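(* Let $(M^n,g)$ be a spin Riemannian manifold of dimension $n$, $F$ a real 2-form on $M^n$, $k_1,k_2\in\mathbb{C}$, and $\hat\nabla_X=\nabla_X+k_1\,\mathrm{cl}(F)\cdot\mathrm{cl}(X)+k_2\,\mathrm{cl}(i_XF)$. Let $\epsilon$ be a spinor with $\hat\nabla\epsilon=0$, and define $$\chi_p(X_1,\dots,X_p)=\frac{i^{[p/2]}}{p!}\sum_\sigma(-1)^{|\sigma|}\langle\epsilon,\mathrm{cl}(X_{\sigma(1)})\cdot\mathrm{cl}(X_{\sigma(2)})\cdots\mathrm{cl}(X_{\sigma(p)})\epsilon\rangle .$$ Then the forms $\chi_p$ form a covariant form hierarchy twisted with $F$, satisfying for every $p$ and every vector field $Y$ $$\begin{aligned} &\nabla_Y\chi_p+a_{p,p+1}\big(\bar k_2-4\bar k_1+(-1)^p(k_2-4k_1)\big)\,i_{i_YF}\chi_{p+1}\\ &\quad+a_{p,p-1}\big(\bar k_2-4\bar k_1+(-1)^{p-1}(k_2-4k_1)\big)\,i_YF\wedge\chi_{p-1}\\ &=\frac1{p+1}\,i_Y\Big(d\chi_p-a_{p,p+1}\big(\bar k_2-4\bar k_1+(-1)^p(k_2-4k_1)\big)\,i_F\chi_{p+1}\\ &\qquad\qquad+2a_{p,p-1}\big(\bar k_2-4\bar k_1+(-1)^{p-1}(k_2-4k_1)\big)\,F\wedge\chi_{p-1}\Big)\\ &\quad-\frac1{n-p+1}\,\alpha_Y\wedge\Big(\delta\chi_p+2a_{p,p+1}\big(\bar k_2-4\bar k_1+(-1)^p(k_2-4k_1)\big)\,F\vee\chi_{p+1}\\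 &\qquad\qquad+a_{p,p-1}\big(\bar k_2-4\bar k_1+(-1)^{p-1}(k_2-4k_1)\big)\,i_F\chi_{p-1}\Big), \end{aligned}$$ where $a_{p,q}=i^{[p/2]-[q/2]}$.
   Context: $\nabla$ is the Levi-Civita connection, also acting on sections of the complex spinor bundle $S$. Clifford conventions: $\mathrm{cl}(X)$ denotes Clifford multiplication by $X$, $\mathrm{cl}(X)\cdot\mathrm{cl}(Y)+\mathrm{cl}(Y)\cdot\mathrm{cl}(X)=2g(X,Y)1$; $S$ carries a pointwise Spin-invariant Hermitian inner product $\langle\cdot,\cdot\rangle$ (linear in the second slot) with $\langle\mathrm{cl}(X)\eta,\epsilon\rangle=\langle\eta,\mathrm{cl}(X)\epsilon\rangle$ for real $X$. With orthonormal coframe $e^i$ and Clifford elements $\Gamma^i$: $\mathrm{cl}(F)=F_{ij}\Gamma^i\Gamma^j$, $\mathrm{cl}(i_XF)=X^iF_{ij}\Gamma^j$ (for $F=\frac12F_{ij}e^i\wedge e^j$). The sum defining $\chi_p$ is over permutations $\sigma$ with sign $(-1)^{|\sigma|}$; $[\cdot]$ is the integer part; forms of degree outside $0,\dots,n$ are zero. $\alpha_Y(X)=g(Y,X)$. $\delta$ is the formal adjoint of $d$ ($(\delta\chi)_{i_2\dots i_p}=-\nabla^{i_1}\chi_{i_1i_2\dots i_p}$). For an $\ell$-form $\chi$ and a $p$-form $\omega$, $$i_\chi\omega=\frac{p}{p!(\ell-1)!}\chi^k{}_{i_1\dots i_{\ell-1}}\omega_{ki_\ell\dots i_{p+\ell-2}}e^{i_1}\wedge\dots\wedge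 e^{i_{p+\ell-2}};$$ in particular for the 1-form $i_YF$, $i_{i_YF}$ is contraction with the dual vector field. The pointwise inner product of $p$-forms is $\langle\chi,\omega\rangle=\frac1{p!}\chi_{i_1\dots i_p}\omega^{i_1\dots i_p}$, and $\vee$ is the adjoint of $\wedge$: $\langle\phi,\omega\vee\chi\rangle=\langle\omega\wedge\phi,\chi\rangle$ for all $\phi$ (zero if $\deg\chi<\deg\omega$), so here $(F\vee\chi)_{i_1\dots}=\frac12F^{jk}\chi_{jki_1\dots}$. Definition: a covariant form hierarchy twisted with a multi-form $F$ is a collection of forms $\chi_p$ satisfying $\nabla^F_Y(\{\chi_p\})=i_Y\mathcal P(F,\{\chi_p\})+\alpha_Y\wedge\mathcal Q(F,\{\chi_p\})$, where $\mathcal P,\mathcal Q$ are form-valued and depend on $F$ and $\{\chi_p\}$, and $\nabla^F$ is a (not necessarily degree preserving) connection on (sums of copies of) $\Lambda^*(M)$ built from the Levi-Civita connection and $F$. *)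

theory Defs
  imports "HOL-Analysis.Analysis" "HOL-Combinatorics.Permutations"
begin

section \<open>Smooth maps on open subsets of \<open>\<real>\<^sup>n\<close>\<close>

primrec Ck_on :: "nat \<Rightarrow> (real^'n \<Rightarrow> 'b::real_normed_vector) \<Rightarrow> (real^'n) set \<Rightarrow> bool" where
  "Ck_on 0 f V \<longleftrightarrow> continuous_on V f"
| "Ck_on (Suc k) f V \<longleftrightarrow>
     f differentiable_on V \<and> (\<forall>v. Ck_on k (\<lambda>u. frechet_derivative f (at u) v) V)"

definition smooth_on :: "(real^'n) set \<Rightarrow> (real^'n \<Rightarrow> 'b::real_normed_vector) \<Rightarrow> bool" where
  "smooth_on V f \<longleftrightarrow> (\<forall>k. Ck_on k f V)"


section \<open>Spin Riemannian manifolds\<close>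

text \<open>
  The manifold is the whole type \<open>'m\<close>, its dimension is \<open>CARD('n)\<close>, and spinors take values in
  \<open>complex^'s\<close>.  The patches \<open>a \<in> patches M\<close> cover the manifold; each carries a coordinate map
  \<open>coord M a\<close>, the coordinate components \<open>metric M a\<close> of the Riemannian metric, and a local
  frame \<open>eframe M a\<close>, where \<open>eframe M a x $ i\<close> is the vector of coordinate components of \<open>e\<^sub>i\<close>
  at \<open>x\<close>.  The matrices \<open>lift M a b\<close> are the transition functions of the spin structure.
  The matrices \<open>gam M i\<close> and the form \<open>herm M\<close> (linear in the second slot) are the Clifford action
  and the Hermitian inner product on the model fibre of the spinor bundle.  All tensor and spinor
  fields below are given by their components with respect to these frames, one family of
  components for each patch.
\<close>

record ('a, 'm, 'n::finite, 's::finite) spin_data =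
  patches :: "'a set"
  patch :: "'a \<Rightarrow> 'm set"
  coord :: "'a \<Rightarrow> 'm \<Rightarrow> real^'n"
  metric :: "'a \<Rightarrow> 'm \<Rightarrow> real^'n^'n"
  eframe :: "'a \<Rightarrow> 'm \<Rightarrow> real^'n^'n"
  lift :: "'a \<Rightarrow> 'a \<Rightarrow> 'm \<Rightarrow> complex^'s^'s"
  gam :: "'n \<Rightarrow> complex^'s^'s"
  herm :: "complex^'s \<Rightarrow> complex^'s \<Rightarrow> complex"

text \<open>The expression of a function in the coordinates of a patch.\<close>

definition in_coord ::
  "('a,'m,'n::finite,'s::finite) spin_data \<Rightarrow> 'a \<Rightarrow> ('m \<Rightarrow> 'b) \<Rightarrow> real^'n \<Rightarrow> 'b" where
  "in_coord M a f = f \<circ> inv_into (patch M a) (coord M a)"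

definition smooth_at_patch ::
  "('a,'m,'n::finite,'s::finite) spin_data \<Rightarrow> 'a \<Rightarrow> ('m \<Rightarrow> 'b::real_normed_vector) \<Rightarrow> bool" where
  "smooth_at_patch M a f \<longleftrightarrow> smooth_on (coord M a ` patch M a) (in_coord M a f)"

definition smooth_atlas ::
  "('a,'m::{t2_space,second_countable_topology},'n::finite,'s::finite) spin_data \<Rightarrow> bool" where
  "smooth_atlas M \<longleftrightarrow>
     (\<Union>a\<in>patches M. patch M a) = UNIV \<and>
     (\<forall>a\<in>patches M. open (patch M a) \<and> open (coord M a ` patch M a) \<and>
        (\<exists>\<psi>. homeomorphism (patch M a) (coord M a ` patch M a) (coord M a) \<psi>)) \<and>
     (\<forall>a\<in>patches M. \<forall>b\<in>patches M.
        smooth_on (coord M a ` (patch M a \<inter> patch M b)) (in_coord M a (coord M b)))"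

definition jacobian ::
  "('a,'m,'n::finite,'s::finite) spin_data \<Rightarrow> 'a \<Rightarrow> 'a \<Rightarrow> 'm \<Rightarrow> real^'n \<Rightarrow> real^'n" where
  "jacobian M a b x = frechet_derivative (in_coord M a (coord M b)) (at (coord M a x))"

definition gdot ::
  "('a,'m,'n::finite,'s::finite) spin_data \<Rightarrow> 'a \<Rightarrow> 'm \<Rightarrow> real^'n \<Rightarrow> real^'n \<Rightarrow> real" where
  "gdot M a x u v = u \<bullet> (metric M a x *v v)"

definition riemannian_metric :: "('a,'m,'n::finite,'s::finite) spin_data \<Rightarrow> bool" where
  "riemannian_metric M \<longleftrightarrow>
     (\<forall>a\<in>patches M. smooth_at_patch M a (metric M a)) \<and>
     (\<forall>a\<in>patches M. \<forall>x\<in>patch M a.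
        (\<forall>u v. gdot M a x u v = gdot M a x v u) \<and> (\<forall>v. v \<noteq> 0 \<longrightarrow> gdot M a x v v > 0)) \<and>
     (\<forall>a\<in>patches M. \<forall>b\<in>patches M. \<forall>x\<in>patch M a \<inter> patch M b. \<forall>u v.
        gdot M a x u v = gdot M b x (jacobian M a b x u) (jacobian M a b x v))"

text \<open>
  \<open>transition M a b x $ i $ j = g(e\<^sup>a\<^sub>i, e\<^sup>b\<^sub>j)\<close>: components with respect to the orthonormal frame of
  \<open>a\<close> are obtained from those with respect to the frame of \<open>b\<close> by applying this matrix.
\<close>

definition transition ::
  "('a,'m,'n::finite,'s::finite) spin_data \<Rightarrow> 'a \<Rightarrow> 'a \<Rightarrow> 'm \<Rightarrow> real^'n^'n" where
  "transition M a b x =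
     (\<chi> i j. gdot M b x (jacobian M a b x (eframe M a x $ i)) (eframe M b x $ j))"

definition oriented_orthonormal_frames :: "('a,'m,'n::finite,'s::finite) spin_data \<Rightarrow> bool" where
  "oriented_orthonormal_frames M \<longleftrightarrow>
     (\<forall>a\<in>patches M. smooth_at_patch M a (eframe M a)) \<and>
     (\<forall>a\<in>patches M. \<forall>x\<in>patch M a. \<forall>i j.
        gdot M a x (eframe M a x $ i) (eframe M a x $ j) = (if i = j then 1 else 0)) \<and>
     (\<forall>a\<in>patches M. \<forall>b\<in>patches M. \<forall>x\<in>patch M a \<inter> patch M b. det (transition M a b x) = 1)"

text \<open>Clifford multiplication by the vector with frame components \<open>v\<close>, and products thereof.\<close>

definition cl :: "('a,'m,'n::finite,'s::finite) spin_data \<Rightarrow> real^'n \<Rightarrow> complex^'s^'s" where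
  "cl M v = (\<Sum>i\<in>UNIV. (v $ i) *\<^sub>R gam M i)"

definition cl_prod ::
  "('a,'m,'n::finite,'s::finite) spin_data \<Rightarrow> (real^'n) list \<Rightarrow> complex^'s^'s" where
  "cl_prod M vs = foldr (\<lambda>v A. cl M v ** A) vs (mat 1)"

text \<open>
  The dimension condition says that the module is irreducible, so it is the fibre of the complex
  spinor bundle.
\<close>

definition spinor_module :: "('a,'m,'n::finite,'s::finite) spin_data \<Rightarrow> bool" where
  "spinor_module M \<longleftrightarrow>
     CARD('s) = 2 ^ (CARD('n) div 2) \<and>
     (\<forall>u v. cl M u ** cl M v + cl M v ** cl M u = mat (of_real (2 * (u \<bullet> v)))) \<and>
     (\<forall>\<eta> \<xi> \<zeta>. herm M \<eta> (\<xi> + \<zeta>) = herm M \<eta> \<xi> + herm M \<eta> \<zeta>) \<and>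
     (\<forall>\<eta> \<xi> z. herm M \<eta> (z *s \<xi>) = z * herm M \<eta> \<xi>) \<and>
     (\<forall>\<eta> \<xi>. herm M \<xi> \<eta> = cnj (herm M \<eta> \<xi>)) \<and>
     (\<forall>\<eta>. \<eta> \<noteq> 0 \<longrightarrow> Re (herm M \<eta> \<eta>) > 0) \<and>
     (\<forall>v \<eta> \<xi>. herm M (cl M v *v \<eta>) \<xi> = herm M \<eta> (cl M v *v \<xi>))"

text \<open>
  The group Spin(n), as the group of even products of unit vectors in the Clifford algebra.  Its
  image in the endomorphisms of the spinor module is a faithful copy, because the even part of the
  complexified Clifford algebra acts faithfully there.  Spin-invariance of \<open>herm M\<close> follows
  from the last clause of \<open>spinor_module\<close>.
\<close>

definition spin_group :: "('a,'m,'n::finite,'s::finite) spin_data \<Rightarrow> (complex^'s^'s) set" where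
  "spin_group M = {cl_prod M vs | vs. even (length vs) \<and> (\<forall>v\<in>set vs. norm v = 1)}"

text \<open>
  A spin structure: smooth lifts of the \<open>SO(n)\<close>-valued transition functions to \<open>Spin(n)\<close> which
  satisfy the cocycle condition.
\<close>

definition spin_structure :: "('a,'m,'n::finite,'s::finite) spin_data \<Rightarrow> bool" where
  "spin_structure M \<longleftrightarrow>
     (\<forall>a\<in>patches M. \<forall>b\<in>patches M.
        smooth_on (coord M a ` (patch M a \<inter> patch M b)) (in_coord M a (lift M a b)) \<and>
        (\<forall>x\<in>patch M a \<inter> patch M b. lift M a b x \<in> spin_group M \<and>
           (\<forall>v. lift M a b x ** cl M v = cl M (transition M a b x *v v) ** lift M a b x))) \<and>
     (\<forall>a\<in>patches M. \<forall>x\<in>patch M a. lift M a a x = mat 1) \<and>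
     (\<forall>a\<in>patches M. \<forall>b\<in>patches M. \<forall>c\<in>patches M. \<forall>x\<in>patch M a \<inter> patch M b \<inter> patch M c.
        lift M a b x ** lift M b c x = lift M a c x)"

definition spin_manifold ::
  "('a,'m::{t2_space,second_countable_topology},'n::finite,'s::finite) spin_data \<Rightarrow> bool" where
  "spin_manifold M \<longleftrightarrow> smooth_atlas M \<and> riemannian_metric M \<and> oriented_orthonormal_frames M \<and>
     spinor_module M \<and> spin_structure M"


section \<open>Vector fields, spinors and differential forms\<close>

definition vector_field ::
  "('a,'m,'n::finite,'s::finite) spin_data \<Rightarrow> ('a \<Rightarrow> 'm \<Rightarrow> real^'n) \<Rightarrow> bool" where
  "vector_field M Y \<longleftrightarrow>
     (\<forall>a\<in>patches M. smooth_at_patch M a (Y a)) \<and>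
     (\<forall>a\<in>patches M. \<forall>b\<in>patches M. \<forall>x\<in>patch M a \<inter> patch M b. Y a x = transition M a b x *v Y b x)"

definition spinor_field ::
  "('a,'m,'n::finite,'s::finite) spin_data \<Rightarrow> ('a \<Rightarrow> 'm \<Rightarrow> complex^'s) \<Rightarrow> bool" where
  "spinor_field M \<epsilon> \<longleftrightarrow>
     (\<forall>a\<in>patches M. smooth_at_patch M a (\<epsilon> a)) \<and>
     (\<forall>a\<in>patches M. \<forall>b\<in>patches M. \<forall>x\<in>patch M a \<inter> patch M b. \<epsilon> a x = lift M a b x *v \<epsilon> b x)"

text \<open>
  A multi-form at a point maps the index list \<open>[i\<^sub>1,\<dots>,i\<^sub>p]\<close> to the orthonormal frame component
  \<open>\<omega>\<^bsub>i\<^sub>1\<dots>i\<^sub>p\<^esub> = \<omega>(e\<^bsub>i\<^sub>1\<^esub>,\<dots>,e\<^bsub>i\<^sub>p\<^esub>)\<close> of its part of degree \<open>p\<close>.  Forms are complex valued.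
  Alternating multi-forms vanish on lists longer than the dimension.
\<close>

type_synonym 'n mform = "'n list \<Rightarrow> complex"
type_synonym ('a, 'm, 'n) mform_field = "'a \<Rightarrow> 'm \<Rightarrow> 'n mform"

definition alternating :: "'n mform \<Rightarrow> bool" where
  "alternating \<omega> \<longleftrightarrow> (\<forall>is \<sigma>. \<sigma> permutes {..<length is} \<longrightarrow>
     \<omega> (permute_list \<sigma> is) = of_int (sign \<sigma>) * \<omega> is)"

definition change_frame :: "real^'n^'n \<Rightarrow> 'n::finite mform \<Rightarrow> 'n mform" where
  "change_frame R \<omega> is = (\<Sum>js | length js = length is.
     (\<Prod>k<length is. of_real (R $ (is ! k) $ (js ! k))) * \<omega> js)"

definition multi_form :: "('a,'m,'n::finite,'s::finite) spin_data \<Rightarrow> ('a,'m,'n) mform_field \<Rightarrow> bool" where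
  "multi_form M \<omega> \<longleftrightarrow>
     (\<forall>a\<in>patches M. \<forall>x\<in>patch M a. alternating (\<omega> a x)) \<and>
     (\<forall>a\<in>patches M. \<forall>is. smooth_at_patch M a (\<lambda>x. \<omega> a x is)) \<and>
     (\<forall>a\<in>patches M. \<forall>b\<in>patches M. \<forall>x\<in>patch M a \<inter> patch M b.
        \<omega> a x = change_frame (transition M a b x) (\<omega> b x))"

definition real_form ::
  "('a,'m,'n::finite,'s::finite) spin_data \<Rightarrow> nat \<Rightarrow> ('a,'m,'n) mform_field \<Rightarrow> bool" where
  "real_form M p \<omega> \<longleftrightarrow> multi_form M \<omega> \<and>
     (\<forall>a\<in>patches M. \<forall>x\<in>patch M a. \<forall>is.
        \<omega> a x is \<in> \<real> \<and> (length is \<noteq> p \<longrightarrow> \<omega> a x is = 0))"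

text \<open>The part of degree \<open>p\<close>; the degree is an integer, and the part of negative degree is zero.\<close>

definition deg_part :: "int \<Rightarrow> 'n mform \<Rightarrow> 'n mform" where
  "deg_part p \<omega> is = (if int (length is) = p then \<omega> is else 0)"


section \<open>Pointwise operations on forms\<close>

definition iprod :: "real^'n \<Rightarrow> 'n::finite mform \<Rightarrow> 'n mform" where
  "iprod v \<omega> is = (\<Sum>j\<in>UNIV. of_real (v $ j) * \<omega> (j # is))"

definition flat :: "real^'n \<Rightarrow> 'n::finite mform" where
  "flat v is = (case is of [i] \<Rightarrow> of_real (v $ i) | _ \<Rightarrow> 0)"

text \<open>
  The three bilinear operations are written for multi-forms.  In \<open>wedge\<close> the summation index
  \<open>k\<close> is the degree of \<open>\<omega>\<close>, so that \<open>(\<alpha> \<and> \<beta>)(X, Y) = \<alpha>(X) \<beta>(Y) - \<alpha>(Y) \<beta>(X)\<close> for 1-forms.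
  In \<open>contract\<close>, which is \<open>i\<^bsub>\<phi>\<^esub>\<omega>\<close>, the summation index \<open>m = l - 1\<close> is one less than the degree
  \<open>l\<close> of \<open>\<phi>\<close>, and \<open>p\<close> is the degree of \<open>\<omega>\<close>, with \<open>p + l - 2\<close> the length of \<open>is\<close>; the sum over
  \<open>\<sigma>\<close> gives the components of \<open>T\<^bsub>i\<^sub>1\<dots>i\<^sub>q\<^esub> e\<^bsup>i\<^sub>1\<^esup> \<and> \<dots> \<and> e\<^bsup>i\<^sub>q\<^esup>\<close>.  Finally \<open>vee\<close> is the adjoint of
  \<open>wedge\<close> for the inner product \<open>1/p! \<chi>\<^bsub>i\<^sub>1\<dots>i\<^sub>p\<^esub> \<omega>\<^bsup>i\<^sub>1\<dots>i\<^sub>p\<^esup>\<close>.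
\<close>

definition wedge :: "'n::finite mform \<Rightarrow> 'n mform \<Rightarrow> 'n mform" where
  "wedge \<omega> \<phi> is = (let q = length is in
     \<Sum>k\<le>q. (\<Sum>\<sigma> | \<sigma> permutes {..<q}. of_int (sign \<sigma>) *
        \<omega> (take k (permute_list \<sigma> is)) * \<phi> (drop k (permute_list \<sigma> is))) / (fact k * fact (q - k)))"

definition contract :: "'n::finite mform \<Rightarrow> 'n mform \<Rightarrow> 'n mform" where
  "contract \<phi> \<omega> is = (let q = length is in
     \<Sum>m\<le>q. (let p = q + 1 - m in of_nat p / (fact p * fact m) *
       (\<Sum>\<sigma> | \<sigma> permutes {..<q}. of_int (sign \<sigma>) * (\<Sum>k\<in>UNIV.
          \<phi> (k # take m (permute_list \<sigma> is)) * \<omega> (k # drop m (permute_list \<sigma> is))))))"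

definition vee :: "'n::finite mform \<Rightarrow> 'n mform \<Rightarrow> 'n mform" where
  "vee \<omega> \<phi> is = (\<Sum>k\<le>CARD('n). (\<Sum>js | length js = k. \<omega> js * \<phi> (js @ is)) / fact k)"


section \<open>Differential operators\<close>

text \<open>Derivative of a function along the vector with frame components \<open>v\<close>.\<close>

definition ddir ::
  "('a,'m,'n::finite,'s::finite) spin_data \<Rightarrow> 'a \<Rightarrow> 'm \<Rightarrow> real^'n \<Rightarrow> ('m \<Rightarrow> 'b::real_normed_vector) \<Rightarrow> 'b" where
  "ddir M a x v f =
     frechet_derivative (in_coord M a f) (at (coord M a x)) (\<Sum>i\<in>UNIV. (v $ i) *\<^sub>R (eframe M a x $ i))"

text \<open>\<open>frame_bracket M a x i j k = g([e\<^sub>i, e\<^sub>j], e\<^sub>k)\<close>\<close>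

definition frame_bracket ::
  "('a,'m,'n::finite,'s::finite) spin_data \<Rightarrow> 'a \<Rightarrow> 'm \<Rightarrow> 'n \<Rightarrow> 'n \<Rightarrow> 'n \<Rightarrow> real" where
  "frame_bracket M a x i j k =
     gdot M a x (ddir M a x (axis i 1) (\<lambda>y. eframe M a y $ j) -
                 ddir M a x (axis j 1) (\<lambda>y. eframe M a y $ i)) (eframe M a x $ k)"

text \<open>
  \<open>levi_civita M a x i j k = g(\<nabla>\<^bsub>e\<^sub>i\<^esub> e\<^sub>j, e\<^sub>k)\<close>, by the Koszul formula in an orthonormal frame.
\<close>

definition levi_civita ::
  "('a,'m,'n::finite,'s::finite) spin_data \<Rightarrow> 'a \<Rightarrow> 'm \<Rightarrow> 'n \<Rightarrow> 'n \<Rightarrow> 'n \<Rightarrow> real" where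
  "levi_civita M a x i j k =
     (frame_bracket M a x i j k - frame_bracket M a x j k i + frame_bracket M a x k i j) / 2"

lemma frame_bracket_skew: "frame_bracket M a x j i k = - frame_bracket M a x i j k"
  by (simp add: frame_bracket_def gdot_def inner_diff_left)

lemma levi_civita_metric: "levi_civita M a x i j k = - levi_civita M a x i k j"
  unfolding levi_civita_def
  using frame_bracket_skew[of M a x i j k] frame_bracket_skew[of M a x j k i]
    frame_bracket_skew[of M a x k i j]
  by (simp add: add_divide_distrib diff_divide_distrib)

lemma levi_civita_torsion_free:
  "levi_civita M a x i j k - levi_civita M a x j i k = frame_bracket M a x i j k"
  unfolding levi_civita_def
  using frame_bracket_skew[of M a x i j k] frame_bracket_skew[of M a x j k i]
    frame_bracket_skew[of M a x k i j]
  by (simp add: add_divide_distrib diff_divide_distrib)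

text \<open>\<open>conn M a x v j k = g(\<nabla>\<^sub>v e\<^sub>j, e\<^sub>k)\<close>\<close>

definition conn ::
  "('a,'m,'n::finite,'s::finite) spin_data \<Rightarrow> 'a \<Rightarrow> 'm \<Rightarrow> real^'n \<Rightarrow> 'n \<Rightarrow> 'n \<Rightarrow> real" where
  "conn M a x v j k = (\<Sum>i\<in>UNIV. (v $ i) * levi_civita M a x i j k)"

definition nabla ::
  "('a,'m,'n::finite,'s::finite) spin_data \<Rightarrow> ('a,'m,'n) mform_field \<Rightarrow> 'a \<Rightarrow> 'm \<Rightarrow> real^'n \<Rightarrow> 'n mform" where
  "nabla M \<omega> a x v is = ddir M a x v (\<lambda>y. \<omega> a y is) -
     (\<Sum>m<length is. \<Sum>k\<in>UNIV. of_real (conn M a x v (is ! m) k) * \<omega> a x (is[m := k]))"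

text \<open>
  The spin connection \<open>\<nabla>\<^sub>v \<epsilon> = v(\<epsilon>) + 1/4 g(e\<^sub>j, \<nabla>\<^sub>v e\<^sub>k) \<Gamma>\<^sup>j \<Gamma>\<^sup>k \<epsilon>\<close>.  The sign is the one for which
  \<open>\<nabla>\<^sub>v (cl(X) \<epsilon>) = cl(\<nabla>\<^sub>v X) \<epsilon> + cl(X) \<nabla>\<^sub>v \<epsilon>\<close> when \<open>\<Gamma>\<^sup>j \<Gamma>\<^sup>k + \<Gamma>\<^sup>k \<Gamma>\<^sup>j = + 2 \<delta>\<^sup>j\<^sup>k\<close>.
\<close>

definition nabla_spinor ::
  "('a,'m,'n::finite,'s::finite) spin_data \<Rightarrow> ('a \<Rightarrow> 'm \<Rightarrow> complex^'s) \<Rightarrow> 'a \<Rightarrow> 'm \<Rightarrow> real^'n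
     \<Rightarrow> complex^'s" where
  "nabla_spinor M \<epsilon> a x v = ddir M a x v (\<epsilon> a) +
     (1/4) *\<^sub>R (\<Sum>j\<in>UNIV. \<Sum>k\<in>UNIV. conn M a x v k j *\<^sub>R (gam M j *v (gam M k *v \<epsilon> a x)))"

text \<open>
  The exterior derivative, by the invariant formula: \<open>d\<omega>(X\<^sub>0,\<dots>,X\<^sub>p)\<close> is the sum of the terms
  \<open>(-1)\<^sup>k X\<^sub>k(\<omega>(\<dots>))\<close>, with \<open>X\<^sub>k\<close> left out, and of \<open>(-1)\<^bsup>k+l\<^esup> \<omega>([X\<^sub>k, X\<^sub>l], \<dots>)\<close> for \<open>k < l\<close>, with
  \<open>X\<^sub>k\<close> and \<open>X\<^sub>l\<close> left out.
\<close>

definition omit :: "nat set \<Rightarrow> 'b list \<Rightarrow> 'b list" where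
  "omit K xs = nths xs (- K)"

definition ext_d ::
  "('a,'m,'n::finite,'s::finite) spin_data \<Rightarrow> ('a,'m,'n) mform_field \<Rightarrow> ('a,'m,'n) mform_field" where
  "ext_d M \<omega> a x is =
     (\<Sum>k<length is. (-1)^k * ddir M a x (axis (is ! k) 1) (\<lambda>y. \<omega> a y (omit {k} is))) +
     (\<Sum>l<length is. \<Sum>k<l. (-1)^(k+l) * (\<Sum>j\<in>UNIV.
        of_real (frame_bracket M a x (is ! k) (is ! l) j) * \<omega> a x (j # omit {k,l} is)))"

definition codiff ::
  "('a,'m,'n::finite,'s::finite) spin_data \<Rightarrow> ('a,'m,'n) mform_field \<Rightarrow> ('a,'m,'n) mform_field" where
  "codiff M \<omega> a x is = - (\<Sum>j\<in>UNIV. nabla M \<omega> a x (axis j 1) (j # is))"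


section \<open>Covariant form hierarchies\<close>

text \<open>
  A connection on multi-forms built from the Levi-Civita connection and a multi-form \<open>F\<close> is
  \<open>\<nabla>\<^sub>Y \<omega> + C(F, Y, \<omega>)\<close>, where \<open>C\<close> is pointwise, linear in \<open>Y\<close> and \<open>\<omega>\<close>, and independent of
  the choice of the oriented orthonormal frame.
\<close>

definition twisting_term :: "('n::finite mform \<Rightarrow> real^'n \<Rightarrow> 'n mform \<Rightarrow> 'n mform) \<Rightarrow> bool" where
  "twisting_term C \<longleftrightarrow> (\<forall>F. alternating F \<longrightarrow>
     (\<forall>v \<omega>. alternating \<omega> \<longrightarrow> alternating (C F v \<omega>)) \<and>
     (\<forall>u v s t \<omega> is. alternating \<omega> \<longrightarrow>
        C F (s *\<^sub>R u + t *\<^sub>R v) \<omega> is = of_real s * C F u \<omega> is + of_real t * C F v \<omega> is) \<and>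
     (\<forall>v \<omega> \<phi> z w is. alternating \<omega> \<longrightarrow> alternating \<phi> \<longrightarrow>
        C F v (\<lambda>js. z * \<omega> js + w * \<phi> js) is = z * C F v \<omega> is + w * C F v \<phi> is) \<and>
     (\<forall>R v \<omega>. orthogonal_matrix R \<longrightarrow> det R = 1 \<longrightarrow> alternating \<omega> \<longrightarrow>
        C (change_frame R F) (R *v v) (change_frame R \<omega>) = change_frame R (C F v \<omega>)))"

definition twisted_nabla ::
  "('a,'m,'n::finite,'s::finite) spin_data \<Rightarrow> ('n mform \<Rightarrow> real^'n \<Rightarrow> 'n mform \<Rightarrow> 'n mform) \<Rightarrow>
   ('a,'m,'n) mform_field \<Rightarrow> ('a,'m,'n) mform_field \<Rightarrow> 'a \<Rightarrow> 'm \<Rightarrow> real^'n \<Rightarrow> 'n mform" where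
  "twisted_nabla M C F \<omega> a x v is = nabla M \<omega> a x v is + C (F a x) v (\<omega> a x) is"

text \<open>
  The collection \<open>{\<chi>\<^sub>p}\<close> is encoded as the single multi-form \<open>X\<close> with parts \<open>\<chi>\<^sub>p\<close>, and likewise
  \<open>P F X\<close> and \<open>Q F X\<close>.  The latter are uniquely determined by the defining equation, whose left
  side is tensorial in \<open>Y\<close>, so their smoothness and their independence of the frame are automatic.
\<close>

definition covariant_form_hierarchy ::
  "('a,'m,'n::finite,'s::finite) spin_data \<Rightarrow> ('n mform \<Rightarrow> real^'n \<Rightarrow> 'n mform \<Rightarrow> 'n mform) \<Rightarrow>
   (('a,'m,'n) mform_field \<Rightarrow> ('a,'m,'n) mform_field \<Rightarrow> ('a,'m,'n) mform_field) \<Rightarrow>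
   (('a,'m,'n) mform_field \<Rightarrow> ('a,'m,'n) mform_field \<Rightarrow> ('a,'m,'n) mform_field) \<Rightarrow>
   ('a,'m,'n) mform_field \<Rightarrow> ('a,'m,'n) mform_field \<Rightarrow> bool" where
  "covariant_form_hierarchy M C P Q F X \<longleftrightarrow>
     multi_form M F \<and> multi_form M X \<and> twisting_term C \<and>
     (\<forall>a\<in>patches M. \<forall>x\<in>patch M a. alternating (P F X a x) \<and> alternating (Q F X a x)) \<and>
     (\<forall>Y. vector_field M Y \<longrightarrow> (\<forall>a\<in>patches M. \<forall>x\<in>patch M a.
        twisted_nabla M C F X a x (Y a x) =
        (\<lambda>is. iprod (Y a x) (P F X a x) is + wedge (flat (Y a x)) (Q F X a x) is)))"


section \<open>The connection on spinors and the form bilinears\<close>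

text \<open>Clifford action of a 1-form, and of a 2-form by \<open>cl(F) = F\<^sub>i\<^sub>j \<Gamma>\<^sup>i \<Gamma>\<^sup>j\<close> (no factor 1/2).\<close>

definition cl1 ::
  "('a,'m,'n::finite,'s::finite) spin_data \<Rightarrow> 'n mform \<Rightarrow> complex^'s \<Rightarrow> complex^'s" where
  "cl1 M \<omega> \<eta> = (\<Sum>j\<in>UNIV. \<omega> [j] *s (gam M j *v \<eta>))"

definition cl2 ::
  "('a,'m,'n::finite,'s::finite) spin_data \<Rightarrow> 'n mform \<Rightarrow> complex^'s \<Rightarrow> complex^'s" where
  "cl2 M \<omega> \<eta> = (\<Sum>i\<in>UNIV. \<Sum>j\<in>UNIV. \<omega> [i, j] *s (gam M i *v (gam M j *v \<eta>)))"

definition nabla_hat ::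
  "('a,'m,'n::finite,'s::finite) spin_data \<Rightarrow> complex \<Rightarrow> complex \<Rightarrow> ('a,'m,'n) mform_field \<Rightarrow>
   ('a \<Rightarrow> 'm \<Rightarrow> complex^'s) \<Rightarrow> 'a \<Rightarrow> 'm \<Rightarrow> real^'n \<Rightarrow> complex^'s" where
  "nabla_hat M k1 k2 F \<epsilon> a x v = nabla_spinor M \<epsilon> a x v +
     k1 *s cl2 M (F a x) (cl M v *v \<epsilon> a x) + k2 *s cl1 M (iprod v (F a x)) (\<epsilon> a x)"

definition parallel_spinor ::
  "('a,'m,'n::finite,'s::finite) spin_data \<Rightarrow> complex \<Rightarrow> complex \<Rightarrow> ('a,'m,'n) mform_field \<Rightarrow>
   ('a \<Rightarrow> 'm \<Rightarrow> complex^'s) \<Rightarrow> bool" where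
  "parallel_spinor M k1 k2 F \<epsilon> \<longleftrightarrow> spinor_field M \<epsilon> \<and>
     (\<forall>a\<in>patches M. \<forall>x\<in>patch M a. \<forall>v. nabla_hat M k1 k2 F \<epsilon> a x v = 0)"

definition bilinear ::
  "('a,'m,'n::finite,'s::finite) spin_data \<Rightarrow> complex^'s \<Rightarrow> (real^'n) list \<Rightarrow> complex" where
  "bilinear M \<eta> vs = (let p = length vs in \<i> ^ (p div 2) / fact p *
     (\<Sum>\<sigma> | \<sigma> permutes {..<p}. of_int (sign \<sigma>) *
        herm M \<eta> (cl_prod M (permute_list \<sigma> vs) *v \<eta>)))"

text \<open>The multi-form with parts \<open>\<chi>\<^sub>p\<close>, and the single \<open>\<chi>\<^sub>p\<close>.\<close>

definition bilinears ::
  "('a,'m,'n::finite,'s::finite) spin_data \<Rightarrow> ('a \<Rightarrow> 'm \<Rightarrow> complex^'s) \<Rightarrow> ('a,'m,'n) mform_field" where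
  "bilinears M \<epsilon> a x is = bilinear M (\<epsilon> a x) (map (\<lambda>i. axis i 1) is)"

definition chi_form ::
  "('a,'m,'n::finite,'s::finite) spin_data \<Rightarrow> ('a \<Rightarrow> 'm \<Rightarrow> complex^'s) \<Rightarrow> int \<Rightarrow>
   ('a,'m,'n) mform_field" where
  "chi_form M \<epsilon> p a x = deg_part p (bilinears M \<epsilon> a x)"

definition acoef :: "int \<Rightarrow> int \<Rightarrow> complex" where
  "acoef p q = \<i> powi (p div 2 - q div 2)"

definition kcoef :: "complex \<Rightarrow> complex \<Rightarrow> int \<Rightarrow> complex" where
  "kcoef k1 k2 p = cnj k2 - 4 * cnj k1 + (-1) powi p * (k2 - 4 * k1)"

text \<open>
  The twisting term of \<open>\<nabla>\<^sup>F\<close> and the forms \<open>P\<close> and \<open>Q\<close> of the hierarchy of bilinears, in terms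
  of an arbitrary multi-form \<open>X\<close> with parts \<open>\<chi>\<^sub>p\<close>.  On lists of length \<open>p + 1\<close> the form \<open>P\<close> belongs
  to the equation for \<open>\<nabla>\<chi>\<^sub>p\<close>, and on lists of length \<open>p - 1\<close> the form \<open>Q\<close> does.
\<close>

definition hier_C ::
  "complex \<Rightarrow> complex \<Rightarrow> 'n::finite mform \<Rightarrow> real^'n \<Rightarrow> 'n mform \<Rightarrow> 'n mform" where
  "hier_C k1 k2 F v X is = (let p = int (length is) in
     acoef p (p+1) * kcoef k1 k2 p * contract (iprod v F) (deg_part (p+1) X) is +
     acoef p (p-1) * kcoef k1 k2 (p-1) * wedge (iprod v F) (deg_part (p-1) X) is)"

definition hier_P ::
  "('a,'m,'n::finite,'s::finite) spin_data \<Rightarrow> complex \<Rightarrow> complex \<Rightarrow> ('a,'m,'n) mform_field \<Rightarrow>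
   ('a,'m,'n) mform_field \<Rightarrow> ('a,'m,'n) mform_field" where
  "hier_P M k1 k2 F X a x is = (let p = int (length is) - 1 in 1 / of_int (p+1) *
     (ext_d M (\<lambda>a x. deg_part p (X a x)) a x is -
      acoef p (p+1) * kcoef k1 k2 p * contract (F a x) (deg_part (p+1) (X a x)) is +
      2 * acoef p (p-1) * kcoef k1 k2 (p-1) * wedge (F a x) (deg_part (p-1) (X a x)) is))"

definition hier_Q ::
  "('a,'m,'n::finite,'s::finite) spin_data \<Rightarrow> complex \<Rightarrow> complex \<Rightarrow> ('a,'m,'n) mform_field \<Rightarrow>
   ('a,'m,'n) mform_field \<Rightarrow> ('a,'m,'n) mform_field" where
  "hier_Q M k1 k2 F X a x is = (let p = int (length is) + 1 in
     - 1 / of_int (int CARD('n) - p + 1) *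
     (codiff M (\<lambda>a x. deg_part p (X a x)) a x is +
      2 * acoef p (p+1) * kcoef k1 k2 p * vee (F a x) (deg_part (p+1) (X a x)) is +
      acoef p (p-1) * kcoef k1 k2 (p-1) * contract (F a x) (deg_part (p-1) (X a x)) is))"

end

theory Submission
  imports Defs
begin

text \<open>
  Parallelism gives \<open>\<nabla>\<^sub>v \<epsilon> = - k\<^sub>1 cl(v) cl(F) \<epsilon> - (k\<^sub>2 - 4 k\<^sub>1) cl(i\<^sub>v F) \<epsilon>\<close>, because
  \<open>[cl(F), cl(v)] = - 4 cl(i\<^sub>v F)\<close>.  Clifford multiplication of an antisymmetrised product by a vector
  is exterior plus (or minus) interior multiplication.  Hence the first term contributes to
  \<open>\<nabla>\<^sub>v \<chi>\<^sub>p\<close> an expression \<open>i\<^sub>v P + v \<and> Q\<close> with \<open>P\<close>, \<open>Q\<close> independent of \<open>v\<close>, and the second one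
  exactly the terms that twist the connection.  So \<open>\<nabla>\<^sup>F\<^sub>v \<chi>\<^sub>p = i\<^sub>v P + v \<and> Q\<close>, and \<open>P\<close> and \<open>Q\<close> are
  read off by skew-symmetrising and by tracing this equation.
\<close>

section \<open>Antisymmetrisation of multi-linear forms\<close>

text \<open>Wedge with a 1-form, contraction with a 2-form, exterior derivative and connection term
  are all brought to one shape, e^i \<and> T_i (\<open>ext1\<close>). Two identities then carry the
  reading off: e^i \<and> i_{e_i} P = (p+1) P while e^i \<and> e^i \<and> Q = 0; and, after
  contraction with e_i, P(e_i, e_i, ...) = 0 while e^i \<and> Q yields (n-p+1) Q. These are the two
  denominators.

  Put \<kappa> = k2 - 4 k1. The derivative of \<epsilon> enters both slots of the Hermitian form. In
  the first slot the constant is conjugated, F being real; in the second the vector has to pass p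
  Clifford factors, which gives (-1)^p and reverses the exterior part against the interior one.
  Hence cnj \<kappa> + (-1)^p \<kappa> at \<open>contract\<close> and cnj \<kappa> - (-1)^p \<kappa>
  at \<open>wedge\<close>; the a_{p,q} only compare the factors i^[p/2] of different degrees.

  The trace breaks down at p = n + 1, where its factor is zero; in the hierarchy such degrees are
  settled by alternation, since all components beyond degree n vanish.\<close>

lemma omit_Nil [simp]: "omit K [] = []"
  by (simp add: omit_def)

lemma omit_Cons_0 [simp]: "omit {0} (x # xs) = xs"
  by (simp add: omit_def nths_Cons nths_all)

lemma omit_Cons_Suc [simp]: "omit {Suc m} (x # xs) = x # omit {m} xs"
proof -
  have "{j. Suc j \<in> - {Suc m}} = - {m}" by auto
  then show ?thesis by (simp add: omit_def nths_Cons)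
qed

text \<open>Deleting the later position first leaves the earlier one with its own index; this turns
  the pair deletions in \<open>ext_d\<close> into successive single ones.\<close>

lemma omit_2: "k < l \<Longrightarrow> omit {k, l} xs = omit {k} (omit {l} xs)"
proof (induction xs arbitrary: k l)
  case (Cons x xs)
  obtain l' where l: "l = Suc l'" using Cons.prems by (cases l) auto
  show ?case
  proof (cases k)
    case 0
    have "{j. Suc j \<in> - {0, Suc l'}} = - {l'}" by auto
    then have "omit {0, Suc l'} (x # xs) = omit {l'} xs"
      by (simp add: omit_def nths_Cons)
    then show ?thesis by (simp add: 0 l)
  next
    case (Suc k')
    have "{j. Suc j \<in> - {Suc k', Suc l'}} = - {k', l'}" by auto
    then have "omit {Suc k', Suc l'} (x # xs) = x # omit {k', l'} xs"
      by (simp add: omit_def nths_Cons)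
    then show ?thesis using Cons.IH[of k' l'] Cons.prems by (simp add: Suc l)
  qed
qed simp

lemma length_omit [simp]: "m < length xs \<Longrightarrow> length (omit {m} xs) = length xs - 1"
proof (induction xs arbitrary: m)
  case (Cons x xs)
  then show ?case by (cases m) (auto simp: less_Suc_eq_0_disj)
qed simp

lemma nth_omit:
  "m < length xs \<Longrightarrow> i < length xs - 1 \<Longrightarrow> omit {m} xs ! i = xs ! (if i < m then i else Suc i)"
proof (induction xs arbitrary: m i)
  case (Cons x xs)
  then show ?case by (cases m; cases i) auto
qed simp

lemma omit_append: "omit {length xs} (xs @ y # ys) = xs @ ys"
  by (induction xs) auto

section \<open>Alternating multi-forms and criteria by transpositions\<close>

lemma permutes_finite_permutation: "finite S \<Longrightarrow> p permutes S \<Longrightarrow> permutation p"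
  by (auto simp: permutation_permutes)

lemma permute_list_transpose:
  assumes "i < length xs" "j < length xs"
  shows "permute_list (Transposition.transpose i j) xs = xs[i := xs ! j, j := xs ! i]"
  using assms by (intro nth_equalityI) (auto simp: permute_list_def Transposition.transpose_def nth_list_update)

lemma alternatingD:
  "alternating \<omega> \<Longrightarrow> \<sigma> permutes {..<length is} \<Longrightarrow> \<omega> (permute_list \<sigma> is) = of_int (sign \<sigma>) * \<omega> is"
  by (simp add: alternating_def)

lemma alternating_swap:
  assumes "alternating \<omega>" "i < length is" "j < length is" "i \<noteq> j"
  shows "\<omega> (is[i := is ! j, j := is ! i]) = - \<omega> is"
  using alternatingD[OF assms(1), of "Transposition.transpose i j" "is"] assms
  by (simp add: permute_list_transpose permutes_swap_id sign_swap_id)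

lemma alternating_not_distinct:
  assumes "alternating \<omega>" "\<not> distinct is"
  shows "\<omega> is = 0"
proof -
  obtain i j where "i < length is" "j < length is" "i \<noteq> j" "is ! i = is ! j"
    using assms(2) by (auto simp: distinct_conv_nth)
  moreover from this have "is[i := is ! j, j := is ! i] = is"
    by (metis list_update_id)
  ultimately show ?thesis
    using alternating_swap[OF assms(1), of i "is" j] by simp
qed

text \<open>By pigeonhole. Together with the alternation of all terms this settles the degrees above
  n, where the divisor n - p + 1 may vanish.\<close>

lemma alternating_long:
  fixes \<omega> :: "'n::finite mform"
  assumes "alternating \<omega>" "length is > CARD('n)"
  shows "\<omega> is = 0"
proof (rule alternating_not_distinct[OF assms(1)])
  show "\<not> distinct is"
    using assms(2) by (metis card_mono distinct_card finite leD subset_UNIV)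
qed

lemma alternating_swapI:
  assumes "\<And>is i j. i < length is \<Longrightarrow> j < length is \<Longrightarrow> i \<noteq> j \<Longrightarrow>
    \<omega> (is[i := is ! j, j := is ! i]) = - \<omega> is"
  shows "alternating \<omega>"
  unfolding alternating_def
proof (intro allI impI)
  fix "is" :: "'a list" and \<sigma>
  assume s: "\<sigma> permutes {..<length is}"
  define n where "n = length is"
  have "finite {..<n}" by simp
  from s have "\<sigma> permutes {..<n}" by (simp add: n_def)
  \<comment> \<open>The induction ranges over all lists of length n, since composing with a
    transposition uses the hypothesis at the transposed list.\<close>
  from this \<open>finite {..<n}\<close>
  have "\<forall>js. length js = n \<longrightarrow> \<omega> (permute_list \<sigma> js) = of_int (sign \<sigma>) * \<omega> js"
  proof (induction rule: permutes_induct)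
    case id
    then show ?case by simp
  next
    case (swap a b p)
    show ?case
    proof (intro allI impI)
      fix js :: "'a list"
      assume l: "length js = n"
      have "\<omega> (permute_list (Transposition.transpose a b \<circ> p) js) = \<omega> (permute_list p (permute_list (Transposition.transpose a b) js))"
        using swap l by (subst permute_list_compose) (auto intro: permutes_swap_id)
      also have "\<dots> = of_int (sign p) * \<omega> (permute_list (Transposition.transpose a b) js)"
        using swap l by simp
      also have "\<dots> = of_int (sign p) * (- \<omega> js)"
        using swap l assms[of a js b] by (simp add: permute_list_transpose)
      finally show "\<omega> (permute_list (Transposition.transpose a b \<circ> p) js) = of_int (sign (Transposition.transpose a b \<circ> p)) * \<omega> js"
        using swap permutes_finite_permutation[OF _ swap(4)]
        by (simp add: sign_compose permutation_swap_id sign_swap_id)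
    qed
  qed
  then show "\<omega> (permute_list \<sigma> is) = of_int (sign \<sigma>) * \<omega> is"
    by (simp add: n_def)
qed

text \<open>A distant swap is an odd number of neighbour swaps: in \<open>far\<close>, crossing one
  more entry adds two neighbour swaps around the shorter swap. Clifford relations give only
  neighbour swaps, hence this form.\<close>

lemma alternating_adjacentI:
  assumes adj: "\<And>xs x y ys. \<omega> (xs @ y # x # ys) = - \<omega> (xs @ x # y # ys)"
  shows "alternating \<omega>"
proof (rule alternating_swapI)
  have far: "\<omega> (xs @ y # zs @ x # ys) = - \<omega> (xs @ x # zs @ y # ys)" for xs x y ys zs
  proof (induction zs arbitrary: xs)
    case Nil
    show ?case using adj[of xs y x ys] by simp
  next
    case (Cons z zs)
    have "\<omega> (xs @ y # (z # zs) @ x # ys) = - \<omega> ((xs @ [z]) @ y # zs @ x # ys)"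
      using adj[of xs z y] by simp
    also have "\<dots> = \<omega> (xs @ z # x # zs @ y # ys)"
      using Cons.IH[of "xs @ [z]"] by simp
    finally show ?case using adj[of xs x z] by simp
  qed
  have lt: "\<omega> (is[i := is ! j, j := is ! i]) = - \<omega> is" if "i < j" "j < length is" for "is" i j
  proof -
    define xs zs ys where "xs = take i is" and "zs = take (j - i - 1) (drop (Suc i) is)"
      and "ys = drop (Suc j) is"
    have e: "is = xs @ is ! i # zs @ is ! j # ys"
    proof -
      have "drop (Suc i) is = zs @ drop (j - i - 1) (drop (Suc i) is)"
        unfolding zs_def by (rule append_take_drop_id[symmetric])
      also have "drop (j - i - 1) (drop (Suc i) is) = drop j is"
        using that by simp
      also have "drop j is = is ! j # ys"
        using that by (simp add: ys_def Cons_nth_drop_Suc)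
      finally show ?thesis
        using that unfolding xs_def by (metis id_take_nth_drop less_trans)
    qed
    have l: "length xs = i" "length zs = j - i - 1" using that by (auto simp: xs_def zs_def)
    have "is[i := is ! j, j := is ! i] = xs @ is ! j # zs @ is ! i # ys"
    proof -
      have "(xs @ u # zs @ w # ys)[i := w', j := u'] = xs @ w' # zs @ u' # ys" for u w u' w'
        using l that by (auto simp: list_update_append Suc_diff_Suc split: nat.splits)
      then show ?thesis by (metis e)
    qed
    then show ?thesis using far[of xs "is ! j" zs "is ! i" ys] e by simp
  qed
  fix "is" :: "'a list" and i j
  assume ij: "i < length is" "j < length is" "i \<noteq> j"
  show "\<omega> (is[i := is ! j, j := is ! i]) = - \<omega> is"
  proof (cases "i < j")
    case True
    then show ?thesis using lt ij by simp
  next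
    case False
    then have "\<omega> (is[j := is ! i, i := is ! j]) = - \<omega> is"
      using lt[of j i "is"] ij by simp
    then show ?thesis using ij(3) by (simp add: list_update_swap)
  qed
qed

section \<open>Antisymmetrisation and its expansion in the first slot\<close>

definition alt :: "('n list \<Rightarrow> complex) \<Rightarrow> 'n mform" where
  "alt T is = (\<Sum>\<sigma> | \<sigma> permutes {..<length is}. of_int (sign \<sigma>) * T (permute_list \<sigma> is))"

text \<open>This is \<open>e\<^sup>i \<and> T\<^sub>i\<close>, summed over the coframe.\<close>

definition ext1 :: "('n \<Rightarrow> 'n mform) \<Rightarrow> 'n mform" where
  "ext1 T is = (\<Sum>m<length is. (-1) ^ m * T (is ! m) (omit {m} is))"

lemma alt_Nil [simp]: "alt T [] = T []"
  by (simp add: alt_def)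

text \<open>\<open>permute_list\<close> is a right action, so permuting the slots of T multiplies
  \<sigma> on the right, whereas permuting the indices, as in \<open>alternating_alt\<close>,
  multiplies it on the left. Either way the sum over the group is reindexed.\<close>

lemma alt_permute:
  assumes r: "\<rho> permutes {..<length is}"
  shows "alt (\<lambda>js. T (permute_list \<rho> js)) is = of_int (sign \<rho>) * alt T is"
proof -
  have P: "permutation \<sigma>" if "\<sigma> permutes {..<length is}" for \<sigma>
    using that permutes_finite_permutation by blast
  have "of_int (sign \<rho>) * alt T is =
      (\<Sum>\<sigma> | \<sigma> permutes {..<length is}. of_int (sign \<rho>) * (of_int (sign (\<sigma> \<circ> \<rho>)) * T (permute_list (\<sigma> \<circ> \<rho>) is)))"
    unfolding alt_def sum_distrib_left by (rule sum_permutations_compose_right[OF r])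
  also have "\<dots> = alt (\<lambda>js. T (permute_list \<rho> js)) is"
    unfolding alt_def
  proof (rule sum.cong[OF refl], clarify)
    fix \<sigma> assume "\<sigma> permutes {..<length is}"
    then show "of_int (sign \<rho>) * (of_int (sign (\<sigma> \<circ> \<rho>)) * T (permute_list (\<sigma> \<circ> \<rho>) is)) =
        of_int (sign \<sigma>) * T (permute_list \<rho> (permute_list \<sigma> is))"
      using P[OF r] P[of \<sigma>] permute_list_compose[OF r, of \<sigma>]
      by (simp add: sign_compose mult.assoc[symmetric] mult.commute flip: of_int_mult)
  qed
  finally show ?thesis by simp
qed

lemma alternating_alt: "alternating (alt T)"
  unfolding alternating_def
proof (intro allI impI)
  fix "is" :: "'a list" and \<rho>
  assume r: "\<rho> permutes {..<length is}"
  have P: "permutation \<sigma>" if "\<sigma> permutes {..<length is}" for \<sigma>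
    using that permutes_finite_permutation by blast
  have "of_int (sign \<rho>) * alt T is =
      (\<Sum>\<sigma> | \<sigma> permutes {..<length is}. of_int (sign \<rho>) * (of_int (sign (\<rho> \<circ> \<sigma>)) * T (permute_list (\<rho> \<circ> \<sigma>) is)))"
    unfolding alt_def sum_distrib_left by (rule setum_permutations_compose_left[OF r])
  also have "\<dots> = alt T (permute_list \<rho> is)"
    unfolding alt_def length_permute_list
  proof (rule sum.cong[OF refl], clarify)
    fix \<sigma> assume "\<sigma> permutes {..<length is}"
    then show "of_int (sign \<rho>) * (of_int (sign (\<rho> \<circ> \<sigma>)) * T (permute_list (\<rho> \<circ> \<sigma>) is)) =
        of_int (sign \<sigma>) * T (permute_list \<sigma> (permute_list \<rho> is))"
      using P[OF r] P[of \<sigma>] permute_list_compose[of \<sigma> "is" \<rho>]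
      by (simp add: sign_compose mult.assoc[symmetric] flip: of_int_mult)
  qed
  finally show "alt T (permute_list \<rho> is) = of_int (sign \<rho>) * alt T is" by simp
qed

lemma alt_alternating: "alternating \<omega> \<Longrightarrow> alt \<omega> is = fact (length is) * \<omega> is"
proof -
  assume "alternating \<omega>"
  then have "alt \<omega> is = (\<Sum>\<sigma> | \<sigma> permutes {..<length is}. \<omega> is)"
    unfolding alt_def
    by (intro sum.cong) (auto simp: alternatingD mult.assoc[symmetric] simp flip: of_int_mult)
  then show ?thesis by (simp add: card_permutations)
qed

lemma alt_cong:
  assumes "\<And>js. length js = length is \<Longrightarrow> set js = set is \<Longrightarrow> T js = U js"
  shows "alt T is = alt U is"
  unfolding alt_def by (intro sum.cong refl) (simp add: assms)

lemma alt_cmult: "alt (\<lambda>js. c * T js) is = c * alt T is"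
  unfolding alt_def sum_distrib_left by (intro sum.cong refl) (simp add: mult_ac)

lemma alt_add: "alt (\<lambda>js. T js + U js) is = alt T is + alt U is"
  unfolding alt_def sum.distrib[symmetric] by (intro sum.cong refl) (simp add: algebra_simps)

lemma alt_sum: "alt (\<lambda>js. \<Sum>i\<in>I. T i js) is = (\<Sum>i\<in>I. alt (T i) is)"
  unfolding alt_def sum_distrib_left by (rule sum.swap)

text \<open>The cycle moving entry m to the front, built from m neighbour transpositions. One \<rho>
  serves all lists of length p, and its value at 0 is recorded because it identifies m in the coset
  decomposition of \<open>alt_expand\<close>.\<close>

lemma ex_front_cycle:
  assumes "m < p"
  shows "\<exists>\<rho>. \<rho> permutes {..<p} \<and> sign \<rho> = (-1) ^ m \<and> \<rho> 0 = m \<and>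
    (\<forall>is :: 'b list. length is = p \<longrightarrow> permute_list \<rho> is = is ! m # omit {m} is)"
  using assms
proof (induction m)
  case 0
  have "is = is ! 0 # omit {0} is" if "length is = p" for "is" :: "'b list"
    using that 0 by (cases "is") auto
  then show ?case using permutes_id[of "{..<p}"] by (intro exI[of _ id]) (simp add: id_def)
next
  case (Suc m)
  then obtain \<rho> where r: "\<rho> permutes {..<p}" "sign \<rho> = (-1) ^ m" "\<rho> 0 = m"
    and e: "\<And>is :: 'b list. length is = p \<Longrightarrow> permute_list \<rho> is = is ! m # omit {m} is"
    by auto
  let ?t = "Transposition.transpose m (Suc m)"
  have t: "?t permutes {..<p}" using Suc.prems by (simp add: permutes_swap_id)
  have "permute_list (?t \<circ> \<rho>) is = is ! Suc m # omit {Suc m} is" if l: "length is = p" for "is" :: "'b list"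
  proof -
    have "permute_list (?t \<circ> \<rho>) is = permute_list \<rho> (permute_list ?t is)"
      using r(1) l by (simp add: permute_list_compose)
    also have "\<dots> = permute_list ?t is ! m # omit {m} (permute_list ?t is)"
      by (rule e) (simp add: l)
    also have "permute_list ?t is ! m = is ! Suc m"
      using t l Suc.prems by (simp add: permute_list_nth)
    also have "omit {m} (permute_list ?t is) = omit {Suc m} is"
      using t l Suc.prems
      by (intro nth_equalityI) (auto simp: nth_omit permute_list_nth Transposition.transpose_def less_Suc_eq)
    finally show ?thesis .
  qed
  moreover have "sign (?t \<circ> \<rho>) = (-1) ^ Suc m"
    using r permutes_finite_permutation[OF _ r(1)]
    by (simp add: sign_compose permutation_swap_id sign_swap_id)
  moreover have "(?t \<circ> \<rho>) permutes {..<p}" using r(1) t by (rule permutes_compose)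
  ultimately show ?case using r(3) by (metis o_apply transpose_apply_first)
qed

lemma alternating_front:
  assumes "alternating \<omega>" "m < length is"
  shows "\<omega> (is ! m # omit {m} is) = (-1) ^ m * \<omega> is"
  using ex_front_cycle[OF assms(2)] alternatingD[OF assms(1)] by (metis of_int_minus of_int_1 of_int_power)

text \<open>The embedding of the symmetric group on p letters as the stabiliser of 0 in that on p +
  1 letters.\<close>

definition lift_perm :: "(nat \<Rightarrow> nat) \<Rightarrow> nat \<Rightarrow> nat" where
  "lift_perm \<tau> k = (case k of 0 \<Rightarrow> 0 | Suc j \<Rightarrow> Suc (\<tau> j))"

lemma lift_perm_comp: "lift_perm (f \<circ> g) = lift_perm f \<circ> lift_perm g"
  by (auto simp: lift_perm_def fun_eq_iff split: nat.splits)

lemma lift_perm_id: "lift_perm id = id"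
  by (auto simp: lift_perm_def fun_eq_iff split: nat.splits)

lemma lift_perm_transpose: "lift_perm (Transposition.transpose a b) = Transposition.transpose (Suc a) (Suc b)"
  by (auto simp: lift_perm_def Transposition.transpose_def fun_eq_iff split: nat.splits)

lemma lift_perm_props:
  assumes "\<tau> permutes {..<p}"
  shows "lift_perm \<tau> permutes {..<Suc p} \<and> sign (lift_perm \<tau>) = sign \<tau>"
  using assms finite_lessThan[of p]
proof (induction rule: permutes_induct)
  case id
  show ?case unfolding lift_perm_id using permutes_id by blast
next
  case (swap a b q)
  have t: "Transposition.transpose (Suc a) (Suc b) permutes {..<Suc p}"
    using swap by (simp add: permutes_swap_id)
  have "permutation q" "permutation (lift_perm q)"
    using swap permutes_finite_permutation by blast+
  with swap t show ?case
    unfolding lift_perm_comp lift_perm_transpose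
    by (metis permutes_compose sign_compose permutation_swap_id sign_swap_id Suc_inject)
qed

lemma permute_list_lift_perm:
  assumes "\<tau> permutes {..<length is}"
  shows "permute_list (lift_perm \<tau>) (i # is) = i # permute_list \<tau> is"
  using lift_perm_props[OF assms]
  by (intro nth_equalityI) (auto simp: permute_list_def lift_perm_def nth_Cons simp del: upt_Suc split: nat.splits)

text \<open>The analogue of the expansion of a determinant along a row.\<close>

lemma alt_expand:
  assumes "is \<noteq> []"
  shows "alt T is = ext1 (\<lambda>i. alt (\<lambda>js. T (i # js))) is"
proof -
  obtain p where p: "length is = Suc p" using assms by (cases "is") auto
  define \<rho> where "\<rho> m = (SOME \<rho>. \<rho> permutes {..<Suc p} \<and> sign \<rho> = (-1) ^ m \<and> \<rho> 0 = m \<and>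
    (\<forall>is :: 'a list. length is = Suc p \<longrightarrow> permute_list \<rho> is = is ! m # omit {m} is))" for m
  have r: "\<rho> m permutes {..<Suc p}" "sign (\<rho> m) = (-1) ^ m" "\<rho> m 0 = m"
      "permute_list (\<rho> m) is = is ! m # omit {m} is" if "m < Suc p" for m
    using someI_ex[OF ex_front_cycle[OF that]] p unfolding \<rho>_def by auto
  let ?A = "{..<Suc p} \<times> {\<tau>. \<tau> permutes {..<p}}"
  \<comment> \<open>Coset decomposition by the stabiliser of 0: a permutation is the front cycle of
    its value at 0, composed with a lifted one. Injectivity together with (p+1) p! = (p+1)! gives
    surjectivity by counting.\<close>
  define h where "h = (\<lambda>(m, \<tau>). \<rho> m \<circ> lift_perm \<tau>)"
  have into: "h ` ?A \<subseteq> {\<sigma>. \<sigma> permutes {..<Suc p}}"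
    using r lift_perm_props by (auto simp: h_def intro!: permutes_compose)
  have inj: "inj_on h ?A"
  proof (rule inj_onI, clarify)
    fix m \<tau> m' \<tau>'
    assume m: "m < Suc p" "m' < Suc p" and h: "h (m, \<tau>) = h (m', \<tau>')"
    have "h (m, \<tau>) 0 = m" "h (m', \<tau>') 0 = m'"
      using r m by (auto simp: h_def lift_perm_def)
    then have mm: "m = m'" using h by simp
    then have "\<rho> m (lift_perm \<tau> k) = \<rho> m (lift_perm \<tau>' k)" for k
      using h by (auto simp: h_def fun_eq_iff)
    then have "lift_perm \<tau> k = lift_perm \<tau>' k" for k
      using permutes_inj[OF r(1)[OF m(1)]] by (simp add: inj_eq)
    then have "\<tau> k = \<tau>' k" for k
      by (metis lift_perm_def nat.case(2) nat.inject)
    then show "m = m' \<and> \<tau> = \<tau>'" using mm by auto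
  qed
  have "card (h ` ?A) = card {\<sigma>. \<sigma> permutes {..<Suc p}}"
    by (simp add: card_image[OF inj] card_cartesian_product card_permutations)
  then have im: "h ` ?A = {\<sigma>. \<sigma> permutes {..<Suc p}}"
    by (intro card_subset_eq[OF _ into]) (auto simp: finite_permutations)
  have "alt T is = (\<Sum>\<sigma>\<in>h ` ?A. of_int (sign \<sigma>) * T (permute_list \<sigma> is))"
    unfolding alt_def p im ..
  also have "\<dots> = (\<Sum>(m, \<tau>)\<in>?A. of_int (sign (h (m, \<tau>))) * T (permute_list (h (m, \<tau>)) is))"
    by (simp add: sum.reindex[OF inj] case_prod_unfold)
  also have "\<dots> = (\<Sum>(m, \<tau>)\<in>?A. (-1) ^ m * (of_int (sign \<tau>) * T (is ! m # permute_list \<tau> (omit {m} is))))"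
  proof (rule sum.cong[OF refl], clarify)
    fix m \<tau> assume m: "m < Suc p" and t: "\<tau> permutes {..<p}"
    have l: "lift_perm \<tau> permutes {..<Suc p}" "sign (lift_perm \<tau>) = sign \<tau>"
      using lift_perm_props[OF t] by auto
    have "permute_list (h (m, \<tau>)) is = permute_list (lift_perm \<tau>) (permute_list (\<rho> m) is)"
      using l p by (simp add: h_def permute_list_compose)
    also have "\<dots> = is ! m # permute_list \<tau> (omit {m} is)"
      using r m t p by (simp add: permute_list_lift_perm)
    finally have 1: "permute_list (h (m, \<tau>)) is = is ! m # permute_list \<tau> (omit {m} is)" .
    have "sign (h (m, \<tau>)) = (-1) ^ m * sign \<tau>"
      using l r m permutes_finite_permutation[OF _ l(1)] permutes_finite_permutation[OF _ r(1)]
      by (simp add: h_def sign_compose)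
    then show "of_int (sign (h (m, \<tau>))) * T (permute_list (h (m, \<tau>)) is) =
        (-1) ^ m * (of_int (sign \<tau>) * T (is ! m # permute_list \<tau> (omit {m} is)))"
      by (simp add: 1)
  qed
  also have "\<dots> = ext1 (\<lambda>i. alt (\<lambda>js. T (i # js))) is"
    unfolding ext1_def alt_def p sum_distrib_left
    by (subst sum.cartesian_product[symmetric]) (simp add: p)
  finally show ?thesis .
qed

section \<open>Calculus of e^i \<and> T_i\<close>

lemma ext1_Nil [simp]: "ext1 T [] = 0"
  by (simp add: ext1_def)

lemma ext1_cong:
  assumes "\<And>i js. Suc (length js) = length is \<Longrightarrow> T i js = U i js"
  shows "ext1 T is = ext1 U is"
  unfolding ext1_def by (intro sum.cong refl) (simp add: assms)

lemma ext1_Cons: "ext1 T (i # is) = T i is - ext1 (\<lambda>j js. T j (i # js)) is"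
  unfolding ext1_def length_Cons sum.lessThan_Suc_shift by (simp add: sum_negf)

text \<open>Up to a factorial, \<open>ext1 T\<close> is the full antisymmetrisation of T read on
  head and tail, by \<open>alt_expand\<close>. The empty list has no head and is treated
  apart.\<close>

lemma alternating_ext1:
  fixes T :: "'a \<Rightarrow> 'a mform"
  assumes "\<And>i. alternating (T i)"
  shows "alternating (ext1 T)"
proof -
  have e: "alt (\<lambda>ks. T (hd ks) (tl ks)) js / fact (length js - 1) = ext1 T js" if "js \<noteq> []" for js
    unfolding alt_expand[OF that] ext1_def sum_divide_distrib
    by (intro sum.cong refl) (simp add: alt_alternating[OF assms])
  show ?thesis
    unfolding alternating_def
  proof (intro allI impI)
    fix "is" :: "'a list" and \<sigma> assume s: "\<sigma> permutes {..<length is}"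
    show "ext1 T (permute_list \<sigma> is) = of_int (sign \<sigma>) * ext1 T is"
    proof (cases "is = []")
      case False
      then have "permute_list \<sigma> is \<noteq> []" by (metis length_0_conv length_permute_list)
      then show ?thesis
        using alternatingD[OF alternating_alt s] by (simp add: False flip: e)
    qed (use s in simp)
  qed
qed

lemma ext1_sum: "ext1 (\<lambda>j js. \<Sum>i\<in>I. T i j js) is = (\<Sum>i\<in>I. ext1 (T i) is)"
  unfolding ext1_def sum_distrib_left by (rule sum.swap)

lemma ext1_add: "ext1 (\<lambda>j js. T j js + U j js) is = ext1 T is + ext1 U is"
  by (simp add: ext1_def algebra_simps sum.distrib)

lemma ext1_cmult: "ext1 (\<lambda>j js. c * T j js) is = c * ext1 T is"
  by (simp add: ext1_def sum_distrib_left mult_ac)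

lemma ext1_minus: "ext1 (\<lambda>j js. - T j js) is = - ext1 T is"
  by (simp add: ext1_def sum_negf)

lemma ext1_diff: "ext1 (\<lambda>j js. T j js - U j js) is = ext1 T is - ext1 U is"
  by (simp add: ext1_def algebra_simps sum_subtractf)

text \<open>Euler's identity e^i \<and> i_{e_i} P = deg(P) P: each summand moves an entry to the
  front, and the sign of the move cancels the one in \<open>ext1\<close>. It produces the factor p +
  1.\<close>

lemma ext1_alternating: "alternating P \<Longrightarrow> ext1 (\<lambda>i js. P (i # js)) is = of_nat (length is) * P is"
  by (simp add: ext1_def alternating_front mult.assoc[symmetric] flip: power_add)

text \<open>Expansion in the first two slots. With q = \<open>length is\<close>, the (q-2)! counts
  the rearrangements of the remaining slots, in which T is already alternating. It stands on the
  left so that no division occurs, and lists shorter than 2 are separate because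
  \<open>length is - 2\<close> truncates.\<close>

lemma ext1_ext1:
  fixes T :: "'a \<Rightarrow> 'a \<Rightarrow> 'a mform"
  assumes "\<And>i j. alternating (T i j)"
  shows "fact (length is - 2) * ext1 (\<lambda>i. ext1 (T i)) is = (if length is < 2 then 0 else alt (\<lambda>ks. T (ks ! 0) (ks ! 1) (drop 2 ks)) is)"
proof (cases "length is < 2")
  case True
  then have "ext1 (\<lambda>i. ext1 (T i)) is = ext1 (\<lambda>i js. 0) is"
    by (intro ext1_cong) (auto simp: less_Suc_eq numeral_2_eq_2)
  then show ?thesis using True by (simp add: ext1_def)
next
  case False
  then have "is \<noteq> []" by auto
  have "fact (length is - 2) * ext1 (T i) js = alt (\<lambda>ks. T i (hd ks) (tl ks)) js" 
    if "Suc (length js) = length is" for i js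
  proof -
    have "js \<noteq> []" using that False by auto
    then show ?thesis
      unfolding alt_expand[OF \<open>js \<noteq> []\<close>] ext1_def sum_distrib_left
      using that by (intro sum.cong refl) (auto simp: alt_alternating[OF assms] simp flip: that)
  qed
  then have "fact (length is - 2) * ext1 (\<lambda>i. ext1 (T i)) is =
      ext1 (\<lambda>i. alt (\<lambda>ks. T i (hd ks) (tl ks))) is"
    unfolding ext1_cmult[symmetric] by (intro ext1_cong) auto
  also have "\<dots> = ext1 (\<lambda>i. alt (\<lambda>js. T ((i # js) ! 0) ((i # js) ! 1) (drop 2 (i # js)))) is"
  proof (intro ext1_cong alt_cong)
    fix i and js ks :: "'a list" assume "Suc (length js) = length is" "length ks = length js"
    then have "ks \<noteq> []" using False by auto
    then show "T i (hd ks) (tl ks) = T ((i # ks) ! 0) ((i # ks) ! 1) (drop 2 (i # ks))"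
      by (cases ks) auto
  qed
  also have "\<dots> = alt (\<lambda>ks. T (ks ! 0) (ks ! 1) (drop 2 ks)) is"
    by (subst alt_expand[OF \<open>is \<noteq> []\<close>]) simp
  finally show ?thesis using False by simp
qed

text \<open>Since e^i \<and> e^j is skew, symmetric coefficients cancel. Applied to T i j =
  \<delta>_ij Q this removes e^i \<and> e^i \<and> Q when the equation is skew-symmetrised.\<close>

lemma ext1_ext1_symmetric:
  fixes T :: "'a \<Rightarrow> 'a \<Rightarrow> 'a mform"
  assumes "\<And>i j. alternating (T i j)" "\<And>i j. T i j = T j i"
  shows "ext1 (\<lambda>i. ext1 (T i)) is = 0"
proof (cases "length is < 2")
  case True
  then show ?thesis using ext1_ext1[OF assms(1), of "is"] by simp
next
  case False
  let ?U = "\<lambda>ks. T (ks ! 0) (ks ! 1) (drop 2 ks)"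
  have t: "Transposition.transpose 0 1 permutes {..<length is}" using False by (intro permutes_swap_id) auto
  have "alt ?U is = alt (\<lambda>ks. ?U (permute_list (Transposition.transpose 0 1) ks)) is"
  proof (rule alt_cong)
    fix js :: "'a list" assume l: "length js = length is"
    then have l: "0 < length js" "Suc 0 < length js" using False by auto
    obtain a b cs where "js = a # b # cs" using l by (metis length_0_conv length_Cons list.exhaust nat_neq_iff less_irrefl list.size(3) One_nat_def)
    then show "?U js = ?U (permute_list (Transposition.transpose 0 1) js)"
      using assms(2)[of a b] by (simp add: permute_list_transpose)
  qed
  also have "\<dots> = - alt ?U is"
    using alt_permute[OF t, of ?U] by (simp add: sign_swap_id)
  finally have "alt ?U is = 0" by simp
  moreover have "fact (length is - 2) * ext1 (\<lambda>i. ext1 (T i)) is = (if length is < 2 then 0 else alt ?U is)"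
    by (rule ext1_ext1) (rule assms(1))
  ultimately show ?thesis using False by simp
qed

text \<open>Contracting e^i \<and> Q with e_i gives n Q from the matching slot minus e^i \<and>
  i_{e_i} Q, which is deg(Q) Q. For deg Q = p - 1 the constant is n - p + 1.\<close>

lemma trace_ext1_axis:
  fixes Q :: "'n::finite mform"
  assumes "alternating Q"
  shows "(\<Sum>i\<in>UNIV. ext1 (\<lambda>j js. (if i = j then 1 else 0) * Q js) (i # is)) =
    (of_nat CARD('n) - of_nat (length is)) * Q is"
proof -
  have "(\<Sum>i\<in>UNIV. ext1 (\<lambda>j js. (if i = j then 1 else 0) * Q (i # js)) is) =
      ext1 (\<lambda>j js. \<Sum>i\<in>UNIV. (if i = j then 1 else 0) * Q (i # js)) is"
    by (rule ext1_sum[symmetric])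
  also have "\<dots> = ext1 (\<lambda>j js. Q (j # js)) is"
    by (simp add: if_distrib[of "\<lambda>x. x * _"] cong: if_cong)
  finally show ?thesis
    by (simp add: ext1_Cons sum_subtractf ext1_alternating[OF assms] algebra_simps)
qed

section \<open>Algebraic operations on forms\<close>

lemma alternating_adjacent:
  assumes "alternating \<omega>"
  shows "\<omega> (xs @ y # x # ys) = - \<omega> (xs @ x # y # ys)"
  using alternating_swap[OF assms, of "length xs" "xs @ x # y # ys" "Suc (length xs)"]
  by (simp add: nth_append list_update_append)

lemma alternating_Cons:
  assumes "alternating \<omega>"
  shows "alternating (\<lambda>js. \<omega> (i # js))"
proof (rule alternating_adjacentI)
  show "\<omega> (i # xs @ y # x # ys) = - \<omega> (i # xs @ x # y # ys)" for xs x y ys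
    using alternating_adjacent[OF assms, of "i # xs" y x ys] by simp
qed

lemma alternating_Cons_swap: "alternating \<omega> \<Longrightarrow> \<omega> (j # i # js) = - \<omega> (i # j # js)"
  using alternating_adjacent[of \<omega> "[]" j i js] by simp

lemma alternating_Cons_same: "alternating \<omega> \<Longrightarrow> \<omega> (i # i # js) = 0"
  by (rule alternating_not_distinct) auto

lemma alternating_cmult: "alternating \<omega> \<Longrightarrow> alternating (\<lambda>is. c (length is) * \<omega> is)"
  by (simp add: alternating_def)

lemma alternating_deg_part: "alternating \<omega> \<Longrightarrow> alternating (deg_part p \<omega>)"
  by (simp add: alternating_def deg_part_def)

lemma alternating_iprod:
  assumes "alternating \<omega>"
  shows "alternating (iprod v \<omega>)"
  unfolding alternating_def iprod_def
  by (simp add: alternatingD[OF alternating_Cons[OF assms]] sum_distrib_left mult.left_commute)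

text \<open>Written through \<open>alt\<close>, wedge and likewise contraction inherit alternation,
  frame covariance and their low-degree formulas from it.\<close>

lemma wedge_alt:
  "wedge \<omega> \<phi> is = (\<Sum>k\<le>length is. 1 / (fact k * fact (length is - k)) *
     alt (\<lambda>js. \<omega> (take k js) * \<phi> (drop k js)) is)"
  by (simp add: wedge_def alt_def Let_def mult.assoc)

lemma contract_alt:
  "contract \<phi> \<omega> is = (\<Sum>m\<le>length is.
     of_nat (length is + 1 - m) / (fact (length is + 1 - m) * fact m) *
     alt (\<lambda>js. \<Sum>k\<in>UNIV. \<phi> (k # take m js) * \<omega> (k # drop m js)) is)"
  by (simp add: contract_def alt_def Let_def)

lemma alternating_wedge: "alternating (wedge \<omega> \<phi>)"
  unfolding alternating_def wedge_alt
  by (simp add: alternatingD[OF alternating_alt] sum_distrib_left mult_ac)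

lemma alternating_contract: "alternating (contract \<omega> \<phi>)"
  unfolding alternating_def contract_alt
  by (simp add: alternatingD[OF alternating_alt] sum_distrib_left mult_ac)

section \<open>Change of orthonormal frame\<close>

lemma change_frame_cong:
  "(\<And>js. length js = length is \<Longrightarrow> \<omega> js = \<phi> js) \<Longrightarrow> change_frame R \<omega> is = change_frame R \<phi> is"
  by (simp add: change_frame_def)

lemma change_frame_sum: "change_frame R (\<lambda>js. \<Sum>i\<in>I. \<omega> i js) is = (\<Sum>i\<in>I. change_frame R (\<omega> i) is)"
  unfolding change_frame_def sum_distrib_left by (rule sum.swap)

lemma change_frame_cmult: "change_frame R (\<lambda>js. c * \<omega> js) is = c * change_frame R \<omega> is"
  by (simp add: change_frame_def sum_distrib_left mult_ac)

lemma change_frame_add: "change_frame R (\<lambda>js. \<omega> js + \<phi> js) is = change_frame R \<omega> is + change_frame R \<phi> is"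
  by (simp add: change_frame_def sum.distrib distrib_left)

lemma change_frame_Nil [simp]: "change_frame R \<omega> [] = \<omega> []"
  by (simp add: change_frame_def)

lemma sum_lists_Suc:
  "(\<Sum>js | length js = Suc n. f js) = (\<Sum>j\<in>UNIV. \<Sum>js | length js = n. f (j # js))"
  for f :: "'n::finite list \<Rightarrow> 'b::comm_monoid_add"
proof -
  have "{js :: 'n list. length js = Suc n} = (\<lambda>(j, js). j # js) ` (UNIV \<times> {js. length js = n})"
    by (auto simp: length_Suc_conv)
  moreover have "inj_on (\<lambda>(j, js). j # js) (UNIV \<times> {js :: 'n list. length js = n})"
    by (auto simp: inj_on_def)
  ultimately show ?thesis
    by (simp add: sum.reindex sum.cartesian_product case_prod_unfold)
qed

lemma change_frame_Cons:
  "change_frame R \<omega> (i # is) = (\<Sum>j\<in>UNIV. of_real (R $ i $ j) * change_frame R (\<lambda>js. \<omega> (j # js)) is)"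
  unfolding change_frame_def length_Cons sum_lists_Suc prod.lessThan_Suc_shift sum_distrib_left
  by (simp add: mult.assoc)

text \<open>A frame change acts slot by slot, hence factorises over a split of the list. The left
  factor varies in the induction because each step freezes its first index.\<close>

lemma change_frame_tensor:
  "k \<le> length is \<Longrightarrow> change_frame R (\<lambda>js. \<phi> (take k js) * \<omega> (drop k js)) is =
    change_frame R \<phi> (take k is) * change_frame R \<omega> (drop k is)"
proof (induction k arbitrary: "is" \<phi>)
  case 0
  then show ?case by (simp add: change_frame_cmult)
next
  case (Suc k)
  then obtain i js where e: "is = i # js" "k \<le> length js" by (cases "is") auto
  have "change_frame R (\<lambda>ls. \<phi> (j # take k ls) * \<omega> (drop k ls)) js =
      change_frame R (\<lambda>l. \<phi> (j # l)) (take k js) * change_frame R \<omega> (drop k js)" for j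
    using Suc.IH[OF e(2), of "\<lambda>l. \<phi> (j # l)"] .
  then show ?case
    by (simp add: e change_frame_Cons sum_distrib_right mult.assoc)
qed

lemma orthogonal_columns:
  fixes R :: "real^'n^'n::finite"
  assumes "orthogonal_matrix R"
  shows "(\<Sum>k\<in>UNIV. R $ k $ a * R $ k $ b) = (if a = b then 1 else 0)"
proof -
  have "Finite_Cartesian_Product.transpose R ** R = mat 1"
    using assms by (simp add: orthogonal_matrix_def)
  then have "(Finite_Cartesian_Product.transpose R ** R) $ a $ b = (mat 1 :: real^'n^'n) $ a $ b"
    by simp
  then show ?thesis
    by (simp add: matrix_matrix_mult_def Finite_Cartesian_Product.transpose_def mat_def)
qed

lemma sum_if_eq1: "(\<Sum>b\<in>UNIV. (if a = b then 1 else 0) * f b) = (f (a::'n::finite) :: 'b::semiring_1)"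
proof -
  have "(\<Sum>b\<in>UNIV. (if a = b then 1 else 0) * f b) = (\<Sum>b\<in>UNIV. if a = b then f b else 0)"
    by (rule sum.cong) auto
  then show ?thesis by simp
qed

text \<open>The two matrix factors at the contracted index sum to the inner product of two columns,
  so orthogonality collapses the double sum to its diagonal.\<close>

lemma change_frame_contraction:
  assumes "orthogonal_matrix R" "m \<le> length is"
  shows "change_frame R (\<lambda>js. \<Sum>k\<in>UNIV. \<phi> (k # take m js) * \<omega> (k # drop m js)) is =
    (\<Sum>k\<in>UNIV. change_frame R \<phi> (k # take m is) * change_frame R \<omega> (k # drop m is))"
proof -
  define f g where "f k = change_frame R (\<lambda>js. \<phi> (k # js)) (take m is)"
    and "g k = change_frame R (\<lambda>js. \<omega> (k # js)) (drop m is)" for k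
  have "change_frame R \<phi> (k # take m is) = (\<Sum>a\<in>UNIV. of_real (R $ k $ a) * f a)"
    "change_frame R \<omega> (k # drop m is) = (\<Sum>a\<in>UNIV. of_real (R $ k $ a) * g a)" for k
    by (simp_all add: change_frame_Cons f_def g_def)
  then have "(\<Sum>k\<in>UNIV. change_frame R \<phi> (k # take m is) * change_frame R \<omega> (k # drop m is)) =
      (\<Sum>k\<in>UNIV. \<Sum>a\<in>UNIV. \<Sum>b\<in>UNIV. of_real (R $ k $ a * R $ k $ b) * (f a * g b))"
    by (simp add: sum_product mult_ac)
  also have "\<dots> = (\<Sum>a\<in>UNIV. \<Sum>k\<in>UNIV. \<Sum>b\<in>UNIV. of_real (R $ k $ a * R $ k $ b) * (f a * g b))"
    by (rule sum.swap)
  also have "\<dots> = (\<Sum>a\<in>UNIV. \<Sum>b\<in>UNIV. of_real (\<Sum>k\<in>UNIV. R $ k $ a * R $ k $ b) * (f a * g b))"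
    unfolding of_real_sum sum_distrib_right by (intro sum.cong refl sum.swap)
  also have "\<dots> = (\<Sum>a\<in>UNIV. \<Sum>b\<in>UNIV. (if a = b then 1 else 0) * (f a * g b))"
    unfolding orthogonal_columns[OF assms(1)] by (intro sum.cong refl) auto
  also have "\<dots> = (\<Sum>a\<in>UNIV. f a * g a)"
    by (simp only: sum_if_eq1)
  also have "\<dots> = change_frame R (\<lambda>js. \<Sum>k\<in>UNIV. \<phi> (k # take m js) * \<omega> (k # drop m js)) is"
    unfolding change_frame_sum f_def g_def
    by (intro sum.cong refl change_frame_tensor[OF assms(2), symmetric])
  finally show ?thesis ..
qed

lemma change_frame_iprod:
  assumes "orthogonal_matrix R"
  shows "iprod (R *v v) (change_frame R \<omega>) is = change_frame R (iprod v \<omega>) is"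
proof -
  define f where "f k = change_frame R (\<lambda>js. \<omega> (k # js)) is" for k
  have "iprod (R *v v) (change_frame R \<omega>) is =
      (\<Sum>j\<in>UNIV. \<Sum>a\<in>UNIV. \<Sum>b\<in>UNIV. of_real (R $ j $ a * R $ j $ b) * (of_real (v $ a) * f b))"
    by (simp add: iprod_def change_frame_Cons f_def sum_product matrix_vector_mult_def mult_ac)
  also have "\<dots> = (\<Sum>a\<in>UNIV. \<Sum>k\<in>UNIV. \<Sum>b\<in>UNIV. of_real (R $ k $ a * R $ k $ b) * (of_real (v $ a) * f b))"
    by (rule sum.swap)
  also have "\<dots> = (\<Sum>a\<in>UNIV. \<Sum>b\<in>UNIV. of_real (\<Sum>k\<in>UNIV. R $ k $ a * R $ k $ b) * (of_real (v $ a) * f b))"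
    unfolding of_real_sum sum_distrib_right by (intro sum.cong refl sum.swap)
  also have "\<dots> = (\<Sum>a\<in>UNIV. \<Sum>b\<in>UNIV. (if a = b then 1 else 0) * (of_real (v $ a) * f b))"
    unfolding orthogonal_columns[OF assms(1)] by (intro sum.cong refl) auto
  also have "\<dots> = (\<Sum>a\<in>UNIV. of_real (v $ a) * f a)"
    by (simp only: sum_if_eq1)
  also have "\<dots> = change_frame R (iprod v \<omega>) is"
    unfolding iprod_def change_frame_sum change_frame_cmult f_def ..
  finally show ?thesis .
qed

lemma change_frame_deg_part: "deg_part p (change_frame R \<omega>) is = change_frame R (deg_part p \<omega>) is"
  by (simp add: deg_part_def change_frame_def)

lemma permute_list_inv:
  assumes "\<sigma> permutes {..<length js}"
  shows "permute_list (inv \<sigma>) (permute_list \<sigma> js) = js" "permute_list \<sigma> (permute_list (inv \<sigma>) js) = js"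
  using permute_list_compose[of "inv \<sigma>" js \<sigma>] permute_list_compose[of \<sigma> js "inv \<sigma>"]
    permutes_inv_o[OF assms] permutes_inv[OF assms] assms by simp_all

text \<open>The same matrix acts in every slot, so a permutation of the slots is absorbed by
  reindexing the summed lists.\<close>

lemma change_frame_permute:
  assumes s: "\<sigma> permutes {..<length is}"
  shows "change_frame R (\<lambda>js. \<omega> (permute_list \<sigma> js)) is = change_frame R \<omega> (permute_list \<sigma> is)"
  unfolding change_frame_def length_permute_list
proof (rule sum.reindex_bij_witness[of _ "permute_list (inv \<sigma>)" "permute_list \<sigma>"])
  fix js :: "'a list" assume "js \<in> {js. length js = length is}"
  then have l: "length js = length is" by simp
  have sj: "\<sigma> permutes {..<length js}" using s l by simp
  show "permute_list (inv \<sigma>) (permute_list \<sigma> js) = js"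
    "permute_list \<sigma> (permute_list (inv \<sigma>) js) = js"
    using permute_list_inv[OF sj] .
  show "permute_list \<sigma> js \<in> {js. length js = length is}" "permute_list (inv \<sigma>) js \<in> {js. length js = length is}"
    using l by auto
  have "(\<Prod>k<length is. complex_of_real (R $ (is ! k) $ (js ! k))) =
      (\<Prod>k<length is. complex_of_real (R $ (is ! \<sigma> k) $ (js ! \<sigma> k)))"
    using prod.permute[OF s, of "\<lambda>k. complex_of_real (R $ (is ! k) $ (js ! k))"] by (simp add: o_def)
  also have "\<dots> = (\<Prod>k<length is. complex_of_real (R $ (permute_list \<sigma> is ! k) $ (permute_list \<sigma> js ! k)))"
    using s sj l by (intro prod.cong refl) (simp add: permute_list_nth)
  finally show "(\<Prod>k<length is. complex_of_real (R $ (permute_list \<sigma> is ! k) $ (permute_list \<sigma> js ! k))) * \<omega> (permute_list \<sigma> js) =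
      (\<Prod>k<length is. complex_of_real (R $ (is ! k) $ (js ! k))) * \<omega> (permute_list \<sigma> js)"
    by simp
qed

lemma change_frame_alt: "change_frame R (alt T) is = alt (change_frame R T) is"
proof -
  have "change_frame R (alt T) is = change_frame R (\<lambda>js. \<Sum>\<sigma> | \<sigma> permutes {..<length is}.
      of_int (sign \<sigma>) * T (permute_list \<sigma> js)) is"
    by (rule change_frame_cong) (simp add: alt_def)
  also have "\<dots> = alt (change_frame R T) is"
    unfolding change_frame_sum change_frame_cmult alt_def
    by (intro sum.cong refl) (simp add: change_frame_permute)
  finally show ?thesis .
qed

lemma change_frame_wedge:
  "wedge (change_frame R \<omega>) (change_frame R \<phi>) is = change_frame R (wedge \<omega> \<phi>) is"
proof -
  have "change_frame R (wedge \<omega> \<phi>) is = change_frame R (\<lambda>js. \<Sum>k\<le>length is. 1 / (fact k * fact (length is - k)) *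
     alt (\<lambda>js. \<omega> (take k js) * \<phi> (drop k js)) js) is"
    by (rule change_frame_cong) (simp add: wedge_alt)
  also have "\<dots> = wedge (change_frame R \<omega>) (change_frame R \<phi>) is"
    unfolding change_frame_sum change_frame_cmult wedge_alt change_frame_alt
    by (intro sum.cong refl arg_cong2[of _ _ _ _ "(*)"] alt_cong) (simp add: change_frame_tensor)
  finally show ?thesis ..
qed

lemma change_frame_contract:
  assumes "orthogonal_matrix R"
  shows "contract (change_frame R \<omega>) (change_frame R \<phi>) is = change_frame R (contract \<omega> \<phi>) is"
proof -
  have "change_frame R (contract \<omega> \<phi>) is = change_frame R (\<lambda>js. \<Sum>m\<le>length is.
     of_nat (length is + 1 - m) / (fact (length is + 1 - m) * fact m) *
     alt (\<lambda>js. \<Sum>k\<in>UNIV. \<omega> (k # take m js) * \<phi> (k # drop m js)) js) is"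
    by (rule change_frame_cong) (simp add: contract_alt)
  also have "\<dots> = contract (change_frame R \<omega>) (change_frame R \<phi>) is"
    unfolding change_frame_sum[where I = "{..length is}"] change_frame_cmult contract_alt change_frame_alt
    by (intro sum.cong refl arg_cong2[of _ _ _ _ "(*)"] alt_cong) (simp add: change_frame_contraction[OF assms])
  finally show ?thesis ..
qed

section \<open>Linearity and the twisting term\<close>

lemma iprod_linear: "iprod (s *\<^sub>R u + t *\<^sub>R v) \<omega> is = of_real s * iprod u \<omega> is + of_real t * iprod v \<omega> is"
  by (simp add: iprod_def algebra_simps sum.distrib sum_distrib_left)

lemma wedge_linear_left:
  "wedge (\<lambda>js. s * \<omega> js + t * \<omega>' js) \<phi> is = s * wedge \<omega> \<phi> is + t * wedge \<omega>' \<phi> is"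
proof -
  have "(\<lambda>js. (s * \<omega> (take k js) + t * \<omega>' (take k js)) * \<phi> (drop k js)) =
      (\<lambda>js. s * (\<omega> (take k js) * \<phi> (drop k js)) + t * (\<omega>' (take k js) * \<phi> (drop k js)))" for k
    by (simp add: fun_eq_iff algebra_simps)
  then show ?thesis
    by (simp only: wedge_alt alt_add alt_cmult distrib_left mult.left_commute[of _ s] mult.left_commute[of _ t]
        sum.distrib sum_distrib_left)
qed

lemma wedge_linear_right:
  "wedge \<phi> (\<lambda>js. s * \<omega> js + t * \<omega>' js) is = s * wedge \<phi> \<omega> is + t * wedge \<phi> \<omega>' is"
proof -
  have "(\<lambda>js. \<phi> (take k js) * (s * \<omega> (drop k js) + t * \<omega>' (drop k js))) =
      (\<lambda>js. s * (\<phi> (take k js) * \<omega> (drop k js)) + t * (\<phi> (take k js) * \<omega>' (drop k js)))" for k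
    by (simp add: fun_eq_iff algebra_simps)
  then show ?thesis
    by (simp only: wedge_alt alt_add alt_cmult distrib_left mult.left_commute[of _ s] mult.left_commute[of _ t]
        sum.distrib sum_distrib_left)
qed

lemma contract_linear_left:
  "contract (\<lambda>js. s * \<omega> js + t * \<omega>' js) \<phi> is = s * contract \<omega> \<phi> is + t * contract \<omega>' \<phi> is"
proof -
  have "(\<lambda>js. \<Sum>k\<in>UNIV. (s * \<omega> (k # take m js) + t * \<omega>' (k # take m js)) * \<phi> (k # drop m js)) =
      (\<lambda>js. s * (\<Sum>k\<in>UNIV. \<omega> (k # take m js) * \<phi> (k # drop m js)) +
        t * (\<Sum>k\<in>UNIV. \<omega>' (k # take m js) * \<phi> (k # drop m js)))" for m
    by (simp add: fun_eq_iff sum_distrib_left sum.distrib algebra_simps)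
  then show ?thesis
    by (simp only: contract_alt alt_add alt_cmult distrib_left mult.left_commute[of _ s] mult.left_commute[of _ t]
        sum.distrib[where A = "{..length is}"] sum_distrib_left[where A = "{..length is}"])
qed

lemma contract_linear_right:
  "contract \<phi> (\<lambda>js. s * \<omega> js + t * \<omega>' js) is = s * contract \<phi> \<omega> is + t * contract \<phi> \<omega>' is"
proof -
  have "(\<lambda>js. \<Sum>k\<in>UNIV. \<phi> (k # take m js) * (s * \<omega> (k # drop m js) + t * \<omega>' (k # drop m js))) =
      (\<lambda>js. s * (\<Sum>k\<in>UNIV. \<phi> (k # take m js) * \<omega> (k # drop m js)) +
        t * (\<Sum>k\<in>UNIV. \<phi> (k # take m js) * \<omega>' (k # drop m js)))" for m
    by (simp add: fun_eq_iff sum_distrib_left sum.distrib algebra_simps)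
  then show ?thesis
    by (simp only: contract_alt alt_add alt_cmult distrib_left mult.left_commute[of _ s] mult.left_commute[of _ t]
        sum.distrib[where A = "{..length is}"] sum_distrib_left[where A = "{..length is}"])
qed

lemma deg_part_linear:
  "deg_part p (\<lambda>js. s * \<omega> js + t * \<phi> js) = (\<lambda>js. s * deg_part p \<omega> js + t * deg_part p \<phi> js)"
  by (auto simp: deg_part_def)

lemma alternating_hier_C: "alternating (hier_C k1 k2 F v X)"
  unfolding alternating_def hier_C_def
  by (simp add: Let_def alternatingD[OF alternating_wedge] alternatingD[OF alternating_contract] algebra_simps)

lemma twisting_term_hier_C: "twisting_term (hier_C k1 k2)"
  unfolding twisting_term_def
proof (intro allI impI conjI)
  fix F \<omega> :: "'n::finite mform" and v :: "real^'n"
  show "alternating (hier_C k1 k2 F v \<omega>)" by (rule alternating_hier_C)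
next
  fix F \<omega> :: "'n::finite mform" and u v :: "real^'n" and s t "is"
  have "iprod (s *\<^sub>R u + t *\<^sub>R v) F = (\<lambda>js. of_real s * iprod u F js + of_real t * iprod v F js)"
    by (simp add: fun_eq_iff iprod_linear)
  then show "hier_C k1 k2 F (s *\<^sub>R u + t *\<^sub>R v) \<omega> is =
      of_real s * hier_C k1 k2 F u \<omega> is + of_real t * hier_C k1 k2 F v \<omega> is"
    by (simp add: hier_C_def Let_def contract_linear_left wedge_linear_left algebra_simps)
next
  fix F \<omega> \<phi> :: "'n::finite mform" and v :: "real^'n" and z w "is"
  show "hier_C k1 k2 F v (\<lambda>js. z * \<omega> js + w * \<phi> js) is =
      z * hier_C k1 k2 F v \<omega> is + w * hier_C k1 k2 F v \<phi> is"
    by (simp add: hier_C_def Let_def deg_part_linear contract_linear_right wedge_linear_right algebra_simps)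
next
  fix F \<omega> :: "'n::finite mform" and v :: "real^'n" and R :: "real^'n^'n"
  assume R: "orthogonal_matrix R"
  show "hier_C k1 k2 (change_frame R F) (R *v v) (change_frame R \<omega>) = change_frame R (hier_C k1 k2 F v \<omega>)"
  proof
    fix "is" :: "'n list"
    let ?p = "int (length is)"
    have 1: "iprod (R *v v) (change_frame R F) = change_frame R (iprod v F)"
      "deg_part q (change_frame R \<omega>) = change_frame R (deg_part q \<omega>)" for q
      by (auto simp: fun_eq_iff change_frame_iprod[OF R] change_frame_deg_part)
    \<comment> \<open>The coefficients depend only on the degree, which a frame change preserves; at
      a fixed list they are constants and pass through.\<close>
    have "change_frame R (hier_C k1 k2 F v \<omega>) is = change_frame R (\<lambda>js.
       acoef ?p (?p+1) * kcoef k1 k2 ?p * contract (iprod v F) (deg_part (?p+1) \<omega>) js +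
       acoef ?p (?p-1) * kcoef k1 k2 (?p-1) * wedge (iprod v F) (deg_part (?p-1) \<omega>) js) is"
      by (rule change_frame_cong) (simp add: hier_C_def Let_def)
    then show "hier_C k1 k2 (change_frame R F) (R *v v) (change_frame R \<omega>) is = change_frame R (hier_C k1 k2 F v \<omega>) is"
      by (simp only: hier_C_def[of _ _ _ _ _ "is"] Let_def 1 change_frame_wedge change_frame_contract[OF R]
          change_frame_add change_frame_cmult)
  qed
qed

section \<open>Operations with forms of degree one and two\<close>

definition homog :: "nat \<Rightarrow> 'n mform \<Rightarrow> bool" where
  "homog p \<omega> \<longleftrightarrow> (\<forall>is. length is \<noteq> p \<longrightarrow> \<omega> is = 0)"

lemma homogD: "homog p \<omega> \<Longrightarrow> length is \<noteq> p \<Longrightarrow> \<omega> is = 0"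
  by (simp add: homog_def)

lemma alt_0: "(\<And>js. length js = length is \<Longrightarrow> T js = 0) \<Longrightarrow> alt T is = 0"
  by (simp add: alt_def)

lemma ext1_0: "(\<And>i js. Suc (length js) = length is \<Longrightarrow> T i js = 0) \<Longrightarrow> ext1 T is = 0"
  by (simp add: ext1_def)

text \<open>With \<phi> of pure degree 1 only k = 1 survives, and for lists of length q the
  remaining 1/(q-1)! cancels against the rearrangements of the alternating \<omega>. The other
  low-degree formulas follow the same pattern.\<close>

lemma wedge_1:
  assumes h: "homog 1 \<phi>" and a: "alternating \<omega>"
  shows "wedge \<phi> \<omega> is = ext1 (\<lambda>i js. \<phi> [i] * \<omega> js) is"
proof (cases "is = []")
  case True
  then show ?thesis using homogD[OF h] by (simp add: wedge_alt)
next
  case False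
  have "wedge \<phi> \<omega> is = (\<Sum>k\<in>{1}. 1 / (fact k * fact (length is - k)) *
     alt (\<lambda>js. \<phi> (take k js) * \<omega> (drop k js)) is)"
    unfolding wedge_alt using False
    by (intro sum.mono_neutral_right) (auto simp: Suc_le_eq intro!: alt_0 homogD[OF h])
  also have "\<dots> = 1 / fact (length is - 1) * ext1 (\<lambda>i. alt (\<lambda>js. \<phi> [i] * \<omega> js)) is"
    by (simp add: alt_expand[OF False])
  also have "\<dots> = ext1 (\<lambda>i js. \<phi> [i] * \<omega> js) is"
    unfolding ext1_cmult[symmetric]
    by (intro ext1_cong, drule sym) (auto simp: alt_cmult alt_alternating[OF a])
  finally show ?thesis .
qed

lemma contract_1:
  assumes h: "homog 1 \<phi>" and a: "alternating \<omega>"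
  shows "contract \<phi> \<omega> is = (\<Sum>k\<in>UNIV. \<phi> [k] * \<omega> (k # is))"
proof -
  have "contract \<phi> \<omega> is = (\<Sum>m\<in>{0}.
     of_nat (length is + 1 - m) / (fact (length is + 1 - m) * fact m) *
     alt (\<lambda>js. \<Sum>k\<in>UNIV. \<phi> (k # take m js) * \<omega> (k # drop m js)) is)"
    unfolding contract_alt
    by (intro sum.mono_neutral_right) (auto intro!: alt_0 sum.neutral homogD[OF h])
  also have "\<dots> = 1 / fact (length is) * (\<Sum>k\<in>UNIV. \<phi> [k] * alt (\<lambda>js. \<omega> (k # js)) is)"
    by (simp add: alt_sum alt_cmult del: of_nat_Suc)
  also have "\<dots> = (\<Sum>k\<in>UNIV. \<phi> [k] * \<omega> (k # is))"
    by (simp add: alt_alternating[OF alternating_Cons[OF a]] sum_distrib_left)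
  finally show ?thesis .
qed

text \<open>Degree 2 of \<phi> means m = 1, hence p = q, and p/(p! m!) = 1/(q-1)! cancels after one
  expansion. In the result \<phi>_ki e^i \<and> i_{e_k} \<omega> the contracted index is in the
  first slot of \<phi>; this order decides the signs when P and Q are read off.\<close>

lemma contract_2:
  assumes h: "homog 2 \<phi>" and a: "alternating \<omega>"
  shows "contract \<phi> \<omega> is = ext1 (\<lambda>i js. \<Sum>k\<in>UNIV. \<phi> [k, i] * \<omega> (k # js)) is"
proof (cases "is = []")
  case True
  then show ?thesis using homogD[OF h] by (simp add: contract_alt)
next
  case False
  have "contract \<phi> \<omega> is = (\<Sum>m\<in>{1}.
     of_nat (length is + 1 - m) / (fact (length is + 1 - m) * fact m) *
     alt (\<lambda>js. \<Sum>k\<in>UNIV. \<phi> (k # take m js) * \<omega> (k # drop m js)) is)"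
    unfolding contract_alt using False
    by (intro sum.mono_neutral_right) (auto simp: Suc_le_eq intro!: alt_0 sum.neutral homogD[OF h])
  also have "\<dots> = 1 / fact (length is - 1) *
      ext1 (\<lambda>i. alt (\<lambda>js. \<Sum>k\<in>UNIV. \<phi> [k, i] * \<omega> (k # js))) is"
    using False by (cases "is") (simp_all add: alt_expand del: of_nat_Suc)
  also have "\<dots> = ext1 (\<lambda>i js. \<Sum>k\<in>UNIV. \<phi> [k, i] * \<omega> (k # js)) is"
    unfolding ext1_cmult[symmetric]
    by (intro ext1_cong, drule sym) (auto simp: alt_cmult alt_sum alt_alternating[OF alternating_Cons[OF a]] sum_distrib_left)
  finally show ?thesis .
qed

text \<open>The factor 2 is the 2! of the ordered pairs (i, j) in \<phi>_ij e^i \<and> e^j \<and>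
  \<omega>.\<close>

lemma wedge_2:
  fixes \<omega> \<phi> :: "'n::finite mform"
  assumes h: "homog 2 \<phi>" and a: "alternating \<omega>"
  shows "2 * wedge \<phi> \<omega> is = ext1 (\<lambda>i. ext1 (\<lambda>j ks. \<phi> [i, j] * \<omega> ks)) is"
proof -
  have e: "fact (length is - 2) * ext1 (\<lambda>i. ext1 (\<lambda>j ks. \<phi> [i, j] * \<omega> ks)) is =
      (if length is < 2 then 0 else alt (\<lambda>ks. \<phi> [ks ! 0, ks ! 1] * \<omega> (drop 2 ks)) is)"
    by (rule ext1_ext1) (rule alternating_cmult[OF a])
  show ?thesis
  proof (cases "length is < 2")
    case True
    then have "wedge \<phi> \<omega> is = 0"
      unfolding wedge_alt by (intro sum.neutral) (auto intro!: alt_0 homogD[OF h])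
    then show ?thesis using e True by simp
  next
    case False
    have "wedge \<phi> \<omega> is = (\<Sum>k\<in>{2}. 1 / (fact k * fact (length is - k)) *
       alt (\<lambda>js. \<phi> (take k js) * \<omega> (drop k js)) is)"
      unfolding wedge_alt using False
      by (intro sum.mono_neutral_right) (auto intro!: alt_0 homogD[OF h])
    also have "\<dots> = 1 / (2 * fact (length is - 2)) * alt (\<lambda>js. \<phi> [js ! 0, js ! 1] * \<omega> (drop 2 js)) is"
    proof -
      have "take 2 js = [js ! 0, js ! 1]" if "length js = length is" for js :: "'n list"
        using that False by (cases js; cases "tl js") auto
      then show ?thesis by (simp cong: alt_cong)
    qed
    finally have "fact (length is - 2) * (2 * wedge \<phi> \<omega> is) =
        fact (length is - 2) * ext1 (\<lambda>i. ext1 (\<lambda>j ks. \<phi> [i, j] * \<omega> ks)) is"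
      unfolding e using False by simp
    then show ?thesis by (simp only: mult_cancel_left) simp
  qed
qed

text \<open>The definition sums only degrees k up to n, so for n = 1 its degree-2 term is missing;
  an alternating 2-form is then zero, and both sides vanish.\<close>

lemma vee_2:
  fixes \<omega> \<phi> :: "'n::finite mform"
  assumes h: "homog 2 \<phi>" and a: "alternating \<phi>"
  shows "2 * vee \<phi> \<omega> is = (\<Sum>i\<in>UNIV. \<Sum>j\<in>UNIV. \<phi> [i, j] * \<omega> (i # j # is))"
proof -
  have s2: "(\<Sum>js | length js = 2. \<phi> js * \<omega> (js @ is)) = (\<Sum>i\<in>UNIV. \<Sum>j\<in>UNIV. \<phi> [i, j] * \<omega> (i # j # is))"
    by (simp add: numeral_2_eq_2 sum_lists_Suc)
  have "(\<Sum>js | length js = k. \<phi> js * \<omega> (js @ is)) = 0" if "k \<noteq> 2" for k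
    using homogD[OF h] that by (intro sum.neutral) auto
  then have z: "vee \<phi> \<omega> is = (\<Sum>k\<le>CARD('n). if k = 2 then (\<Sum>js | length js = 2. \<phi> js * \<omega> (js @ is)) / 2 else 0)"
    unfolding vee_def by (intro sum.cong refl) auto
  show ?thesis
  proof (cases "2 \<le> CARD('n)")
    case True
    then show ?thesis by (simp add: z s2)
  next
    case False
    have "\<phi> [i, j] = 0" for i j
      by (rule alternating_long[OF a]) (use False in auto)
    then show ?thesis using False by (simp add: z)
  qed
qed

section \<open>Clifford bilinears\<close>

definition act :: "('a,'m,'n::finite,'s::finite) spin_data \<Rightarrow> 'n list \<Rightarrow> complex^'s \<Rightarrow> complex^'s" where
  "act M is \<eta> = foldr (\<lambda>i \<zeta>. gam M i *v \<zeta>) is \<eta>"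

definition pairing ::
  "('a,'m,'n::finite,'s::finite) spin_data \<Rightarrow> complex^'s \<Rightarrow> complex^'s \<Rightarrow> 'n list \<Rightarrow> complex" where
  "pairing M \<xi> \<eta> is = herm M \<xi> (act M is \<eta>)"

text \<open>Two spinors are kept because differentiating \<chi>_p puts a second spinor into either
  slot, and cl(F) \<epsilon> will be one. The factor i^[p/2] is left out: it depends on the degree,
  which Clifford multiplication shifts.\<close>

definition bil ::
  "('a,'m,'n::finite,'s::finite) spin_data \<Rightarrow> complex^'s \<Rightarrow> complex^'s \<Rightarrow> 'n mform" where
  "bil M \<xi> \<eta> is = alt (pairing M \<xi> \<eta>) is / fact (length is)"

lemma act_Nil [simp]: "act M [] \<eta> = \<eta>"
  by (simp add: act_def)

lemma act_Cons [simp]: "act M (i # is) \<eta> = gam M i *v act M is \<eta>"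
  by (simp add: act_def)

lemma act_append: "act M (xs @ ys) \<eta> = act M xs (act M ys \<eta>)"
  by (simp add: act_def)

lemma alternating_bil: "alternating (bil M \<xi> \<eta>)"
  unfolding alternating_def bil_def by (simp add: alternatingD[OF alternating_alt])

lemma cl_axis: "cl M (axis i 1) = gam M i"
proof -
  have "cl M (axis i 1) = (\<Sum>j\<in>UNIV. if j = i then gam M j else 0)"
    unfolding cl_def by (intro sum.cong) (auto simp: axis_def)
  then show ?thesis by simp
qed

lemma cl_prod_axis: "cl_prod M (map (\<lambda>i. axis i 1) is) *v \<eta> = act M is \<eta>"
  by (induction "is") (simp_all add: cl_prod_def cl_axis flip: matrix_vector_mul_assoc)

lemma bilinear_axis:
  "bilinear M \<eta> (map (\<lambda>i. axis i 1) is) = \<i> ^ (length is div 2) * bil M \<eta> \<eta> is"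
proof -
  have "permute_list \<sigma> (map (\<lambda>i. axis i 1) is) = map (\<lambda>i. axis i (1::real)) (permute_list \<sigma> is)"
    if "\<sigma> permutes {..<length is}" for \<sigma>
    using that by (rule permute_list_map)
  then show ?thesis
    by (auto simp: bilinear_def Let_def bil_def alt_def pairing_def cl_prod_axis intro!: sum.cong)
qed

section \<open>Linearity of the Clifford action\<close>

lemma scaleR_vec_complex: "r *\<^sub>R (v::complex^'s) = of_real r *s v"
  unfolding vec_eq_iff vector_smult_component vector_scaleR_component by (simp add: scaleR_conv_of_real)

lemma matrix_vector_mult_sum: "(A::complex^'s^'t) *v (\<Sum>i\<in>I. f i) = (\<Sum>i\<in>I. A *v f i)"
  by (induction I rule: infinite_finite_induct) (simp_all add: matrix_vector_right_distrib)

lemma smult_sum_right: "c *s (\<Sum>i\<in>I. f i) = (\<Sum>i\<in>I. c *s (f i :: complex^'s))"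
  by (induction I rule: infinite_finite_induct) (simp_all add: vector_add_ldistrib)

lemma smult_sum_left: "(\<Sum>i\<in>I. c i) *s v = (\<Sum>i\<in>I. c i *s (v :: complex^'s))"
  by (induction I rule: infinite_finite_induct) (simp_all add: vector_sadd_rdistrib)

lemma smult_minus1: "(-1) *s v = - (v :: complex^'s)"
  by (simp add: vec_eq_iff)

lemma act_add: "act M is (\<eta> + \<zeta>) = act M is \<eta> + act M is \<zeta>"
  by (induction "is") (simp_all add: matrix_vector_right_distrib)

lemma act_smult: "act M is (z *s \<eta>) = z *s act M is \<eta>"
  by (induction "is") (simp_all add: vector_scalar_commute)

lemma act_0 [simp]: "act M is 0 = 0"
  by (induction "is") simp_all

lemma act_sum: "act M is (\<Sum>i\<in>I. f i) = (\<Sum>i\<in>I. act M is (f i))"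
  by (induction I rule: infinite_finite_induct) (simp_all add: act_add)

lemma act_minus: "act M is (- \<eta>) = - act M is \<eta>"
  using act_smult[of M "is" "-1" \<eta>] by (simp only: smult_minus1)

lemma cl_mult:
  fixes M :: "('a,'m,'n::finite,'s::finite) spin_data"
  shows "cl M v *v \<eta> = (\<Sum>i\<in>UNIV. of_real (v $ i) *s (gam M i *v \<eta>))"
proof -
  have "(\<Sum>i\<in>I. r i *\<^sub>R A i) *v \<eta> = (\<Sum>i\<in>I. of_real (r i) *s (A i *v \<eta>))"
    for I :: "'n set" and r and A :: "'n \<Rightarrow> complex^'s^'s" and \<eta> :: "complex^'s"
  proof (induction I rule: infinite_finite_induct)
    case (insert i I)
    have "(r i *\<^sub>R A i) *v \<eta> = of_real (r i) *s (A i *v \<eta>)"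
      unfolding vec_eq_iff matrix_vector_mult_def vector_smult_component vector_scaleR_component
      by (simp add: scaleR_conv_of_real sum_distrib_left mult_ac)
    then show ?case using insert by (simp add: matrix_vector_mult_add_rdistrib)
  qed simp_all
  then show ?thesis by (simp add: cl_def)
qed

text \<open>The infinitesimal version of \<open>change_frame\<close>: the matrix w acts as a
  derivation on the slots. With w the connection matrix it is, up to sign, the zeroth-order part of
  \<open>nabla\<close>.\<close>

definition frame_deriv :: "('n::finite \<Rightarrow> 'n \<Rightarrow> real) \<Rightarrow> 'n mform \<Rightarrow> 'n mform" where
  "frame_deriv w \<omega> is = (\<Sum>m<length is. \<Sum>k\<in>UNIV. of_real (w (is ! m) k) * \<omega> (is[m := k]))"

lemma permute_list_update:
  assumes "\<sigma> permutes {..<length is}" "m < length is"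
  shows "(permute_list \<sigma> is)[m := k] = permute_list \<sigma> (is[\<sigma> m := k])"
  using assms permutes_inj[OF assms(1)] permutes_in_image[OF assms(1)]
  by (intro nth_equalityI) (auto simp: permute_list_def nth_list_update inj_eq)

lemma frame_deriv_permute:
  assumes s: "\<sigma> permutes {..<length is}"
  shows "frame_deriv w \<omega> (permute_list \<sigma> is) = frame_deriv w (\<lambda>js. \<omega> (permute_list \<sigma> js)) is"
proof -
  let ?f = "\<lambda>m. \<Sum>k\<in>UNIV. complex_of_real (w (is ! m) k) * \<omega> (permute_list \<sigma> (is[m := k]))"
  have "frame_deriv w \<omega> (permute_list \<sigma> is) = (\<Sum>m<length is. ?f (\<sigma> m))"
    unfolding frame_deriv_def length_permute_list
    by (intro sum.cong refl) (simp add: permute_list_update[OF s] permute_list_nth[OF s])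
  also have "\<dots> = (\<Sum>m<length is. ?f m)"
    using sum.permute[OF s, of ?f] by (simp add: o_def)
  finally show ?thesis by (simp add: frame_deriv_def)
qed

lemma frame_deriv_cong:
  "(\<And>js. length js = length is \<Longrightarrow> \<omega> js = \<phi> js) \<Longrightarrow> frame_deriv w \<omega> is = frame_deriv w \<phi> is"
  by (simp add: frame_deriv_def)

lemma frame_deriv_cmult: "frame_deriv w (\<lambda>js. c * \<omega> js) is = c * frame_deriv w \<omega> is"
  by (simp add: frame_deriv_def sum_distrib_left mult_ac)

lemma frame_deriv_sum: "frame_deriv w (\<lambda>js. \<Sum>i\<in>I. \<omega> i js) is = (\<Sum>i\<in>I. frame_deriv w (\<omega> i) is)"
proof -
  have "frame_deriv w (\<lambda>js. \<Sum>i\<in>I. \<omega> i js) is =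
      (\<Sum>m<length is. \<Sum>i\<in>I. \<Sum>k\<in>UNIV. of_real (w (is ! m) k) * \<omega> i (is[m := k]))"
    unfolding frame_deriv_def sum_distrib_left by (intro sum.cong refl sum.swap)
  also have "\<dots> = (\<Sum>i\<in>I. frame_deriv w (\<omega> i) is)"
    unfolding frame_deriv_def by (rule sum.swap)
  finally show ?thesis .
qed

lemma alternating_frame_deriv:
  assumes "alternating \<omega>"
  shows "alternating (frame_deriv w \<omega>)"
  unfolding alternating_def
proof (intro allI impI)
  fix "is" :: "'a list" and \<sigma>
  assume s: "\<sigma> permutes {..<length is}"
  have "frame_deriv w (\<lambda>js. \<omega> (permute_list \<sigma> js)) is = frame_deriv w (\<lambda>js. of_int (sign \<sigma>) * \<omega> js) is"
    by (rule frame_deriv_cong) (use s in \<open>simp add: alternatingD[OF assms]\<close>)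
  then show "frame_deriv w \<omega> (permute_list \<sigma> is) = of_int (sign \<sigma>) * frame_deriv w \<omega> is"
    by (simp add: frame_deriv_permute[OF s] frame_deriv_cmult)
qed

lemma alt_frame_deriv: "alt (frame_deriv w T) is = frame_deriv w (alt T) is"
proof -
  have "frame_deriv w (alt T) is = frame_deriv w (\<lambda>js. \<Sum>\<sigma> | \<sigma> permutes {..<length is}.
      of_int (sign \<sigma>) * T (permute_list \<sigma> js)) is"
    by (rule frame_deriv_cong) (simp add: alt_def)
  also have "\<dots> = alt (frame_deriv w T) is"
    unfolding frame_deriv_sum frame_deriv_cmult alt_def
    by (intro sum.cong refl) (simp add: frame_deriv_permute)
  finally show ?thesis ..
qed

text \<open>With j present once, only its own position contributes, with the parity of the number of
  entries before it.\<close>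

lemma ext1_delta:
  assumes "j \<notin> set xs" "j \<notin> set ys"
  shows "ext1 (\<lambda>i js. (if j = i then 1 else 0) * Q js) (xs @ j # ys) = (-1) ^ length xs * Q (xs @ ys)"
proof -
  have "(\<Sum>m<length (xs @ j # ys). (-1) ^ m * ((if j = (xs @ j # ys) ! m then 1 else 0) * Q (omit {m} (xs @ j # ys)))) =
      (\<Sum>m<length (xs @ j # ys). if m = length xs then (-1) ^ m * Q (omit {m} (xs @ j # ys)) else 0)"
  proof (intro sum.cong refl)
    fix m assume "m \<in> {..<length (xs @ j # ys)}"
    then show "(-1) ^ m * ((if j = (xs @ j # ys) ! m then 1 else 0) * Q (omit {m} (xs @ j # ys))) =
        (if m = length xs then (-1) ^ m * Q (omit {m} (xs @ j # ys)) else 0)"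
      using assms by (auto simp: nth_append nth_Cons split: nat.splits)
  qed
  then show ?thesis
    by (simp add: ext1_def omit_append)
qed

lemma ext1_delta_notin:
  assumes "j \<notin> set is"
  shows "ext1 (\<lambda>i js. (if j = i then 1 else 0) * Q js) is = 0"
  unfolding ext1_def using assms by (intro sum.neutral) auto

section \<open>Clifford relations and spinor bilinears\<close>

context
  fixes M :: "('a,'m,'n::finite,'s::finite) spin_data"
  assumes sm: "spinor_module M"
begin

lemma herm_add_right: "herm M \<eta> (\<xi> + \<zeta>) = herm M \<eta> \<xi> + herm M \<eta> \<zeta>"
  and herm_smult_right: "herm M \<eta> (z *s \<xi>) = z * herm M \<eta> \<xi>"
  and herm_cnj: "herm M \<xi> \<eta> = cnj (herm M \<eta> \<xi>)"
  and herm_pos: "\<eta> \<noteq> 0 \<Longrightarrow> Re (herm M \<eta> \<eta>) > 0"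
  and herm_cl: "herm M (cl M v *v \<eta>) \<xi> = herm M \<eta> (cl M v *v \<xi>)"
  and cl_anticommute: "cl M u ** cl M v + cl M v ** cl M u = mat (of_real (2 * (u \<bullet> v)))"
  using sm unfolding spinor_module_def by blast+

lemma herm_add_left: "herm M (\<xi> + \<zeta>) \<eta> = herm M \<xi> \<eta> + herm M \<zeta> \<eta>"
  by (simp add: herm_cnj[of _ \<eta>] herm_add_right)

lemma herm_smult_left: "herm M (z *s \<xi>) \<eta> = cnj z * herm M \<xi> \<eta>"
  by (simp add: herm_cnj[of _ \<eta>] herm_smult_right)

lemma herm_0_right [simp]: "herm M \<eta> 0 = 0"
  using herm_smult_right[of \<eta> 0 0] by simp

lemma herm_0_left [simp]: "herm M 0 \<eta> = 0"
  using herm_smult_left[of 0 0 \<eta>] by simp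

lemma herm_minus_right: "herm M \<eta> (- \<xi>) = - herm M \<eta> \<xi>"
  using herm_smult_right[of \<eta> "-1" \<xi>] by (simp only: smult_minus1) simp

lemma herm_sum_right: "herm M \<eta> (\<Sum>i\<in>I. f i) = (\<Sum>i\<in>I. herm M \<eta> (f i))"
  by (induction I rule: infinite_finite_induct) (simp_all add: herm_add_right)

lemma herm_sum_left: "herm M (\<Sum>i\<in>I. f i) \<eta> = (\<Sum>i\<in>I. herm M (f i) \<eta>)"
  by (induction I rule: infinite_finite_induct) (simp_all add: herm_add_left)

lemma herm_gam: "herm M (gam M i *v \<eta>) \<xi> = herm M \<eta> (gam M i *v \<xi>)"
  using herm_cl[of "axis i 1"] by (simp add: cl_axis)

lemma gam_anticommute:
  "gam M i *v (gam M j *v \<eta>) = (if i = j then 2 else 0) *s \<eta> - gam M j *v (gam M i *v \<eta>)"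
proof -
  have "(gam M i ** gam M j + gam M j ** gam M i) *v \<eta> = mat (if i = j then 2 else 0) *v \<eta>"
    using cl_anticommute[of "axis i 1" "axis j 1"] by (simp add: cl_axis inner_axis_axis)
  moreover have "mat c *v \<eta> = c *s \<eta>" for c
    by (simp add: vec_eq_iff matrix_vector_mult_def mat_def if_distrib[of "\<lambda>x. x * _"] cong: if_cong)
  ultimately show ?thesis
    by (simp add: matrix_vector_mult_add_rdistrib eq_diff_eq flip: matrix_vector_mul_assoc)
qed

lemma gam_gam: "gam M i *v (gam M i *v \<eta>) = \<eta>"
proof -
  have "2 *s (gam M i *v (gam M i *v \<eta>)) = 2 *s \<eta>"
    using gam_anticommute[of i i \<eta>] by (simp add: vec_eq_iff)
  then show ?thesis by (simp add: vec_eq_iff)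
qed

lemma gam_swap: "i \<noteq> j \<Longrightarrow> gam M i *v (gam M j *v \<eta>) = - (gam M j *v (gam M i *v \<eta>))"
  using gam_anticommute[of i j \<eta>] by simp

lemma pairing_swap: "x \<noteq> y \<Longrightarrow> pairing M \<xi> \<eta> (xs @ y # x # ys) = - pairing M \<xi> \<eta> (xs @ x # y # ys)"
  by (simp add: pairing_def act_append gam_swap[of y x] act_minus herm_minus_right)

lemma pairing_cancel: "pairing M \<xi> \<eta> (xs @ x # x # ys) = pairing M \<xi> \<eta> (xs @ ys)"
  by (simp add: pairing_def act_append gam_gam)

text \<open>Each passage past a different generator costs a sign; in this way a generator is brought
  next to its copy or to the end of the list.\<close>

lemma pairing_move:
  "y \<notin> set xs \<Longrightarrow> pairing M \<xi> \<eta> (us @ y # xs @ zs) = (-1) ^ length xs * pairing M \<xi> \<eta> (us @ xs @ y # zs)"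
proof (induction xs arbitrary: us)
  case (Cons x xs)
  then have "x \<noteq> y" "y \<notin> set xs" by auto
  then show ?case
    using pairing_swap[of x y \<xi> \<eta> us "xs @ zs"] Cons.IH[of "us @ [x]"] by simp
qed simp

lemma pairing_gam_left: "pairing M (gam M j *v \<xi>) \<eta> is = pairing M \<xi> \<eta> (j # is)"
  by (simp add: pairing_def herm_gam)

lemma pairing_gam_right: "pairing M \<xi> (gam M j *v \<eta>) is = pairing M \<xi> \<eta> (is @ [j])"
  by (simp add: pairing_def act_append)

text \<open>Distinct generators anticommute, so on lists without repetition the Clifford product is
  already alternating and averaging over permutations changes nothing; repeated indices are killed
  by alternation. This replaces sums over permutations by single products.\<close>

lemma bil_distinct: "bil M \<xi> \<eta> is = (if distinct is then pairing M \<xi> \<eta> is else 0)"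
proof (cases "distinct is")
  case True
  define q where "q is = (if distinct is then pairing M \<xi> \<eta> is else 0)" for "is"
  have "alternating q"
  proof (rule alternating_adjacentI)
    show "q (xs @ y # x # ys) = - q (xs @ x # y # ys)" for xs x y ys
      by (cases "x = y") (auto simp: q_def pairing_swap[of x y])
  qed
  moreover have "alt (pairing M \<xi> \<eta>) is = alt q is"
    unfolding alt_def q_def using True by (intro sum.cong refl) auto
  ultimately show ?thesis using True by (simp add: bil_def alt_alternating q_def)
next
  case False
  then show ?thesis using alternating_not_distinct[OF alternating_bil] by simp
qed

text \<open>Left Clifford multiplication is exterior plus interior multiplication; for right
  multiplication the second sign is opposite.\<close>

lemma bil_gam_left:
  "bil M (gam M j *v \<xi>) \<eta> is = bil M \<xi> \<eta> (j # is) +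
     ext1 (\<lambda>i js. (if j = i then 1 else 0) * bil M \<xi> \<eta> js) is"
proof (cases "distinct is")
  case False
  have "alternating (ext1 (\<lambda>i js. (if j = i then 1 else 0) * bil M \<xi> \<eta> js))"
    by (intro alternating_ext1 alternating_cmult[where c = "\<lambda>_. _"] alternating_bil)
  then show ?thesis using False by (simp add: bil_distinct alternating_not_distinct)
next
  case True
  show ?thesis
  proof (cases "j \<in> set is")
    case False
    then show ?thesis using True by (simp add: ext1_delta_notin bil_distinct pairing_gam_left)
  next
    case j: True
    then obtain xs ys where e: "is = xs @ j # ys" by (metis split_list)
    then have n: "j \<notin> set xs" "j \<notin> set ys" "distinct (xs @ ys)" using True by auto
    \<comment> \<open>The new generator travels to its copy and squares to 1. The interior part
      contributes nothing here, since it would repeat the index j.\<close>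
    have "pairing M \<xi> \<eta> (j # xs @ j # ys) = (-1) ^ length xs * pairing M \<xi> \<eta> (xs @ ys)"
      using pairing_move[OF n(1), of \<xi> \<eta> "[]" "j # ys"] by (simp add: pairing_cancel)
    then show ?thesis
      using True j n by (simp add: e ext1_delta bil_distinct pairing_gam_left)
  qed
qed

lemma bil_gam_right:
  "bil M \<xi> (gam M j *v \<eta>) is = (-1) ^ length is * (bil M \<xi> \<eta> (j # is) -
     ext1 (\<lambda>i js. (if j = i then 1 else 0) * bil M \<xi> \<eta> js) is)"
proof (cases "distinct is")
  case False
  have "alternating (ext1 (\<lambda>i js. (if j = i then 1 else 0) * bil M \<xi> \<eta> js))"
    by (intro alternating_ext1 alternating_cmult[where c = "\<lambda>_. _"] alternating_bil)
  then show ?thesis using False by (simp add: bil_distinct alternating_not_distinct)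
next
  case True
  show ?thesis
  proof (cases "j \<in> set is")
    case False
    have "pairing M \<xi> \<eta> (j # is) = (-1) ^ length is * pairing M \<xi> \<eta> (is @ [j])"
      using pairing_move[OF False, of \<xi> \<eta> "[]" "[]"] by simp
    then show ?thesis
      using True False by (simp add: ext1_delta_notin bil_distinct pairing_gam_right flip: power_add)
  next
    case j: True
    then obtain xs ys where e: "is = xs @ j # ys" by (metis split_list)
    then have n: "j \<notin> set xs" "j \<notin> set ys" "distinct (xs @ ys)" using True by auto
    \<comment> \<open>The appended generator crosses only ys. This agrees with the claim because
      (-1)^(|xs| + 1 + |ys|) times -(-1)^|xs| is (-1)^|ys|.\<close>
    have "pairing M \<xi> \<eta> (xs @ ys) = (-1) ^ length ys * pairing M \<xi> \<eta> (xs @ j # ys @ [j])"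
      using pairing_move[OF n(2), of \<xi> \<eta> xs "[j]"] pairing_cancel[of \<xi> \<eta> "xs @ ys" j "[]"]
        pairing_cancel[of \<xi> \<eta> "xs" j "ys"]
      by (simp flip: power_add)
    then have "pairing M \<xi> \<eta> (xs @ j # ys @ [j]) = (-1) ^ length ys * pairing M \<xi> \<eta> (xs @ ys)"
      by (simp flip: power_add)
    then show ?thesis
      using True j n by (simp add: e ext1_delta bil_distinct pairing_gam_right power_add flip: mult.assoc)
  qed
qed

lemma bil_sum_left: "bil M (\<Sum>i\<in>I. c i *s \<xi> i) \<eta> is = (\<Sum>i\<in>I. cnj (c i) * bil M (\<xi> i) \<eta> is)"
  by (simp add: bil_distinct pairing_def herm_sum_left herm_smult_left)

lemma bil_sum_right: "bil M \<xi> (\<Sum>i\<in>I. c i *s \<eta> i) is = (\<Sum>i\<in>I. c i * bil M \<xi> (\<eta> i) is)"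
  by (simp add: bil_distinct pairing_def act_sum act_smult herm_sum_right herm_smult_right)

lemma bil_add_left: "bil M (\<xi> + \<zeta>) \<eta> is = bil M \<xi> \<eta> is + bil M \<zeta> \<eta> is"
  by (simp add: bil_distinct pairing_def herm_add_left)

lemma bil_add_right: "bil M \<xi> (\<eta> + \<zeta>) is = bil M \<xi> \<eta> is + bil M \<xi> \<zeta> is"
  by (simp add: bil_distinct pairing_def act_add herm_add_right)

lemma bil_minus_left: "bil M (- \<xi>) \<eta> is = - bil M \<xi> \<eta> is"
  using bil_sum_left[of "\<lambda>_. -1" "\<lambda>_. \<xi>" "{()}"] by (simp only: smult_minus1) simp

lemma bil_minus_right: "bil M \<xi> (- \<eta>) is = - bil M \<xi> \<eta> is"
  using bil_sum_right[of \<xi> "\<lambda>_. -1" "\<lambda>_. \<eta>" "{()}"] by (simp only: smult_minus1) simp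

section \<open>Infinitesimal spin rotations\<close>

definition spin_rot :: "('n \<Rightarrow> 'n \<Rightarrow> real) \<Rightarrow> complex^'s \<Rightarrow> complex^'s" where
  "spin_rot w \<eta> = (\<Sum>j\<in>UNIV. \<Sum>k\<in>UNIV. of_real (w k j / 4) *s (gam M j *v (gam M k *v \<eta>)))"

text \<open>Commuting \<Gamma>^j \<Gamma>^k with \<Gamma>^i leaves two terms with a factor 2; by
  skewness of w they agree, and the coefficient is (2 + 2)/4 = 1. This explains the 1/4 in the spin
  connection.\<close>

lemma spin_rot_gam:
  assumes skew: "\<And>j k. w j k = - w k j"
  shows "spin_rot w (gam M i *v \<eta>) - gam M i *v spin_rot w \<eta> = (\<Sum>k\<in>UNIV. of_real (w i k) *s (gam M k *v \<eta>))"
proof -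
  have c: "gam M j *v (gam M k *v (gam M i *v \<eta>)) - gam M i *v (gam M j *v (gam M k *v \<eta>)) =
      (if i = k then 2 else 0) *s (gam M j *v \<eta>) - (if i = j then 2 else 0) *s (gam M k *v \<eta>)" for j k
  proof -
    have 1: "gam M k *v (gam M i *v \<eta>) = (if i = k then 2 else 0) *s \<eta> - gam M i *v (gam M k *v \<eta>)"
      using gam_anticommute[of k i \<eta>] by (simp add: eq_commute[of i k])
    have 2: "gam M j *v (gam M i *v (gam M k *v \<eta>)) =
        (if i = j then 2 else 0) *s (gam M k *v \<eta>) - gam M i *v (gam M j *v (gam M k *v \<eta>))"
      using gam_anticommute[of j i "gam M k *v \<eta>"] by (simp add: eq_commute[of i j])
    show ?thesis
      unfolding 1 by (simp add: matrix_vector_mult_diff_distrib vector_scalar_commute 2)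
  qed
  have "spin_rot w (gam M i *v \<eta>) - gam M i *v spin_rot w \<eta> =
      (\<Sum>j\<in>UNIV. \<Sum>k\<in>UNIV. of_real (w k j / 4) *s
        ((if i = k then 2 else 0) *s (gam M j *v \<eta>) - (if i = j then 2 else 0) *s (gam M k *v \<eta>)))"
    unfolding spin_rot_def matrix_vector_mult_sum vector_scalar_commute sum_subtractf[symmetric]
    by (intro sum.cong refl) (simp only: vector_ssub_ldistrib[symmetric] c)
  also have "\<dots> = (\<Sum>j\<in>UNIV. \<Sum>k\<in>UNIV. (if i = k then of_real (w k j / 2) *s (gam M j *v \<eta>) else 0)) -
      (\<Sum>j\<in>UNIV. \<Sum>k\<in>UNIV. (if i = j then of_real (w k j / 2) *s (gam M k *v \<eta>) else 0))"
    unfolding sum_subtractf[symmetric]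
    by (intro sum.cong refl) (auto simp: vector_ssub_ldistrib vector_smult_assoc)
  also have "\<dots> = (\<Sum>j\<in>UNIV. of_real (w i j / 2) *s (gam M j *v \<eta>)) -
      (\<Sum>k\<in>UNIV. of_real (w k i / 2) *s (gam M k *v \<eta>))"
    by (subst (2) sum.swap) simp
  also have "\<dots> = (\<Sum>k\<in>UNIV. of_real (w i k) *s (gam M k *v \<eta>))"
    unfolding sum_subtractf[symmetric] vector_sub_rdistrib[symmetric]
    by (intro sum.cong refl) (simp add: skew[of _ i] flip: of_real_diff)
  finally show ?thesis .
qed

text \<open>Taking a commutator is a derivation of Clifford products, so the rule for one generator
  extends along the list.\<close>

lemma spin_rot_act:
  assumes skew: "\<And>j k. w j k = - w k j"
  shows "spin_rot w (act M is \<eta>) - act M is (spin_rot w \<eta>) =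
    (\<Sum>m<length is. \<Sum>k\<in>UNIV. of_real (w (is ! m) k) *s act M (is[m := k]) \<eta>)"
proof (induction "is")
  case (Cons i "is")
  have "spin_rot w (act M (i # is) \<eta>) - act M (i # is) (spin_rot w \<eta>) =
      (spin_rot w (gam M i *v act M is \<eta>) - gam M i *v spin_rot w (act M is \<eta>)) +
      gam M i *v (spin_rot w (act M is \<eta>) - act M is (spin_rot w \<eta>))"
    by (simp add: matrix_vector_mult_diff_distrib)
  also have "\<dots> = (\<Sum>k\<in>UNIV. of_real (w i k) *s (gam M k *v act M is \<eta>)) +
      gam M i *v (\<Sum>m<length is. \<Sum>k\<in>UNIV. of_real (w (is ! m) k) *s act M (is[m := k]) \<eta>)"
    unfolding Cons.IH spin_rot_gam[OF skew] ..
  also have "\<dots> = (\<Sum>m<length (i # is). \<Sum>k\<in>UNIV. of_real (w ((i # is) ! m) k) *s act M ((i # is)[m := k]) \<eta>)"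
    unfolding length_Cons sum.lessThan_Suc_shift
    by (simp add: matrix_vector_mult_sum vector_scalar_commute)
  finally show ?case .
qed simp

text \<open>The generators are self-adjoint, so taking adjoints reverses \<Gamma>^j \<Gamma>^k, and
  skewness of w turns the reversal into a sign: spin rotations are skew-Hermitian.\<close>

lemma herm_spin_rot:
  assumes skew: "\<And>j k. w j k = - w k j"
  shows "herm M (spin_rot w \<xi>) \<eta> = - herm M \<xi> (spin_rot w \<eta>)"
proof -
  have "herm M (spin_rot w \<xi>) \<eta> =
      (\<Sum>j\<in>UNIV. \<Sum>k\<in>UNIV. of_real (w k j / 4) * herm M \<xi> (gam M k *v (gam M j *v \<eta>)))"
    by (simp add: spin_rot_def herm_sum_left herm_smult_left herm_gam)
  also have "\<dots> = (\<Sum>k\<in>UNIV. \<Sum>j\<in>UNIV. of_real (w k j / 4) * herm M \<xi> (gam M k *v (gam M j *v \<eta>)))"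
    by (rule sum.swap)
  also have "\<dots> = (\<Sum>k\<in>UNIV. \<Sum>j\<in>UNIV. - (of_real (w j k / 4) * herm M \<xi> (gam M k *v (gam M j *v \<eta>))))"
  proof (intro sum.cong refl)
    fix j k
    show "of_real (w k j / 4) * herm M \<xi> (gam M k *v (gam M j *v \<eta>)) =
        - (of_real (w j k / 4) * herm M \<xi> (gam M k *v (gam M j *v \<eta>)))"
      using skew[of k j] by simp
  qed
  also have "\<dots> = - herm M \<xi> (spin_rot w \<eta>)"
    by (simp add: spin_rot_def herm_sum_right herm_smult_right sum_negf)
  finally show ?thesis .
qed

text \<open>The rotations in the two slots combine to a commutator with the Clifford product, that
  is, to the tensorial rotation of the components. This is the algebraic part of the compatibility
  of the spin connection with the Levi-Civita connection.\<close>

lemma bil_spin_rot: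
  assumes skew: "\<And>j k. w j k = - w k j"
  shows "bil M (spin_rot w \<xi>) \<eta> is + bil M \<xi> (spin_rot w \<eta>) is = - frame_deriv w (bil M \<xi> \<eta>) is"
proof -
  have p: "pairing M (spin_rot w \<xi>) \<eta> js + pairing M \<xi> (spin_rot w \<eta>) js = - frame_deriv w (pairing M \<xi> \<eta>) js" for js
  proof -
    have "pairing M (spin_rot w \<xi>) \<eta> js + pairing M \<xi> (spin_rot w \<eta>) js =
        - herm M \<xi> (spin_rot w (act M js \<eta>) - act M js (spin_rot w \<eta>))"
      by (simp add: pairing_def herm_spin_rot[OF skew] diff_conv_add_uminus herm_add_right herm_minus_right
          del: add_uminus_conv_diff)
    then show ?thesis
      unfolding spin_rot_act[OF skew]
      by (simp add: frame_deriv_def pairing_def herm_sum_right herm_smult_right)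
  qed
  have "bil M (spin_rot w \<xi>) \<eta> is + bil M \<xi> (spin_rot w \<eta>) is =
      alt (\<lambda>js. pairing M (spin_rot w \<xi>) \<eta> js + pairing M \<xi> (spin_rot w \<eta>) js) is / fact (length is)"
    by (simp add: bil_def alt_add add_divide_distrib)
  also have "\<dots> = alt (\<lambda>js. (-1) * frame_deriv w (pairing M \<xi> \<eta>) js) is / fact (length is)"
    unfolding p by simp
  also have "\<dots> = - (1 / fact (length is) * frame_deriv w (alt (pairing M \<xi> \<eta>)) is)"
    unfolding alt_cmult alt_frame_deriv by simp
  also have "\<dots> = - frame_deriv w (bil M \<xi> \<eta>) is"
    unfolding frame_deriv_cmult[symmetric] by (simp add: bil_def cong: frame_deriv_cong)
  finally show ?thesis .
qed

section \<open>The 2-form acting on spinors\<close>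

lemma cl2_gam:
  assumes skew: "\<And>i j. \<phi> [i, j] = - \<phi> [j, i]"
  shows "cl2 M \<phi> (gam M k *v \<eta>) = gam M k *v cl2 M \<phi> \<eta> - 4 *s (\<Sum>j\<in>UNIV. \<phi> [k, j] *s (gam M j *v \<eta>))"
proof -
  have c: "gam M i *v (gam M j *v (gam M k *v \<eta>)) = gam M k *v (gam M i *v (gam M j *v \<eta>)) +
      ((if k = j then 2 else 0) *s (gam M i *v \<eta>) - (if k = i then 2 else 0) *s (gam M j *v \<eta>))" for i j
  proof -
    have 1: "gam M j *v (gam M k *v \<eta>) = (if k = j then 2 else 0) *s \<eta> - gam M k *v (gam M j *v \<eta>)"
      using gam_anticommute[of j k \<eta>] by (simp add: eq_commute[of k j])
    have 2: "gam M i *v (gam M k *v (gam M j *v \<eta>)) =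
        (if k = i then 2 else 0) *s (gam M j *v \<eta>) - gam M k *v (gam M i *v (gam M j *v \<eta>))"
      using gam_anticommute[of i k "gam M j *v \<eta>"] by (simp add: eq_commute[of k i])
    show ?thesis
      unfolding 1 by (simp add: matrix_vector_mult_diff_distrib vector_scalar_commute 2)
  qed
  have "cl2 M \<phi> (gam M k *v \<eta>) = gam M k *v cl2 M \<phi> \<eta> +
     ((\<Sum>i\<in>UNIV. \<Sum>j\<in>UNIV. if k = j then (2 * \<phi> [i, j]) *s (gam M i *v \<eta>) else 0) -
      (\<Sum>i\<in>UNIV. \<Sum>j\<in>UNIV. if k = i then (2 * \<phi> [i, j]) *s (gam M j *v \<eta>) else 0))"
    unfolding cl2_def matrix_vector_mult_sum vector_scalar_commute sum_subtractf[symmetric] sum.distrib[symmetric]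
    by (intro sum.cong refl) (auto simp: c vector_add_ldistrib vector_ssub_ldistrib vector_smult_assoc mult.commute)
  also have "(\<Sum>i\<in>UNIV. \<Sum>j\<in>UNIV. if k = j then (2 * \<phi> [i, j]) *s (gam M i *v \<eta>) else 0) -
      (\<Sum>i\<in>UNIV. \<Sum>j\<in>UNIV. if k = i then (2 * \<phi> [i, j]) *s (gam M j *v \<eta>) else 0) =
      (\<Sum>i\<in>UNIV. (2 * \<phi> [i, k]) *s (gam M i *v \<eta>)) - (\<Sum>j\<in>UNIV. (2 * \<phi> [k, j]) *s (gam M j *v \<eta>))"
    by (subst (2) sum.swap) simp
  \<comment> \<open>The anticommutator gives a factor 2, and skewness makes the two sums opposite,
    which doubles it; \<open>cl2\<close> has no 1/2 to compensate.\<close>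
  also have "\<dots> = - (4 *s (\<Sum>j\<in>UNIV. \<phi> [k, j] *s (gam M j *v \<eta>)))"
    unfolding smult_sum_right sum_subtractf[symmetric] sum_negf[symmetric]
    by (intro sum.cong refl) (simp add: skew[of _ k] vec_eq_iff algebra_simps)
  finally show ?thesis by simp
qed

text \<open>The vector is brought to the left of cl(F), where it multiplies the v-independent spinor
  cl(F) \<eta> and can be exchanged for operations on forms. The commutators merge with the k2 term
  to k2 - 4 k1.\<close>

lemma twist_spinor:
  assumes skew: "\<And>i j. \<phi> [i, j] = - \<phi> [j, i]"
  shows "k1 *s cl2 M \<phi> (cl M v *v \<eta>) + k2 *s cl1 M (iprod v \<phi>) \<eta> =
    (\<Sum>j\<in>UNIV. (k1 * of_real (v $ j)) *s (gam M j *v cl2 M \<phi> \<eta>)) +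
    (\<Sum>j\<in>UNIV. ((k2 - 4 * k1) * iprod v \<phi> [j]) *s (gam M j *v \<eta>))"
proof -
  have lin: "cl2 M \<phi> (\<Sum>i\<in>I. c i *s f i) = (\<Sum>i\<in>I. c i *s cl2 M \<phi> (f i))" for I :: "'n set" and c f
  proof -
    have a: "cl2 M \<phi> (\<xi> + \<zeta>) = cl2 M \<phi> \<xi> + cl2 M \<phi> \<zeta>" and z: "cl2 M \<phi> 0 = 0" for \<xi> \<zeta>
      by (simp_all add: cl2_def matrix_vector_right_distrib vector_add_ldistrib sum.distrib)
    have m: "cl2 M \<phi> (z *s \<xi>) = z *s cl2 M \<phi> \<xi>" for z \<xi>
      by (simp add: cl2_def vector_scalar_commute smult_sum_right vector_smult_assoc mult.commute)
    show ?thesis by (induction I rule: infinite_finite_induct) (simp_all add: a z m)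
  qed
  have "k1 *s cl2 M \<phi> (cl M v *v \<eta>) = (\<Sum>k\<in>UNIV. (k1 * of_real (v $ k)) *s (gam M k *v cl2 M \<phi> \<eta>)) -
      (\<Sum>k\<in>UNIV. \<Sum>j\<in>UNIV. (4 * k1 * of_real (v $ k) * \<phi> [k, j]) *s (gam M j *v \<eta>))"
    unfolding cl_mult lin cl2_gam[where \<phi> = \<phi>, OF skew] smult_sum_right sum_subtractf[symmetric]
    by (intro sum.cong refl) (simp add: vector_ssub_ldistrib smult_sum_right vector_smult_assoc mult_ac)
  also have "(\<Sum>k\<in>UNIV. \<Sum>j\<in>UNIV. (4 * k1 * of_real (v $ k) * \<phi> [k, j]) *s (gam M j *v \<eta>)) =
      (\<Sum>j\<in>UNIV. (4 * k1 * iprod v \<phi> [j]) *s (gam M j *v \<eta>))"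
    by (subst sum.swap) (simp add: iprod_def sum_distrib_left smult_sum_left mult_ac)
  finally have 1: "k1 *s cl2 M \<phi> (cl M v *v \<eta>) = (\<Sum>k\<in>UNIV. (k1 * of_real (v $ k)) *s (gam M k *v cl2 M \<phi> \<eta>)) -
      (\<Sum>j\<in>UNIV. (4 * k1 * iprod v \<phi> [j]) *s (gam M j *v \<eta>))" .
  have 2: "k2 *s cl1 M (iprod v \<phi>) \<eta> = (\<Sum>j\<in>UNIV. (k2 * iprod v \<phi> [j]) *s (gam M j *v \<eta>))"
    by (simp add: cl1_def smult_sum_right vector_smult_assoc)
  have 3: "(\<Sum>j\<in>UNIV. ((k2 - 4 * k1) * iprod v \<phi> [j]) *s (gam M j *v \<eta>)) =
      (\<Sum>j\<in>UNIV. (k2 * iprod v \<phi> [j]) *s (gam M j *v \<eta>)) - (\<Sum>j\<in>UNIV. (4 * k1 * iprod v \<phi> [j]) *s (gam M j *v \<eta>))"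
    by (simp add: left_diff_distrib vector_sub_rdistrib sum_subtractf)
  show ?thesis unfolding 1 2 3 by simp
qed

section \<open>The spin group and frame covariance of the bilinears\<close>

lemma cl_cl: "cl M v *v (cl M v *v \<eta>) = of_real (v \<bullet> v) *s \<eta>"
proof -
  have "(cl M v ** cl M v + cl M v ** cl M v) *v \<eta> = mat (of_real (2 * (v \<bullet> v))) *v \<eta>"
    by (simp only: cl_anticommute)
  moreover have "mat c *v \<eta> = c *s \<eta>" for c
    by (simp add: vec_eq_iff matrix_vector_mult_def mat_def if_distrib[of "\<lambda>x. x * _"] cong: if_cong)
  ultimately show ?thesis
    unfolding matrix_vector_mult_add_rdistrib matrix_vector_mul_assoc[symmetric]
    by (simp add: vec_eq_iff)
qed

text \<open>A unit vector acts as a self-adjoint involution, hence unitarily.\<close>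

lemma herm_spin_group:
  assumes "L \<in> spin_group M"
  shows "herm M (L *v \<xi>) (L *v \<eta>) = herm M \<xi> \<eta>"
proof -
  obtain vs where L: "L = cl_prod M vs" and u: "\<forall>v\<in>set vs. norm v = 1"
    using assms by (auto simp: spin_group_def)
  show ?thesis
    unfolding L using u
  proof (induction vs)
    case (Cons v vs)
    then have "v \<bullet> v = 1" by (simp add: dot_square_norm)
    then show ?case using Cons
      by (simp add: cl_prod_def herm_cl cl_cl flip: matrix_vector_mul_assoc)
  qed (simp add: cl_prod_def)
qed

text \<open>Intertwining carries cl(v)^2 = |v|^2 to cl(R v)^2 = |R v|^2, and evaluation on a nonzero
  spinor compares the two scalars. Orthogonality of the transition matrices is thus obtained from
  the lift.\<close>

lemma orthogonal_of_spin_lift: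
  fixes R :: "real^'n^'n"
  assumes L: "L \<in> spin_group M" and e: "\<And>v. L ** cl M v = cl M (R *v v) ** L"
  shows "orthogonal_matrix R"
proof -
  \<comment> \<open>Any nonzero spinor serves; L \<eta> is nonzero because L preserves the Hermitian
    form.\<close>
  define \<eta> :: "complex^'s" where "\<eta> = 1"
  have "herm M (L *v \<eta>) (L *v \<eta>) \<noteq> 0"
    using herm_pos[of \<eta>] by (auto simp: herm_spin_group[OF L] \<eta>_def)
  then have nz: "L *v \<eta> \<noteq> 0" by auto
  have e': "L *v (cl M v *v \<zeta>) = cl M (R *v v) *v (L *v \<zeta>)" for v \<zeta>
    using e[of v] by (simp add: matrix_vector_mul_assoc)
  have "norm (R *v v) = norm v" for v
  proof -
    have "of_real ((R *v v) \<bullet> (R *v v)) *s (L *v \<eta>) = of_real (v \<bullet> v) *s (L *v \<eta>)"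
      by (simp add: cl_cl[symmetric] e'[symmetric]) (simp add: cl_cl vector_scalar_commute)
    then have "(complex_of_real ((R *v v) \<bullet> (R *v v)) - of_real (v \<bullet> v)) *s (L *v \<eta>) = 0"
      by (simp add: vector_sub_rdistrib)
    then have "complex_of_real ((R *v v) \<bullet> (R *v v)) = of_real (v \<bullet> v)"
      using nz by (simp add: vector_mul_eq_0)
    then show ?thesis by (simp add: norm_eq_sqrt_inner)
  qed
  then have "orthogonal_transformation ((*v) R)"
    by (simp add: orthogonal_transformation)
  then show ?thesis
    by (simp add: orthogonal_transformation_matrix)
qed

text \<open>Self-adjointness moves the generators one at a time to the left spinor, so that L stands
  on both sides throughout and its unitarity closes the induction.\<close>

lemma bil_change_frame:
  fixes R :: "real^'n^'n"
  assumes L: "L \<in> spin_group M" and e: "\<And>v. L ** cl M v = cl M (R *v v) ** L"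
  shows "bil M (L *v \<xi>) (L *v \<eta>) is = change_frame R (bil M \<xi> \<eta>) is"
proof -
  have R: "R ** Finite_Cartesian_Product.transpose R = mat 1"
    using orthogonal_of_spin_lift[OF L e] by (simp add: orthogonal_matrix_def)
  have g: "gam M i *v (L *v \<zeta>) = L *v (\<Sum>j\<in>UNIV. of_real (R $ i $ j) *s (gam M j *v \<zeta>))" for i \<zeta>
  proof -
    \<comment> \<open>Chosen so that R maps it to e_i; its components are row i of R.\<close>
    let ?u = "Finite_Cartesian_Product.transpose R *v axis i 1"
    have "R *v ?u = axis i 1" by (simp only: matrix_vector_mul_assoc R matrix_vector_mul_lid)
    then have "gam M i *v (L *v \<zeta>) = L *v (cl M ?u *v \<zeta>)"
      using e[of ?u] by (simp add: matrix_vector_mul_assoc cl_axis)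
    moreover have "?u $ j = R $ i $ j" for j
      by (simp add: matrix_vector_mult_basis column_def Finite_Cartesian_Product.transpose_def)
    ultimately show ?thesis by (simp add: cl_mult)
  qed
  have "pairing M (L *v \<xi>) (L *v \<eta>) js = change_frame R (pairing M \<xi> \<eta>) js" for js
  proof (induction js arbitrary: \<xi>)
    case Nil
    then show ?case by (simp add: pairing_def herm_spin_group[OF L])
  next
    case (Cons i js)
    have "pairing M (L *v \<xi>) (L *v \<eta>) (i # js) =
        change_frame R (pairing M (\<Sum>j\<in>UNIV. of_real (R $ i $ j) *s (gam M j *v \<xi>)) \<eta>) js"
      unfolding pairing_gam_left[symmetric] g by (rule Cons.IH)
    also have "pairing M (\<Sum>j\<in>UNIV. of_real (R $ i $ j) *s (gam M j *v \<xi>)) \<eta> =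
        (\<lambda>ks. \<Sum>j\<in>UNIV. of_real (R $ i $ j) * pairing M \<xi> \<eta> (j # ks))"
      by (simp add: fun_eq_iff pairing_def herm_sum_left herm_smult_left herm_gam)
    finally show ?case
      by (simp add: change_frame_sum change_frame_cmult change_frame_Cons)
  qed
  then have "bil M (L *v \<xi>) (L *v \<eta>) is = 1 / fact (length is) * alt (change_frame R (pairing M \<xi> \<eta>)) is"
    by (simp add: bil_def cong: alt_cong)
  also have "\<dots> = change_frame R (bil M \<xi> \<eta>) is"
    unfolding change_frame_alt[symmetric] change_frame_cmult[symmetric]
    by (rule change_frame_cong) (simp add: bil_def)
  finally show ?thesis .
qed

end

section \<open>Covariant and exterior derivatives\<close>

lemma differentiable_on_openD:
  "f differentiable_on V \<Longrightarrow> open V \<Longrightarrow> u \<in> V \<Longrightarrow> f differentiable at u"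
  by (metis at_within_open differentiable_on_def)

section \<open>Differentiability classes and bilinear maps\<close>

lemma Ck_on_cong:
  assumes V: "open V" and "Ck_on k f V" "\<And>u. u \<in> V \<Longrightarrow> f u = g u"
  shows "Ck_on k g V"
  using assms(2,3)
proof (induction k arbitrary: f g)
  case 0
  have "continuous_on V f = continuous_on V g"
    by (rule continuous_on_cong[OF refl]) (rule 0(2))
  then show ?case using 0(1) by (simp only: Ck_on.simps)
next
  case (Suc k)
  have f: "f differentiable_on V" "\<And>v. Ck_on k (\<lambda>u. frechet_derivative f (at u) v) V"
    using Suc.prems(1) by simp_all
  have d: "g differentiable_on V"
    unfolding differentiable_on_def
  proof
    fix u assume u: "u \<in> V"
    then have "f differentiable at u within V" using f(1) by (simp add: differentiable_on_def)
    then show "g differentiable at u within V"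
      by (rule differentiable_transform_within[where d = 1]) (simp_all add: u Suc.prems(2))
  qed
  have e: "frechet_derivative f (at u) = frechet_derivative g (at u)" if "u \<in> V" for u
    by (rule frechet_derivative_transform_within_open[OF differentiable_on_openD[OF f(1) V that] V that])
      (rule Suc.prems(2))
  have "Ck_on k (\<lambda>u. frechet_derivative g (at u) v) V" for v
    by (rule Suc.IH[OF f(2)[of v]]) (simp only: e)
  with d show ?case by (simp only: Ck_on.simps simp_thms)
qed

lemma Ck_on_Suc_imp: "Ck_on (Suc k) f V \<Longrightarrow> Ck_on k f V"
proof (induction k arbitrary: f)
  case 0
  then show ?case by (simp add: differentiable_imp_continuous_on)
next
  case (Suc k)
  then show ?case by (metis Ck_on.simps(2))
qed

text \<open>Any explicit derivative D may stand in for \<open>frechet_derivative\<close>; on an open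
  set the two agree by uniqueness.\<close>

lemma Ck_on_SucI:
  assumes V: "open V" and D: "\<And>u. u \<in> V \<Longrightarrow> (f has_derivative D u) (at u)"
    and C: "\<And>v. Ck_on k (\<lambda>u. D u v) V"
  shows "Ck_on (Suc k) f V"
proof -
  have "f differentiable_on V"
    unfolding differentiable_on_def using D V by (metis at_within_open differentiableI)
  moreover have "Ck_on k (\<lambda>u. frechet_derivative f (at u) v) V" for v
    by (rule Ck_on_cong[OF V C[of v]]) (metis D frechet_derivative_at)
  ultimately show ?thesis by simp
qed

lemma Ck_on_SucD:
  assumes "Ck_on (Suc k) f V" "open V" "u \<in> V"
  shows "(f has_derivative frechet_derivative f (at u)) (at u)"
proof -
  have "f differentiable at u"
    by (rule differentiable_on_openD[OF _ assms(2,3)]) (use assms(1) in simp)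
  then show ?thesis by (simp only: frechet_derivative_works)
qed

lemma Ck_on_add:
  assumes V: "open V" and "Ck_on k f V" "Ck_on k g V"
  shows "Ck_on k (\<lambda>u. f u + g u) V"
  using assms(2,3)
proof (induction k arbitrary: f g)
  case 0
  then show ?case by (simp add: continuous_on_add)
next
  case (Suc k)
  show ?case
  proof (rule Ck_on_SucI[OF V])
    show "((\<lambda>u. f u + g u) has_derivative
        (\<lambda>v. frechet_derivative f (at u) v + frechet_derivative g (at u) v)) (at u)" if "u \<in> V" for u
      using Suc.prems that V by (intro has_derivative_add) (auto intro: Ck_on_SucD)
    show "Ck_on k (\<lambda>u. frechet_derivative f (at u) v + frechet_derivative g (at u) v) V" for v
      using Suc.prems by (intro Suc.IH) simp_all
  qed
qed

text \<open>Product rule and induction on k. Both factors vary because the rule pairs the derivative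
  of one with the other, whose surplus order of differentiability is dropped.\<close>

lemma Ck_on_bilinear:
  assumes B: "bounded_bilinear B" and V: "open V" and "Ck_on k f V" "Ck_on k g V"
  shows "Ck_on k (\<lambda>u. B (f u) (g u)) V"
  using assms(3,4)
proof (induction k arbitrary: f g)
  case 0
  then show ?case by (simp add: bounded_bilinear.continuous_on[OF B])
next
  case (Suc k)
  show ?case
  proof (rule Ck_on_SucI[OF V])
    show "((\<lambda>u. B (f u) (g u)) has_derivative
        (\<lambda>v. B (f u) (frechet_derivative g (at u) v) + B (frechet_derivative f (at u) v) (g u))) (at u)"
      if "u \<in> V" for u
      using Suc.prems that V by (intro bounded_bilinear.FDERIV[OF B]) (auto intro: Ck_on_SucD)
    show "Ck_on k (\<lambda>u. B (f u) (frechet_derivative g (at u) v) + B (frechet_derivative f (at u) v) (g u)) V" for v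
    proof (intro Ck_on_add[OF V] Suc.IH)
      show "Ck_on k f V" "Ck_on k g V"
        using Suc.prems by (simp_all only: Ck_on_Suc_imp)
      show "Ck_on k (\<lambda>u. frechet_derivative f (at u) v) V" "Ck_on k (\<lambda>u. frechet_derivative g (at u) v) V"
        using Suc.prems by simp_all
    qed
  qed
qed

section \<open>Covariant and exterior derivatives in a frame\<close>

definition diff_at ::
  "('a,'m,'n::finite,'s::finite) spin_data \<Rightarrow> 'a \<Rightarrow> 'm \<Rightarrow> ('m \<Rightarrow> 'b::real_normed_vector) \<Rightarrow> bool" where
  "diff_at M a x f \<longleftrightarrow> in_coord M a f differentiable at (coord M a x)"

lemma ddir_has_derivative:
  assumes "(in_coord M a f has_derivative D) (at (coord M a x))"
  shows "ddir M a x v f = D (\<Sum>i\<in>UNIV. (v $ i) *\<^sub>R (eframe M a x $ i))"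
  using frechet_derivative_at[OF assms] by (simp add: ddir_def)

lemma ddir_cmult:
  fixes f :: "'m \<Rightarrow> complex"
  assumes "diff_at M a x f"
  shows "ddir M a x v (\<lambda>y. c * f y) = c * ddir M a x v f"
proof -
  have "(in_coord M a f has_derivative frechet_derivative (in_coord M a f) (at (coord M a x))) (at (coord M a x))"
    using assms by (simp add: diff_at_def frechet_derivative_works[symmetric])
  then have "((\<lambda>u. c * in_coord M a f u) has_derivative
      (\<lambda>h. c * frechet_derivative (in_coord M a f) (at (coord M a x)) h)) (at (coord M a x))"
    by (rule has_derivative_mult_right)
  then have "(in_coord M a (\<lambda>y. c * f y) has_derivative
      (\<lambda>h. c * frechet_derivative (in_coord M a f) (at (coord M a x)) h)) (at (coord M a x))"
    by (simp add: in_coord_def o_def)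
  from ddir_has_derivative[OF this] show ?thesis by (simp add: ddir_def)
qed

lemma ddir_0 [simp]: "ddir M a x v (\<lambda>y. 0 :: 'b::real_normed_vector) = 0"
proof -
  have "(in_coord M a (\<lambda>y. 0 :: 'b) has_derivative (\<lambda>h. 0)) (at (coord M a x))"
    by (simp add: in_coord_def o_def)
  from ddir_has_derivative[OF this] show ?thesis .
qed

lemma nabla_frame_deriv:
  "nabla M \<omega> a x v is = ddir M a x v (\<lambda>y. \<omega> a y is) - frame_deriv (conn M a x v) (\<omega> a x) is"
  by (simp add: nabla_def frame_deriv_def)

lemma alternating_nabla:
  assumes a: "\<And>y. alternating (\<omega> a y)" and d: "\<And>is. diff_at M a x (\<lambda>y. \<omega> a y is)"
  shows "alternating (nabla M \<omega> a x v)"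
  unfolding alternating_def nabla_frame_deriv
  by (simp add: alternatingD[OF a] alternatingD[OF alternating_frame_deriv[OF a]] ddir_cmult[OF d] right_diff_distrib)

text \<open>Replacing entry m by k equals putting k in front of the shortened list, up to (-1)^m. So
  the connection term is e^j \<and> w_jk i_{e_k} \<omega>, to which the rules of \<open>ext1\<close>
  apply.\<close>

lemma frame_deriv_ext1:
  assumes a: "alternating \<omega>"
  shows "frame_deriv w \<omega> is = ext1 (\<lambda>j js. \<Sum>k\<in>UNIV. of_real (w j k) * \<omega> (k # js)) is"
  unfolding frame_deriv_def ext1_def
proof (intro sum.cong refl)
  fix m assume m: "m \<in> {..<length is}"
  have e: "\<omega> (is[m := k]) = (-1) ^ m * \<omega> (k # omit {m} is)" for k
  proof -
    have "omit {m} (is[m := k]) = omit {m} is"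
      using m by (intro nth_equalityI) (auto simp: nth_omit nth_list_update)
    then have "\<omega> (k # omit {m} is) = (-1) ^ m * \<omega> (is[m := k])"
      using alternating_front[OF a, of m "is[m := k]"] m by simp
    then show ?thesis by (simp flip: power_add mult.assoc)
  qed
  show "(\<Sum>k\<in>UNIV. of_real (w (is ! m) k) * \<omega> (is[m := k])) =
      (-1) ^ m * (\<Sum>k\<in>UNIV. of_real (w (is ! m) k) * \<omega> (k # omit {m} is))"
    by (simp add: e sum_distrib_left mult_ac)
qed

text \<open>Each pair of positions is deleted in two orders, with opposite signs. Collected over k <
  l, the double sum has the shape of the bracket terms in \<open>ext_d\<close>.\<close>

lemma ext1_ext1_pairs:
  "ext1 (\<lambda>i. ext1 (S i)) is = (\<Sum>l<length is. \<Sum>k<l. (-1) ^ (k + l) *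
     (S (is ! l) (is ! k) (omit {k, l} is) - S (is ! k) (is ! l) (omit {k, l} is)))"
proof (induction "is" arbitrary: S)
  case (Cons i "is")
  have o: "omit {0, Suc l} (i # is) = omit {l} is" "k < l \<Longrightarrow> omit {Suc k, Suc l} (i # is) = i # omit {k, l} is" for k l
    by (simp_all add: omit_2)
  have "ext1 (\<lambda>j. ext1 (S j)) (i # is) =
      ext1 (\<lambda>j js. S i j js - S j i js) is + ext1 (\<lambda>j. ext1 (\<lambda>k ks. S j k (i # ks))) is"
    by (simp add: ext1_Cons ext1_diff)
  also have "ext1 (\<lambda>j js. S i j js - S j i js) is = (\<Sum>l<length is. (-1) ^ Suc l *
      (S (is ! l) i (omit {l} is) - S i (is ! l) (omit {l} is)))"
    by (simp add: ext1_def algebra_simps sum_subtractf)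
  also have "ext1 (\<lambda>j. ext1 (\<lambda>k ks. S j k (i # ks))) is = (\<Sum>l<length is. \<Sum>k<l. (-1) ^ (k + l) *
     (S (is ! l) (is ! k) (i # omit {k, l} is) - S (is ! k) (is ! l) (i # omit {k, l} is)))"
    by (rule Cons.IH)
  finally show ?case
    unfolding length_Cons sum.lessThan_Suc_shift by (simp add: o sum.distrib sum_subtractf sum_negf)
qed simp

lemma conn_axis: "conn M a x (axis i 1) j k = levi_civita M a x i j k"
proof -
  have "conn M a x (axis i 1) j k = (\<Sum>l\<in>UNIV. if l = i then levi_civita M a x l j k else 0)"
    unfolding conn_def by (intro sum.cong) (auto simp: axis_def)
  then show ?thesis by simp
qed

lemma conn_skew: "conn M a x v j k = - conn M a x v k j"
  unfolding conn_def sum_negf[symmetric]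
  by (intro sum.cong refl) (metis levi_civita_metric mult_minus_right)

text \<open>Torsion-freeness: skew-symmetrising the connection coefficients leaves the brackets of
  the frame. In the form d = e^i \<and> \<nabla>_{e_i} it makes d \<chi>_p appear when the equation
  is skew-symmetrised.\<close>

lemma ext_d_nabla:
  assumes a: "alternating (\<omega> a x)"
  shows "ext_d M \<omega> a x is = ext1 (\<lambda>i. nabla M \<omega> a x (axis i 1)) is"
proof -
  have "ext1 (\<lambda>i. frame_deriv (conn M a x (axis i 1)) (\<omega> a x)) is =
      ext1 (\<lambda>i. ext1 (\<lambda>j js. \<Sum>k\<in>UNIV. of_real (levi_civita M a x i j k) * \<omega> a x (k # js))) is"
    by (simp add: frame_deriv_ext1[OF a] conn_axis cong: ext1_cong)
  also have "\<dots> = (\<Sum>l<length is. \<Sum>k<l. (-1) ^ (k + l) *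
      - (\<Sum>j\<in>UNIV. of_real (frame_bracket M a x (is ! k) (is ! l) j) * \<omega> a x (j # omit {k, l} is)))"
    unfolding ext1_ext1_pairs levi_civita_torsion_free[symmetric]
    by (simp add: left_diff_distrib sum_subtractf)
  finally have "ext1 (\<lambda>i. frame_deriv (conn M a x (axis i 1)) (\<omega> a x)) is = \<dots>" .
  moreover have "ext1 (\<lambda>i. nabla M \<omega> a x (axis i 1)) is =
      ext1 (\<lambda>i js. ddir M a x (axis i 1) (\<lambda>y. \<omega> a y js) - frame_deriv (conn M a x (axis i 1)) (\<omega> a x) js) is"
    by (rule ext1_cong) (simp add: nabla_frame_deriv)
  ultimately show ?thesis
    by (simp add: ext_d_def ext1_diff sum_negf) (simp add: ext1_def)
qed

lemma in_coord_bilinears: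
  fixes M :: "('a,'m,'n::finite,'s::finite) spin_data"
  shows "in_coord M a (\<lambda>y. bilinears M \<epsilon> a y is) =
    (\<lambda>u. \<i> ^ (length is div 2) * bil M (in_coord M a (\<epsilon> a) u) (in_coord M a (\<epsilon> a) u) is)"
  by (simp add: fun_eq_iff in_coord_def bilinears_def bilinear_axis)

lemma alternating_bilinears: "alternating (bilinears M \<epsilon> a x)"
  by (simp add: alternating_def bilinears_def bilinear_axis alternatingD[OF alternating_bil])

section \<open>Smoothness and derivatives of the bilinears\<close>

context
  fixes M :: "('a,'m::{t2_space,second_countable_topology},'n::finite,'s::finite) spin_data"
  assumes M: "spin_manifold M"
begin

lemma spinor_module_of_manifold: "spinor_module M"
  using M by (simp add: spin_manifold_def)

lemma open_coord: "a \<in> patches M \<Longrightarrow> open (coord M a ` patch M a)"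
  using M by (simp add: spin_manifold_def smooth_atlas_def)

lemma inv_coord:
  assumes "a \<in> patches M" "x \<in> patch M a"
  shows "inv_into (patch M a) (coord M a) (coord M a x) = x"
proof -
  obtain \<psi> where "homeomorphism (patch M a) (coord M a ` patch M a) (coord M a) \<psi>"
    using M assms(1) unfolding spin_manifold_def smooth_atlas_def by blast
  then have "inj_on (coord M a) (patch M a)"
    by (metis homeomorphism_apply1 inj_on_inverseI)
  then show ?thesis using assms(2) by simp
qed

lemma smooth_imp_diff_at:
  assumes "a \<in> patches M" "x \<in> patch M a" "smooth_at_patch M a f"
  shows "diff_at M a x f"
proof -
  have "Ck_on (Suc 0) (in_coord M a f) (coord M a ` patch M a)"
    using assms(3) by (simp only: smooth_at_patch_def smooth_on_def)
  then show ?thesis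
    using assms(1,2) open_coord by (auto simp: diff_at_def intro: differentiable_on_openD)
qed

text \<open>Sesquilinear over the complex numbers but bilinear over the reals, the scalars relevant
  for the derivatives; boundedness is automatic in finite dimension.\<close>

lemma bounded_bilinear_bil: "bounded_bilinear (\<lambda>\<xi> \<eta>. c * bil M \<xi> \<eta> is)"
proof -
  have r: "bil M (r *\<^sub>R \<xi>) \<eta> is = r *\<^sub>R bil M \<xi> \<eta> is" "bil M \<xi> (r *\<^sub>R \<eta>) is = r *\<^sub>R bil M \<xi> \<eta> is" for r \<xi> \<eta>
    using bil_sum_left[OF spinor_module_of_manifold, of "\<lambda>_. of_real r" "\<lambda>_. \<xi>" "{()}" \<eta> "is"]
      bil_sum_right[OF spinor_module_of_manifold, of \<xi> "\<lambda>_. of_real r" "\<lambda>_. \<eta>" "{()}" "is"]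
    unfolding scaleR_vec_complex scaleR_conv_of_real[where 'a = complex] by simp_all
  have "Linear_Algebra.bilinear (\<lambda>\<xi> \<eta>. c * bil M \<xi> \<eta> is)"
    unfolding Linear_Algebra.bilinear_def
    by (auto intro!: linearI simp: bil_add_left[OF spinor_module_of_manifold] bil_add_right[OF spinor_module_of_manifold] r algebra_simps)
  then show ?thesis by (simp add: bilinear_conv_bounded_bilinear)
qed

lemma smooth_bilinears:
  assumes "a \<in> patches M" "smooth_at_patch M a (\<epsilon> a)"
  shows "smooth_at_patch M a (\<lambda>x. bilinears M \<epsilon> a x is)"
proof -
  have c: "Ck_on k (in_coord M a (\<epsilon> a)) (coord M a ` patch M a)" for k
    using assms(2) unfolding smooth_at_patch_def smooth_on_def by (rule spec)
  show ?thesis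
    unfolding smooth_at_patch_def smooth_on_def in_coord_bilinears
    by (rule allI)
      (rule Ck_on_bilinear[OF bounded_bilinear_bil[of "\<i> ^ (length is div 2)" "is"] open_coord[OF assms(1)] c c])
qed

lemma ddir_bilinears:
  assumes ax: "a \<in> patches M" "x \<in> patch M a" and s: "smooth_at_patch M a (\<epsilon> a)"
  shows "ddir M a x v (\<lambda>y. bilinears M \<epsilon> a y is) = \<i> ^ (length is div 2) *
    (bil M (ddir M a x v (\<epsilon> a)) (\<epsilon> a x) is + bil M (\<epsilon> a x) (ddir M a x v (\<epsilon> a)) is)"
proof -
  let ?e = "in_coord M a (\<epsilon> a)" and ?u = "coord M a x"
  have e: "?e ?u = \<epsilon> a x" by (simp add: in_coord_def inv_coord[OF ax])
  have "(?e has_derivative frechet_derivative ?e (at ?u)) (at ?u)"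
    using smooth_imp_diff_at[OF ax s] unfolding diff_at_def by (simp only: frechet_derivative_works)
  from bounded_bilinear.FDERIV[OF bounded_bilinear_bil this this, of "\<i> ^ (length is div 2)" "is"]
  show ?thesis
    unfolding in_coord_bilinears[symmetric] e
    by (subst ddir_has_derivative, assumption) (simp add: ddir_def distrib_left add.commute)
qed

text \<open>By \<open>bil_spin_rot\<close> the connection terms of the two spinor derivatives are
  exactly the connection term of the form, so the product rule passes from \<open>ddir\<close> to
  the covariant derivatives.\<close>

lemma nabla_bilinears:
  assumes ax: "a \<in> patches M" "x \<in> patch M a" and s: "smooth_at_patch M a (\<epsilon> a)"
  shows "nabla M (bilinears M \<epsilon>) a x v is = \<i> ^ (length is div 2) *
    (bil M (nabla_spinor M \<epsilon> a x v) (\<epsilon> a x) is + bil M (\<epsilon> a x) (nabla_spinor M \<epsilon> a x v) is)"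
proof -
  have n: "nabla_spinor M \<epsilon> a x v = ddir M a x v (\<epsilon> a) + spin_rot M (conn M a x v) (\<epsilon> a x)"
    by (simp add: nabla_spinor_def spin_rot_def[OF spinor_module_of_manifold] scaleR_vec_complex smult_sum_right vector_smult_assoc)
  have "frame_deriv (conn M a x v) (bilinears M \<epsilon> a x) is =
      \<i> ^ (length is div 2) * frame_deriv (conn M a x v) (bil M (\<epsilon> a x) (\<epsilon> a x)) is"
    unfolding frame_deriv_cmult[symmetric]
    by (rule frame_deriv_cong) (simp add: bilinears_def bilinear_axis)
  also have "frame_deriv (conn M a x v) (bil M (\<epsilon> a x) (\<epsilon> a x)) is =
      - (bil M (spin_rot M (conn M a x v) (\<epsilon> a x)) (\<epsilon> a x) is + bil M (\<epsilon> a x) (spin_rot M (conn M a x v) (\<epsilon> a x)) is)"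
    by (subst bil_spin_rot[OF spinor_module_of_manifold conn_skew]) simp
  finally have "frame_deriv (conn M a x v) (bilinears M \<epsilon> a x) is = \<i> ^ (length is div 2) * \<dots>" .
  then show ?thesis
    unfolding nabla_frame_deriv ddir_bilinears[where \<epsilon> = \<epsilon>, OF ax s] n bil_add_left[OF spinor_module_of_manifold] bil_add_right[OF spinor_module_of_manifold]
    by (simp only:) (simp add: algebra_simps)
qed

text \<open>The lift enters through two properties only: membership in the spin group, which
  preserves the Hermitian form, and intertwining, which converts generators into rows of the
  transition matrix.\<close>

lemma multi_form_bilinears:
  assumes "spinor_field M \<epsilon>"
  shows "multi_form M (bilinears M \<epsilon>)"
  unfolding multi_form_def
proof (intro conjI ballI allI)
  show "alternating (bilinears M \<epsilon> a x)" for a x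
    by (rule alternating_bilinears)
  show "smooth_at_patch M a (\<lambda>x. bilinears M \<epsilon> a x is)" if "a \<in> patches M" for a "is"
    using that assms by (intro smooth_bilinears) (auto simp: spinor_field_def)
  fix a b x assume ab: "a \<in> patches M" "b \<in> patches M" "x \<in> patch M a \<inter> patch M b"
  then have L: "lift M a b x \<in> spin_group M"
    "\<And>v. lift M a b x ** cl M v = cl M (transition M a b x *v v) ** lift M a b x"
    using M ab unfolding spin_manifold_def spin_structure_def by blast+
  have e: "\<epsilon> a x = lift M a b x *v \<epsilon> b x"
    using assms ab unfolding spinor_field_def by blast
  show "bilinears M \<epsilon> a x = change_frame (transition M a b x) (bilinears M \<epsilon> b x)"
  proof
    fix "is" :: "'n list"
    have "change_frame (transition M a b x) (bilinears M \<epsilon> b x) is =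
        \<i> ^ (length is div 2) * change_frame (transition M a b x) (bil M (\<epsilon> b x) (\<epsilon> b x)) is"
      unfolding change_frame_cmult[symmetric]
      by (rule change_frame_cong) (simp add: bilinears_def bilinear_axis)
    then show "bilinears M \<epsilon> a x is = change_frame (transition M a b x) (bilinears M \<epsilon> b x) is"
      by (simp add: bilinears_def bilinear_axis e bil_change_frame[OF spinor_module_of_manifold L])
  qed
qed

end

section \<open>The hierarchy\<close>

lemma sum_ext1_delta:
  "(\<Sum>j\<in>UNIV. c j * ext1 (\<lambda>i js. (if j = i then 1 else 0) * Q js) is) = ext1 (\<lambda>i js. c i * Q js) is"
  for c :: "'n::finite \<Rightarrow> complex"
proof -
  have "(\<Sum>j\<in>UNIV. c j * ext1 (\<lambda>i js. (if j = i then 1 else 0) * Q js) is) =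
      ext1 (\<lambda>i js. \<Sum>j\<in>UNIV. c j * ((if j = i then 1 else 0) * Q js)) is"
    by (simp only: ext1_cmult[symmetric] ext1_sum[symmetric])
  also have "(\<lambda>i js. \<Sum>j\<in>UNIV. c j * ((if j = i then 1 else 0) * Q js)) = (\<lambda>i js. c i * Q js)"
  proof (intro ext)
    fix i js
    have "(\<Sum>j\<in>UNIV. c j * ((if j = i then 1 else 0) * Q js)) = (\<Sum>j\<in>UNIV. if j = i then c j * Q js else 0)"
      by (intro sum.cong) auto
    then show "(\<Sum>j\<in>UNIV. c j * ((if j = i then 1 else 0) * Q js)) = c i * Q js" by simp
  qed
  finally show ?thesis .
qed

text \<open>In both uses the coefficients are real, the components of v or of
  \<open>iprod v F\<close>, so only the constant k is conjugated.\<close>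

lemma bil_contract_left:
  assumes sm: "spinor_module M" and c: "\<And>j. cnj (c j) = c j"
  shows "bil M (\<Sum>j\<in>UNIV. (k * c j) *s (gam M j *v \<xi>)) \<eta> is =
    cnj k * ((\<Sum>j\<in>UNIV. c j * bil M \<xi> \<eta> (j # is)) + ext1 (\<lambda>j js. c j * bil M \<xi> \<eta> js) is)"
  unfolding bil_sum_left[OF sm] bil_gam_left[OF sm] sum_ext1_delta[of c "bil M \<xi> \<eta>" "is", symmetric]
  by (simp add: c sum_distrib_left sum.distrib distrib_left mult.assoc)

lemma bil_contract_right:
  assumes sm: "spinor_module M"
  shows "bil M \<xi> (\<Sum>j\<in>UNIV. (k * c j) *s (gam M j *v \<eta>)) is =
    (-1) ^ length is * k * ((\<Sum>j\<in>UNIV. c j * bil M \<xi> \<eta> (j # is)) - ext1 (\<lambda>j js. c j * bil M \<xi> \<eta> js) is)"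
  unfolding bil_sum_right[OF sm] bil_gam_right[OF sm] sum_ext1_delta[of c "bil M \<xi> \<eta>" "is", symmetric]
  by (simp add: sum_distrib_left sum_subtractf right_diff_distrib mult_ac)

lemma ext1_combine:
  "ext1 (\<lambda>j js. c j * (s * \<omega> js + t * \<phi> js)) is =
    s * ext1 (\<lambda>j js. c j * \<omega> js) is + t * ext1 (\<lambda>j js. c j * \<phi> js) is"
  unfolding ext1_cmult[symmetric] ext1_add[symmetric] by (intro ext1_cong) (simp add: algebra_simps)

lemma sum_combine:
  "(\<Sum>j\<in>I. c j * (s * f j + t * g j)) = s * (\<Sum>j\<in>I. c j * f j) + t * (\<Sum>j\<in>I. c j * g j)"
  for s :: complex
  unfolding sum_distrib_left sum.distrib[symmetric] by (intro sum.cong refl) (simp add: algebra_simps)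

text \<open>The terms with \<open>k\<^sub>1\<close> are absorbed in the unspecified forms \<open>P\<close> and \<open>Q\<close>; only the commutator
  of \<open>cl(F)\<close> with a vector, which turns \<open>k\<^sub>2\<close> into \<open>k\<^sub>2 - 4 k\<^sub>1\<close>, contributes to the twisting.\<close>

lemma bil_twist:
  assumes sm: "spinor_module M" and u: "\<And>j. cnj (u j) = u j" and v: "\<And>j. cnj (v j) = v j"
    and T: "T = - ((\<Sum>j\<in>UNIV. (k1 * v j) *s (gam M j *v \<Phi>)) + (\<Sum>j\<in>UNIV. (\<kappa> * u j) *s (gam M j *v \<eta>)))"
  defines "P \<equiv> \<lambda>p js. (- cnj k1) * bil M \<Phi> \<eta> js + (- ((-1) ^ p * k1)) * bil M \<eta> \<Phi> js"
    and "Q \<equiv> \<lambda>p js. (- cnj k1) * bil M \<Phi> \<eta> js + (-1) ^ p * k1 * bil M \<eta> \<Phi> js"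
  shows "bil M T \<eta> is + bil M \<eta> T is =
    (\<Sum>j\<in>UNIV. v j * P (length is) (j # is)) + ext1 (\<lambda>j js. v j * Q (length is) js) is -
    (cnj \<kappa> + (-1) ^ length is * \<kappa>) * (\<Sum>j\<in>UNIV. u j * bil M \<eta> \<eta> (j # is)) -
    (cnj \<kappa> - (-1) ^ length is * \<kappa>) * ext1 (\<lambda>j js. u j * bil M \<eta> \<eta> js) is"
proof -
  \<comment> \<open>Here s is (-1)^p; a, b are the interior and exterior parts with \<Phi> in the
    left slot, a', b' those with \<Phi> in the right slot, and d, e those of \<eta> paired with
    itself.\<close>
  have ring: "- (c1 * (a + b) + c2 * (d + e)) + - (s * k1 * (a' - b') + s * \<kappa> * (d - e)) =
      (- c1 * a + - (s * k1) * a') + (- c1 * b + s * k1 * b') - (c2 + s * \<kappa>) * d - (c2 - s * \<kappa>) * e"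
    for a a' b b' c1 c2 d e s :: complex
    by (simp add: algebra_simps)
  show ?thesis
    unfolding P_def Q_def ext1_combine sum_combine T bil_minus_left[OF sm] bil_minus_right[OF sm]
      bil_add_left[OF sm] bil_add_right[OF sm] bil_contract_left[OF sm u] bil_contract_left[OF sm v]
      bil_contract_right[OF sm]
    by (rule ring)
qed

lemma iprod_axis: "iprod (axis i 1) \<omega> js = \<omega> (i # js)"
proof -
  have "iprod (axis i 1) \<omega> js = (\<Sum>j\<in>UNIV. if j = i then \<omega> (j # js) else 0)"
    unfolding iprod_def by (intro sum.cong) (auto simp: axis_def)
  then show ?thesis by simp
qed

lemma homog_iprod: "homog (Suc p) \<omega> \<Longrightarrow> homog p (iprod v \<omega>)"
  by (simp add: homog_def iprod_def)

section \<open>Solving for the two unspecified forms\<close>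

context
  fixes p :: nat and f \<chi>1 \<chi>2 P Q :: "'n::finite mform" and N :: "real^'n \<Rightarrow> 'n mform" and A B :: complex
  assumes f: "alternating f" "homog 2 f" and chi: "alternating \<chi>1" "alternating \<chi>2"
    and PQ: "alternating P" "alternating Q"
    and eq: "\<And>v is. length is = p \<Longrightarrow>
      N v is + A * contract (iprod v f) \<chi>1 is + B * wedge (iprod v f) \<chi>2 is =
      (\<Sum>j\<in>UNIV. of_real (v $ j) * P (j # is)) + ext1 (\<lambda>j js. of_real (v $ j) * Q js) is"
begin

lemma homog_iprod_f: "homog 1 (iprod v f)"
  using f(2) by (intro homog_iprod) (simp add: numeral_2_eq_2)

text \<open>\<open>N\<close> stands for v \<mapsto> \<nabla>_v \<chi>_p and \<open>A\<close>,
  \<open>B\<close> for the twisting coefficients. Frame vectors suffice, since skew-symmetrising and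
  tracing involve no others.\<close>

lemma equation_on_frame:
  assumes "length is = p"
  shows "N (axis i 1) is + A * (\<Sum>k\<in>UNIV. f [i, k] * \<chi>1 (k # is)) + B * ext1 (\<lambda>j js. f [i, j] * \<chi>2 js) is =
    P (i # is) + ext1 (\<lambda>j js. (if i = j then 1 else 0) * Q js) is"
proof -
  have 1: "(\<Sum>j\<in>UNIV. of_real (axis i 1 $ j) * P (j # is)) = P (i # is)"
    using iprod_axis[of i P "is"] by (simp add: iprod_def)
  have 2: "ext1 (\<lambda>j js. of_real (axis i 1 $ j) * Q js) is = ext1 (\<lambda>j js. (if i = j then 1 else 0) * Q js) is"
    by (intro ext1_cong) (auto simp: axis_def)
  show ?thesis
    using eq[OF assms, of "axis i 1"] unfolding 1 2
    by (simp add: contract_1[OF homog_iprod_f chi(1)] wedge_1[OF homog_iprod_f chi(2)] iprod_axis)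
qed

text \<open>Wedging with e^i from the left. The A-term acquires a minus because
  \<open>contract\<close> takes the contracted index in the first slot of f, and the B-term a 2 from
  the ordered pairs in e^i \<and> e^j.\<close>

lemma skew_symmetrised_equation:
  assumes l: "length js = Suc p"
  shows "of_nat (Suc p) * P js = ext1 (\<lambda>i. N (axis i 1)) js - A * contract f \<chi>1 js + 2 * B * wedge f \<chi>2 js"
proof -
  have 1: "ext1 (\<lambda>i is. \<Sum>k\<in>UNIV. f [i, k] * \<chi>1 (k # is)) js = - contract f \<chi>1 js"
    unfolding contract_2[OF f(2) chi(1)] ext1_minus[symmetric] sum_negf[symmetric]
    by (intro ext1_cong sum.cong refl) (metis alternating_Cons_swap[OF f(1)] mult_minus_left)
  have 2: "ext1 (\<lambda>i. ext1 (\<lambda>j ks. (if i = j then 1 else 0) * Q ks)) js = 0"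
  proof (rule ext1_ext1_symmetric)
    show "alternating (\<lambda>ks. (if i = j then 1 else 0) * Q ks)" for i j
      using PQ(2) by (rule alternating_cmult)
  qed auto
  have "ext1 (\<lambda>i is. N (axis i 1) is + A * (\<Sum>k\<in>UNIV. f [i, k] * \<chi>1 (k # is)) + B * ext1 (\<lambda>j js. f [i, j] * \<chi>2 js) is) js =
      ext1 (\<lambda>i is. P (i # is) + ext1 (\<lambda>j js. (if i = j then 1 else 0) * Q js) is) js"
    using l by (intro ext1_cong) (simp add: equation_on_frame)
  then show ?thesis
    unfolding ext1_add ext1_cmult 1 2 wedge_2[OF f(2) chi(2), symmetric] ext1_alternating[OF PQ(1)] l
    by (simp add: algebra_simps)
qed

text \<open>Contracting with e_i. The A-term meets the indices of f in reverse order, which gives -2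
  \<open>vee\<close>; in the B-term f_ii = 0, and the sign is that of passing e^j.\<close>

lemma traced_equation:
  assumes l: "Suc (length js) = p"
  shows "(of_nat CARD('n) - of_nat (length js)) * Q js =
    (\<Sum>i\<in>UNIV. N (axis i 1) (i # js)) - 2 * A * vee f \<chi>1 js - B * contract f \<chi>2 js"
proof -
  have 1: "(\<Sum>i\<in>UNIV. \<Sum>k\<in>UNIV. f [i, k] * \<chi>1 (k # i # js)) = - (2 * vee f \<chi>1 js)"
    unfolding vee_2[OF f(2,1)] sum_negf[symmetric]
    by (intro sum.cong refl) (metis alternating_Cons_swap[OF chi(1)] mult_minus_right)
  have "(\<Sum>i\<in>UNIV. ext1 (\<lambda>j ks. f [i, j] * \<chi>2 ks) (i # js)) = - (\<Sum>i\<in>UNIV. ext1 (\<lambda>j ks. f [i, j] * \<chi>2 (i # ks)) js)"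
    by (simp add: ext1_Cons alternating_Cons_same[OF f(1)] sum_negf)
  then have 2: "(\<Sum>i\<in>UNIV. ext1 (\<lambda>j ks. f [i, j] * \<chi>2 ks) (i # js)) = - contract f \<chi>2 js"
    unfolding contract_2[OF f(2) chi(2)] ext1_sum .
  have "(\<Sum>i\<in>UNIV. N (axis i 1) (i # js) + A * (\<Sum>k\<in>UNIV. f [i, k] * \<chi>1 (k # i # js)) +
        B * ext1 (\<lambda>j js. f [i, j] * \<chi>2 js) (i # js)) =
      (\<Sum>i\<in>UNIV. P (i # i # js) + ext1 (\<lambda>j js. (if i = j then 1 else 0) * Q js) (i # js))"
    using l by (intro sum.cong refl) (simp only: equation_on_frame length_Cons)
  then show ?thesis
    unfolding sum.distrib sum_distrib_left[symmetric] 1 2 trace_ext1_axis[OF PQ(2)]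
    by (simp add: alternating_Cons_same[OF PQ(1)] algebra_simps)
qed

lemma solved_equation:
  assumes l: "length is = p" and n: "p \<le> CARD('n)"
  shows "N v is + A * contract (iprod v f) \<chi>1 is + B * wedge (iprod v f) \<chi>2 is =
    1 / of_nat (Suc p) * iprod v (\<lambda>js. ext1 (\<lambda>i. N (axis i 1)) js - A * contract f \<chi>1 js + 2 * B * wedge f \<chi>2 js) is
    - 1 / (of_nat CARD('n) - of_nat p + 1) * ext1 (\<lambda>j js. of_real (v $ j) *
       (- (\<Sum>i\<in>UNIV. N (axis i 1) (i # js)) + 2 * A * vee f \<chi>1 js + B * contract f \<chi>2 js)) is"
proof -
  have 1: "iprod v (\<lambda>js. ext1 (\<lambda>i. N (axis i 1)) js - A * contract f \<chi>1 js + 2 * B * wedge f \<chi>2 js) is =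
      of_nat (Suc p) * (\<Sum>j\<in>UNIV. of_real (v $ j) * P (j # is))"
    unfolding iprod_def sum_distrib_left
    by (intro sum.cong refl) (simp only: skew_symmetrised_equation[symmetric] length_Cons l mult.left_commute)
  have "of_nat (CARD('n) - p + 1) \<noteq> (0 :: complex)"
    unfolding of_nat_eq_0_iff by simp
  \<comment> \<open>The bound on p makes the natural difference a genuine one; for p = n + 1 this
    divisor would be zero.\<close>
  then have nz: "(of_nat CARD('n) - of_nat p + 1 :: complex) \<noteq> 0"
    unfolding of_nat_add of_nat_diff[OF n] of_nat_1 .
  have 2: "ext1 (\<lambda>j js. of_real (v $ j) *
       (- (\<Sum>i\<in>UNIV. N (axis i 1) (i # js)) + 2 * A * vee f \<chi>1 js + B * contract f \<chi>2 js)) is =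
      - (of_nat CARD('n) - of_nat p + 1) * ext1 (\<lambda>j js. of_real (v $ j) * Q js) is"
    unfolding ext1_cmult[symmetric]
  proof (rule ext1_cong)
    fix j and js :: "'n list" assume s: "Suc (length js) = length is"
    \<comment> \<open>Q is evaluated on lists of length p - 1, so the factor n -
      \<open>length js\<close> of the trace is n - p + 1.\<close>
    then have s: "Suc (length js) = p" "of_nat p = 1 + (of_nat (length js) :: complex)" using l by auto
    show "of_real (v $ j) * (- (\<Sum>i\<in>UNIV. N (axis i 1) (i # js)) + 2 * A * vee f \<chi>1 js + B * contract f \<chi>2 js) =
        - (of_nat CARD('n) - of_nat p + 1) * (of_real (v $ j) * Q js)"
    proof -
      have "- (\<Sum>i\<in>UNIV. N (axis i 1) (i # js)) + 2 * A * vee f \<chi>1 js + B * contract f \<chi>2 js =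
          - ((of_nat CARD('n) - of_nat (length js)) * Q js)"
        unfolding traced_equation[OF s(1)] by simp
      then show ?thesis unfolding s(2) by (simp only:) (simp add: algebra_simps)
    qed
  qed
  have ring: "x + y = 1 / b * (b * x) - 1 / c * (- c * y)" if "b \<noteq> 0" "c \<noteq> 0" for b c x y :: complex
    using that by simp
  show ?thesis unfolding eq[OF l] 1 2 by (rule ring[OF of_nat_neq_0 nz])
qed

end

text \<open>The purpose of a_{p,q}: it exchanges the normalisation i^[q/2] of \<chi>_q for that of
  degree p, so that all terms share one power of i.\<close>

lemma acoef_mult: "acoef (int p) (int q) * \<i> ^ (q div 2) = \<i> ^ (p div 2)"
proof -
  have "int m div 2 = int (m div 2)" for m
    by (simp add: zdiv_int)
  then have "acoef (int p) (int q) = \<i> ^ (p div 2) / \<i> ^ (q div 2)"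
    by (simp only: acoef_def) (simp add: power_int_diff)
  then show ?thesis by simp
qed

lemma chi_form_nat:
  "chi_form M \<epsilon> (int q) a x js = (if length js = q then \<i> ^ (q div 2) * bil M (\<epsilon> a x) (\<epsilon> a x) js else 0)"
  by (auto simp: chi_form_def deg_part_def bilinears_def bilinear_axis)

lemma alternating_chi_form: "alternating (chi_form M \<epsilon> q a x)"
  by (simp add: chi_form_def[abs_def] alternating_deg_part alternating_bilinears)

text \<open>The connection term replaces entries but keeps the length of the list, so degrees do not
  mix.\<close>

lemma nabla_cong:
  "(\<And>y js. length js = length is \<Longrightarrow> \<omega> a y js = \<phi> a y js) \<Longrightarrow> nabla M \<omega> a x v is = nabla M \<phi> a x v is"
  by (simp add: nabla_def)

lemma chi_form_abs: "chi_form M \<epsilon> q = (\<lambda>a x. deg_part q (bilinears M \<epsilon> a x))"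
  by (simp add: fun_eq_iff chi_form_def)

lemma chi_form_0: "int (length js) \<noteq> q \<Longrightarrow> chi_form M \<epsilon> q a x js = 0"
  by (simp add: chi_form_def deg_part_def)

lemma alternating_append: "alternating \<omega> \<Longrightarrow> alternating (\<lambda>is. \<omega> (js @ is))"
proof (induction js arbitrary: \<omega>)
  case (Cons j js)
  then show ?case using Cons.IH[OF alternating_Cons[OF Cons.prems, of j]] by simp
qed simp

lemma alternating_vee:
  assumes "alternating \<omega>"
  shows "alternating (vee \<phi> \<omega>)"
  unfolding alternating_def vee_def
  by (simp add: alternatingD[OF alternating_append[OF assms]] sum_distrib_left mult.left_commute)

lemma alternating_codiff:
  assumes "\<And>v. alternating (nabla M \<omega> a x v)"
  shows "alternating (codiff M \<omega> a x)"
  unfolding alternating_def codiff_def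
  by (simp add: alternatingD[OF alternating_Cons[OF assms]] sum_distrib_left)

lemma homog_flat: "homog 1 (flat v)"
  by (auto simp: homog_def flat_def split: list.splits)

lemma alternating_hier:
  assumes "alternating \<omega>" "alternating \<phi>" "alternating \<psi>"
  shows "alternating (\<lambda>is. \<omega> is + s * \<phi> is + t * \<psi> is)"
  unfolding alternating_def
  by (simp add: alternatingD[OF assms(1)] alternatingD[OF assms(2)] alternatingD[OF assms(3)] algebra_simps)

text \<open>Integer exponents give p - 1 a meaning at p = 0. The parity sign yields exactly the
  coefficients of \<open>bil_twist\<close>, + at the interior and - at the exterior part.\<close>

lemma kcoef_nat:
  "kcoef k1 k2 (int p) = cnj (k2 - 4 * k1) + (-1) ^ p * (k2 - 4 * k1)"
  "kcoef k1 k2 (int p - 1) = cnj (k2 - 4 * k1) - (-1) ^ p * (k2 - 4 * k1)"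
  by (simp_all add: kcoef_def power_int_diff)

section \<open>The hierarchy of a parallel spinor\<close>

context
  fixes M :: "('a,'m::{t2_space,second_countable_topology},'n::finite,'s::finite) spin_data"
    and F :: "('a,'m,'n) mform_field" and k1 k2 :: complex and \<epsilon> :: "'a \<Rightarrow> 'm \<Rightarrow> complex^'s" and a x
  assumes M: "spin_manifold M" and F: "real_form M 2 F" and par: "parallel_spinor M k1 k2 F \<epsilon>"
    and ax: "a \<in> patches M" "x \<in> patch M a"
begin

lemma F_alternating: "alternating (F a x)"
  using F ax unfolding real_form_def multi_form_def by blast

lemma F_homog: "homog 2 (F a x)"
  using F ax unfolding real_form_def homog_def by blast

lemma F_cnj: "cnj (F a x is) = F a x is"
  using F ax unfolding real_form_def Reals_cnj_iff by blast

lemma iF_homog: "homog 1 (iprod v (F a x))"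
  using F_homog by (intro homog_iprod) (simp add: numeral_2_eq_2)

lemma smooth_spinor: "smooth_at_patch M a (\<epsilon> a)"
  using par ax unfolding parallel_spinor_def spinor_field_def by blast

lemma diff_at_bilinears: "diff_at M a x (\<lambda>y. bilinears M \<epsilon> a y is)"
  by (intro smooth_imp_diff_at[OF M ax] smooth_bilinears[OF M ax(1)] smooth_spinor)

lemma diff_at_chi_form: "diff_at M a x (\<lambda>y. chi_form M \<epsilon> q a y is)"
proof (cases "int (length is) = q")
  case True
  then show ?thesis using diff_at_bilinears[of "is"] by (simp add: chi_form_def deg_part_def)
next
  case False
  then show ?thesis by (simp add: chi_form_0 diff_at_def in_coord_def o_def)
qed

lemma alternating_nabla_chi: "alternating (nabla M (chi_form M \<epsilon> q) a x v)"
  by (intro alternating_nabla alternating_chi_form diff_at_chi_form)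

lemma alternating_ext_d_chi: "alternating (ext_d M (chi_form M \<epsilon> q) a x)"
proof -
  have "ext_d M (chi_form M \<epsilon> q) a x = ext1 (\<lambda>i. nabla M (chi_form M \<epsilon> q) a x (axis i 1))"
    by (intro ext ext_d_nabla alternating_chi_form)
  then show ?thesis by (simp add: alternating_ext1 alternating_nabla_chi)
qed

text \<open>P and Q stay existential: once the equation holds with some alternating forms
  independent of v, skew-symmetrising and tracing recover them from the other terms.\<close>

lemma nabla_chi_PQ:
  "\<exists>P Q. alternating P \<and> alternating Q \<and> (\<forall>v is. length is = p \<longrightarrow>
      nabla M (chi_form M \<epsilon> (int p)) a x v is +
      (acoef (int p) (int p + 1) * kcoef k1 k2 (int p)) * contract (iprod v (F a x)) (chi_form M \<epsilon> (int p + 1) a x) is +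
      (acoef (int p) (int p - 1) * kcoef k1 k2 (int p - 1)) * wedge (iprod v (F a x)) (chi_form M \<epsilon> (int p - 1) a x) is =
      (\<Sum>j\<in>UNIV. of_real (v $ j) * P (j # is)) + ext1 (\<lambda>j js. of_real (v $ j) * Q js) is)"
proof -
  let ?\<eta> = "\<epsilon> a x" and ?f = "F a x" and ?c = "\<i> ^ (p div 2)" and ?\<kappa> = "k2 - 4 * k1"
  let ?\<Phi> = "cl2 M ?f ?\<eta>"
  \<comment> \<open>The sign belongs to the degree q of the equation, not to the lists on which the
    forms are evaluated, of length q + 1 for P and q - 1 for Q.\<close>
  define P where "P = (\<lambda>q js. (- cnj k1) * bil M ?\<Phi> ?\<eta> js + (- ((-1) ^ q * k1)) * bil M ?\<eta> ?\<Phi> js)"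
  define Q where "Q = (\<lambda>q js. (- cnj k1) * bil M ?\<Phi> ?\<eta> js + (-1) ^ q * k1 * bil M ?\<eta> ?\<Phi> js)"
  have alt: "alternating (\<lambda>js. ?c * P p js)" "alternating (\<lambda>js. ?c * Q p js)"
    unfolding P_def Q_def alternating_def by (simp_all add: alternatingD[OF alternating_bil] algebra_simps)
  have "nabla M (chi_form M \<epsilon> (int p)) a x v is +
      (acoef (int p) (int p + 1) * kcoef k1 k2 (int p)) * contract (iprod v (F a x)) (chi_form M \<epsilon> (int p + 1) a x) is +
      (acoef (int p) (int p - 1) * kcoef k1 k2 (int p - 1)) * wedge (iprod v (F a x)) (chi_form M \<epsilon> (int p - 1) a x) is =
      (\<Sum>j\<in>UNIV. of_real (v $ j) * (?c * P p (j # is))) + ext1 (\<lambda>j js. of_real (v $ j) * (?c * Q p js)) is"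
    if l: "length is = p" for v "is"
  proof -
    define T where "T = nabla_spinor M \<epsilon> a x v"
    define u where "u j = iprod v ?f [j]" for j
    define S where "S = (\<Sum>j\<in>UNIV. u j * bil M ?\<eta> ?\<eta> (j # is))"
    define E where "E = ext1 (\<lambda>j js. u j * bil M ?\<eta> ?\<eta> js) is"
    have uc: "cnj (u j) = u j" for j
      by (simp add: u_def iprod_def F_cnj)
    have skew: "?f [i, j] = - ?f [j, i]" for i j
      by (rule alternating_Cons_swap[OF F_alternating])
    have "nabla_hat M k1 k2 F \<epsilon> a x v = 0"
      using par ax by (simp add: parallel_spinor_def)
    then have "T + (k1 *s cl2 M ?f (cl M v *v ?\<eta>) + k2 *s cl1 M (iprod v ?f) ?\<eta>) = 0"
      by (simp add: nabla_hat_def T_def add.assoc)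
    then have T: "T = - ((\<Sum>j\<in>UNIV. (k1 * of_real (v $ j)) *s (gam M j *v ?\<Phi>)) +
        (\<Sum>j\<in>UNIV. (?\<kappa> * u j) *s (gam M j *v ?\<eta>)))"
      unfolding twist_spinor[where \<phi> = ?f, OF spinor_module_of_manifold[OF M] skew] u_def by (simp only: eq_neg_iff_add_eq_0)
    have "nabla M (chi_form M \<epsilon> (int p)) a x v is = nabla M (bilinears M \<epsilon>) a x v is"
      by (rule nabla_cong) (simp add: chi_form_def deg_part_def l)
    also have "\<dots> = ?c * (bil M T ?\<eta> is + bil M ?\<eta> T is)"
      unfolding nabla_bilinears[where \<epsilon> = \<epsilon>, OF M ax smooth_spinor] T_def l ..
    also have "bil M T ?\<eta> is + bil M ?\<eta> T is =
        (\<Sum>j\<in>UNIV. of_real (v $ j) * P p (j # is)) + ext1 (\<lambda>j js. of_real (v $ j) * Q p js) is -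
        (cnj ?\<kappa> + (-1) ^ p * ?\<kappa>) * S - (cnj ?\<kappa> - (-1) ^ p * ?\<kappa>) * E"
      using bil_twist[OF spinor_module_of_manifold[OF M] uc _ T, of "is"] unfolding P_def Q_def S_def E_def l by simp
    finally have N: "nabla M (chi_form M \<epsilon> (int p)) a x v is = ?c * ((\<Sum>j\<in>UNIV. of_real (v $ j) * P p (j # is)) +
        ext1 (\<lambda>j js. of_real (v $ j) * Q p js) is - (cnj ?\<kappa> + (-1) ^ p * ?\<kappa>) * S - (cnj ?\<kappa> - (-1) ^ p * ?\<kappa>) * E)" .
    have C: "acoef (int p) (int p + 1) * contract (iprod v ?f) (chi_form M \<epsilon> (int p + 1) a x) is = ?c * S"
    proof -
      have "contract (iprod v ?f) (chi_form M \<epsilon> (int (Suc p)) a x) is = \<i> ^ (Suc p div 2) * S"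
        unfolding contract_1[OF iF_homog alternating_chi_form] S_def u_def sum_distrib_left
        by (intro sum.cong refl) (simp only: chi_form_nat length_Cons l if_True refl mult.left_commute)
      then have "acoef (int p) (int (Suc p)) * contract (iprod v ?f) (chi_form M \<epsilon> (int (Suc p)) a x) is = ?c * S"
        by (simp only: acoef_mult mult.assoc[symmetric])
      then show ?thesis by (simp add: add.commute)
    qed
    have W: "acoef (int p) (int p - 1) * wedge (iprod v ?f) (chi_form M \<epsilon> (int p - 1) a x) is = ?c * E"
    proof (cases p)
      \<comment> \<open>The form has degree -1 here, outside the range of
        \<open>chi_form_nat\<close>; both sides vanish on the empty list.\<close>
      case 0
      then show ?thesis using l by (simp add: E_def wedge_1[OF iF_homog alternating_chi_form])
    next
      case (Suc q)
      have "wedge (iprod v ?f) (chi_form M \<epsilon> (int q) a x) is = \<i> ^ (q div 2) * E"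
        unfolding wedge_1[OF iF_homog alternating_chi_form] E_def u_def ext1_cmult[symmetric]
        by (intro ext1_cong) (simp add: chi_form_nat l Suc)
      then have "acoef (int p) (int q) * wedge (iprod v ?f) (chi_form M \<epsilon> (int q) a x) is = ?c * E"
        by (simp only: acoef_mult mult.assoc[symmetric])
      then show ?thesis by (simp add: Suc)
    qed
    have 1: "(\<Sum>j\<in>UNIV. of_real (v $ j) * (?c * P p (j # is))) = ?c * (\<Sum>j\<in>UNIV. of_real (v $ j) * P p (j # is))"
      by (simp add: sum_distrib_left mult_ac)
    have 2: "ext1 (\<lambda>j js. of_real (v $ j) * (?c * Q p js)) is = ?c * ext1 (\<lambda>j js. of_real (v $ j) * Q p js) is"
      unfolding ext1_cmult[symmetric] by (simp add: mult_ac)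
    \<comment> \<open>K and L are the two values of \<open>kcoef\<close>; the twisting terms cancel
      the contributions of S and E and leave only the v-linear terms in P and Q.\<close>
    have ring: "c * (X + Y - K * S' - L * E') + A * K * C' + B * L * W' = c * X + c * Y"
      if "A * C' = c * S'" "B * W' = c * E'" for c X Y K L A B C' W' S' E' :: complex
    proof -
      have e: "A * K * C' = K * (c * S')" "B * L * W' = L * (c * E')"
        unfolding that[symmetric] by (simp_all only: mult_ac)
      show ?thesis unfolding e by (simp add: algebra_simps)
    qed
    show ?thesis
      unfolding N 1 2 kcoef_nat by (rule ring[OF C W])
  qed
  with alt show ?thesis by blast
qed

text \<open>The bound on \<open>p\<close> excludes the division by zero at \<open>p = n + 1\<close>.\<close>

lemma hierarchy_degree:
  assumes n: "p \<le> CARD('n)"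
  shows "nabla M (chi_form M \<epsilon> (int p)) a x v is +
      acoef (int p) (int p + 1) * kcoef k1 k2 (int p) * contract (iprod v (F a x)) (chi_form M \<epsilon> (int p + 1) a x) is +
      acoef (int p) (int p - 1) * kcoef k1 k2 (int p - 1) * wedge (iprod v (F a x)) (chi_form M \<epsilon> (int p - 1) a x) is =
    1 / of_int (int p + 1) * iprod v (\<lambda>js. ext_d M (chi_form M \<epsilon> (int p)) a x js
      - acoef (int p) (int p + 1) * kcoef k1 k2 (int p) * contract (F a x) (chi_form M \<epsilon> (int p + 1) a x) js
      + 2 * acoef (int p) (int p - 1) * kcoef k1 k2 (int p - 1) * wedge (F a x) (chi_form M \<epsilon> (int p - 1) a x) js) is
    - 1 / of_int (int CARD('n) - int p + 1) * wedge (flat v) (\<lambda>js. codiff M (chi_form M \<epsilon> (int p)) a x js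
      + 2 * acoef (int p) (int p + 1) * kcoef k1 k2 (int p) * vee (F a x) (chi_form M \<epsilon> (int p + 1) a x) js
      + acoef (int p) (int p - 1) * kcoef k1 k2 (int p - 1) * contract (F a x) (chi_form M \<epsilon> (int p - 1) a x) js) is"
proof -
  let ?A = "acoef (int p) (int p + 1) * kcoef k1 k2 (int p)" and ?B = "acoef (int p) (int p - 1) * kcoef k1 k2 (int p - 1)"
  have Qalt: "alternating (\<lambda>js. codiff M (chi_form M \<epsilon> (int p)) a x js
      + 2 * acoef (int p) (int p + 1) * kcoef k1 k2 (int p) * vee (F a x) (chi_form M \<epsilon> (int p + 1) a x) js
      + ?B * contract (F a x) (chi_form M \<epsilon> (int p - 1) a x) js)"
    by (intro alternating_hier alternating_codiff alternating_nabla_chi alternating_vee alternating_chi_form alternating_contract)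
  have w: "wedge (flat v) (\<lambda>js. codiff M (chi_form M \<epsilon> (int p)) a x js
      + 2 * acoef (int p) (int p + 1) * kcoef k1 k2 (int p) * vee (F a x) (chi_form M \<epsilon> (int p + 1) a x) js
      + ?B * contract (F a x) (chi_form M \<epsilon> (int p - 1) a x) js) is =
    ext1 (\<lambda>j js. of_real (v $ j) * (- (\<Sum>i\<in>UNIV. nabla M (chi_form M \<epsilon> (int p)) a x (axis i 1) (i # js))
      + 2 * ?A * vee (F a x) (chi_form M \<epsilon> (int p + 1) a x) js
      + ?B * contract (F a x) (chi_form M \<epsilon> (int p - 1) a x) js)) is"
    unfolding wedge_1[OF homog_flat Qalt] by (simp add: flat_def codiff_def mult.assoc)
  note e = ext_d_nabla[OF alternating_chi_form]
  show ?thesis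
  proof (cases "length is = p")
    case True
    obtain P Q where PQ: "alternating P" "alternating Q" and
      eq: "\<And>v is. length is = p \<Longrightarrow>
        nabla M (chi_form M \<epsilon> (int p)) a x v is +
        ?A * contract (iprod v (F a x)) (chi_form M \<epsilon> (int p + 1) a x) is +
        ?B * wedge (iprod v (F a x)) (chi_form M \<epsilon> (int p - 1) a x) is =
        (\<Sum>j\<in>UNIV. of_real (v $ j) * P (j # is)) + ext1 (\<lambda>j js. of_real (v $ j) * Q js) is"
      using nabla_chi_PQ[of p] by blast
    show ?thesis
      using solved_equation[OF F_alternating F_homog alternating_chi_form alternating_chi_form PQ eq True n, of v]
      unfolding w e by (simp add: mult.assoc add.commute)
  next
    case False
    \<comment> \<open>On lists of length other than p every term is zero, since each shift of degree
      inside a term is undone by the operation around it.\<close>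
    have n0: "nabla M (chi_form M \<epsilon> (int p)) a x v' js = 0" if "length js \<noteq> p" for v' js
      using that by (simp add: nabla_def chi_form_nat)
    have 1: "contract (iprod v (F a x)) (chi_form M \<epsilon> (int p + 1) a x) is = 0"
      unfolding contract_1[OF iF_homog alternating_chi_form] using False by (simp add: chi_form_0)
    have 2: "wedge (iprod v (F a x)) (chi_form M \<epsilon> (int p - 1) a x) is = 0"
      unfolding wedge_1[OF iF_homog alternating_chi_form] using False by (intro ext1_0) (auto simp: chi_form_0)
    have 3: "ext_d M (chi_form M \<epsilon> (int p)) a x (j # is) = 0" for j
      unfolding e using False by (intro ext1_0 n0) auto
    have 4: "contract (F a x) (chi_form M \<epsilon> (int p + 1) a x) (j # is) = 0" for j
      unfolding contract_2[OF F_homog alternating_chi_form] using False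
      by (intro ext1_0) (simp add: chi_form_0)
    have "2 * wedge (F a x) (chi_form M \<epsilon> (int p - 1) a x) (j # is) = 0" for j
      unfolding wedge_2[OF F_homog alternating_chi_form] using False
      by (intro ext1_0) (simp add: chi_form_0)
    then have 5: "wedge (F a x) (chi_form M \<epsilon> (int p - 1) a x) (j # is) = 0" for j by simp
    have 6: "vee (F a x) (chi_form M \<epsilon> (int p + 1) a x) js = 0" if "Suc (length js) = length is" for js
    proof -
      have "2 * vee (F a x) (chi_form M \<epsilon> (int p + 1) a x) js = 0"
        unfolding vee_2[OF F_homog F_alternating] using False that by (simp add: chi_form_0)
      then show ?thesis by simp
    qed
    have 7: "contract (F a x) (chi_form M \<epsilon> (int p - 1) a x) js = 0" if "Suc (length js) = length is" for js
      unfolding contract_2[OF F_homog alternating_chi_form] using False that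
      by (intro ext1_0) (auto simp: chi_form_0)
    have 8: "(\<Sum>i\<in>UNIV. nabla M (chi_form M \<epsilon> (int p)) a x (axis i 1) (i # js)) = 0" if "Suc (length js) = length is" for js
      using False that by (intro sum.neutral ballI n0) simp
    show ?thesis
      unfolding w n0[OF False] 1 2 iprod_def 3 4 5
      by (subst ext1_0) (simp_all add: 6 7 8)
  qed
qed

lemma alternating_hier_P: "alternating (hier_P M k1 k2 F (bilinears M \<epsilon>) a x)"
  unfolding alternating_def hier_P_def Let_def chi_form_abs[symmetric] length_permute_list
  by (simp add: alternatingD[OF alternating_ext_d_chi] alternatingD[OF alternating_contract]
      alternatingD[OF alternating_wedge] chi_form_def[symmetric]) (simp add: algebra_simps)

lemma alternating_hier_Q: "alternating (hier_Q M k1 k2 F (bilinears M \<epsilon>) a x)"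
  unfolding alternating_def hier_Q_def Let_def chi_form_abs[symmetric] length_permute_list
  by (simp add: alternatingD[OF alternating_codiff[OF alternating_nabla_chi]] alternatingD[OF alternating_contract]
      alternatingD[OF alternating_vee[OF alternating_chi_form]] chi_form_def[symmetric]) (simp add: algebra_simps)

text \<open>Lists longer than n include the degree p = n + 1, at which the divisor in
  \<open>hier_Q\<close> is zero. All terms there are alternating, hence zero, whatever value the
  quotient has. For shorter lists the equation is \<open>hierarchy_degree\<close>, one degree at a
  time.\<close>

lemma hierarchy_equation:
  "twisted_nabla M (hier_C k1 k2) F (bilinears M \<epsilon>) a x v is =
   iprod v (hier_P M k1 k2 F (bilinears M \<epsilon>) a x) is + wedge (flat v) (hier_Q M k1 k2 F (bilinears M \<epsilon>) a x) is"
proof (cases "length is \<le> CARD('n)")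
  case False
  then have l: "CARD('n) < length is" by simp
  have "alternating (nabla M (bilinears M \<epsilon>) a x v)"
    by (intro alternating_nabla alternating_bilinears diff_at_bilinears)
  then show ?thesis
    unfolding twisted_nabla_def
    by (simp add: alternating_long[OF _ l] alternating_hier_C alternating_wedge alternating_iprod alternating_hier_P)
next
  case True
  define p where "p = length is"
  have N: "nabla M (chi_form M \<epsilon> (int p)) a x v is = nabla M (bilinears M \<epsilon>) a x v is"
    by (rule nabla_cong) (simp add: chi_form_def deg_part_def p_def)
  have P: "iprod v (hier_P M k1 k2 F (bilinears M \<epsilon>) a x) is =
    1 / of_int (int p + 1) * iprod v (\<lambda>js. ext_d M (chi_form M \<epsilon> (int p)) a x js
      - acoef (int p) (int p + 1) * kcoef k1 k2 (int p) * contract (F a x) (chi_form M \<epsilon> (int p + 1) a x) js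
      + 2 * acoef (int p) (int p - 1) * kcoef k1 k2 (int p - 1) * wedge (F a x) (chi_form M \<epsilon> (int p - 1) a x) js) is"
    unfolding iprod_def sum_distrib_left
    by (intro sum.cong refl) (simp add: hier_P_def Let_def chi_form_abs p_def)
  define Q where "Q js = codiff M (chi_form M \<epsilon> (int p)) a x js
      + 2 * acoef (int p) (int p + 1) * kcoef k1 k2 (int p) * vee (F a x) (chi_form M \<epsilon> (int p + 1) a x) js
      + acoef (int p) (int p - 1) * kcoef k1 k2 (int p - 1) * contract (F a x) (chi_form M \<epsilon> (int p - 1) a x) js" for js
  have Qalt: "alternating Q"
    unfolding Q_def
    by (intro alternating_hier alternating_codiff alternating_nabla_chi alternating_vee alternating_chi_form alternating_contract)
  have "wedge (flat v) (hier_Q M k1 k2 F (bilinears M \<epsilon>) a x) is =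
      - 1 / of_int (int CARD('n) - int p + 1) * wedge (flat v) Q is"
    unfolding wedge_1[OF homog_flat alternating_hier_Q] wedge_1[OF homog_flat Qalt] ext1_cmult[symmetric]
  proof (rule ext1_cong)
    fix j and js :: "'n list" assume "Suc (length js) = length is"
    \<comment> \<open>On lists of length p - 1 the degree used inside \<open>hier_Q\<close> is this
      p.\<close>
    then have "int p = int (length js) + 1" by (simp add: p_def)
    then show "flat v [j] * hier_Q M k1 k2 F (bilinears M \<epsilon>) a x js =
        - 1 / of_int (int CARD('n) - int p + 1) * (flat v [j] * Q js)"
      by (simp add: hier_Q_def Let_def chi_form_abs Q_def)
  qed
  then show ?thesis
    using hierarchy_degree[of p v "is"] True
    unfolding P twisted_nabla_def hier_C_def Let_def p_def[symmetric] N chi_form_def[symmetric] Q_def[symmetric, abs_def]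
    by (simp add: add.assoc)
qed

end

theorem proposition4p6:
  fixes M :: "('a, 'm::{t2_space,second_countable_topology}, 'n::finite, 's::finite) spin_data"
    and F :: "('a, 'm, 'n) mform_field"
    and k1 k2 :: complex
    and \<epsilon> :: "'a \<Rightarrow> 'm \<Rightarrow> complex^'s"
  assumes "spin_manifold M"
    and "real_form M 2 F"
    and "parallel_spinor M k1 k2 F \<epsilon>"
  shows "covariant_form_hierarchy M (hier_C k1 k2) (hier_P M k1 k2) (hier_Q M k1 k2) F (bilinears M \<epsilon>)
    \<and> (\<forall>p::int. \<forall>Y. 0 \<le> p \<and> p \<le> int CARD('n) \<and> vector_field M Y \<longrightarrow>
        (\<forall>a\<in>patches M. \<forall>x\<in>patch M a. \<forall>is.
          nabla M (chi_form M \<epsilon> p) a x (Y a x) is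
          + acoef p (p+1) * (cnj k2 - 4 * cnj k1 + (-1) powi p * (k2 - 4 * k1))
              * contract (iprod (Y a x) (F a x)) (chi_form M \<epsilon> (p+1) a x) is
          + acoef p (p-1) * (cnj k2 - 4 * cnj k1 + (-1) powi (p-1) * (k2 - 4 * k1))
              * wedge (iprod (Y a x) (F a x)) (chi_form M \<epsilon> (p-1) a x) is
          = 1 / of_int (p+1) * iprod (Y a x) (\<lambda>js.
                ext_d M (chi_form M \<epsilon> p) a x js
                - acoef p (p+1) * (cnj k2 - 4 * cnj k1 + (-1) powi p * (k2 - 4 * k1))
                    * contract (F a x) (chi_form M \<epsilon> (p+1) a x) js
                + 2 * acoef p (p-1) * (cnj k2 - 4 * cnj k1 + (-1) powi (p-1) * (k2 - 4 * k1))
                    * wedge (F a x) (chi_form M \<epsilon> (p-1) a x) js) is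
            - 1 / of_int (int CARD('n) - p + 1) * wedge (flat (Y a x)) (\<lambda>js.
                codiff M (chi_form M \<epsilon> p) a x js
                + 2 * acoef p (p+1) * (cnj k2 - 4 * cnj k1 + (-1) powi p * (k2 - 4 * k1))
                    * vee (F a x) (chi_form M \<epsilon> (p+1) a x) js
                + acoef p (p-1) * (cnj k2 - 4 * cnj k1 + (-1) powi (p-1) * (k2 - 4 * k1))
                    * contract (F a x) (chi_form M \<epsilon> (p-1) a x) js) is))"
proof
  show "covariant_form_hierarchy M (hier_C k1 k2) (hier_P M k1 k2) (hier_Q M k1 k2) F (bilinears M \<epsilon>)"
    unfolding covariant_form_hierarchy_def
  proof (intro conjI ballI allI impI)
    show "multi_form M F" using assms(2) by (simp add: real_form_def)
    show "multi_form M (bilinears M \<epsilon>)"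
      using assms(3) by (intro multi_form_bilinears[OF assms(1)]) (simp add: parallel_spinor_def)
    show "twisting_term (hier_C k1 k2)" by (rule twisting_term_hier_C)
    fix a x assume ax: "a \<in> patches M" "x \<in> patch M a"
    show "alternating (hier_P M k1 k2 F (bilinears M \<epsilon>) a x)"
      by (rule alternating_hier_P[OF assms ax])
    show "alternating (hier_Q M k1 k2 F (bilinears M \<epsilon>) a x)"
      by (rule alternating_hier_Q[OF assms ax])
    fix Y
    show "twisted_nabla M (hier_C k1 k2) F (bilinears M \<epsilon>) a x (Y a x) =
        (\<lambda>is. iprod (Y a x) (hier_P M k1 k2 F (bilinears M \<epsilon>) a x) is +
          wedge (flat (Y a x)) (hier_Q M k1 k2 F (bilinears M \<epsilon>) a x) is)"
      by (rule ext) (rule hierarchy_equation[OF assms ax])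
  qed
  show "\<forall>p::int. \<forall>Y. 0 \<le> p \<and> p \<le> int CARD('n) \<and> vector_field M Y \<longrightarrow>
        (\<forall>a\<in>patches M. \<forall>x\<in>patch M a. \<forall>is.
          nabla M (chi_form M \<epsilon> p) a x (Y a x) is
          + acoef p (p+1) * (cnj k2 - 4 * cnj k1 + (-1) powi p * (k2 - 4 * k1))
              * contract (iprod (Y a x) (F a x)) (chi_form M \<epsilon> (p+1) a x) is
          + acoef p (p-1) * (cnj k2 - 4 * cnj k1 + (-1) powi (p-1) * (k2 - 4 * k1))
              * wedge (iprod (Y a x) (F a x)) (chi_form M \<epsilon> (p-1) a x) is
          = 1 / of_int (p+1) * iprod (Y a x) (\<lambda>js.
                ext_d M (chi_form M \<epsilon> p) a x js
                - acoef p (p+1) * (cnj k2 - 4 * cnj k1 + (-1) powi p * (k2 - 4 * k1))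
                    * contract (F a x) (chi_form M \<epsilon> (p+1) a x) js
                + 2 * acoef p (p-1) * (cnj k2 - 4 * cnj k1 + (-1) powi (p-1) * (k2 - 4 * k1))
                    * wedge (F a x) (chi_form M \<epsilon> (p-1) a x) js) is
            - 1 / of_int (int CARD('n) - p + 1) * wedge (flat (Y a x)) (\<lambda>js.
                codiff M (chi_form M \<epsilon> p) a x js
                + 2 * acoef p (p+1) * (cnj k2 - 4 * cnj k1 + (-1) powi p * (k2 - 4 * k1))
                    * vee (F a x) (chi_form M \<epsilon> (p+1) a x) js
                + acoef p (p-1) * (cnj k2 - 4 * cnj k1 + (-1) powi (p-1) * (k2 - 4 * k1))
                    * contract (F a x) (chi_form M \<epsilon> (p-1) a x) js) is)"
  proof (intro allI ballI impI)
    fix p :: int and Y a x "is"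
    assume p: "0 \<le> p \<and> p \<le> int CARD('n) \<and> vector_field M Y" and ax: "a \<in> patches M" "x \<in> patch M a"
    \<comment> \<open>Degrees are integers in the statement so that p - 1 is available at p = 0; the
      bounds turn p into a natural number.\<close>
    obtain q where q: "p = int q" "q \<le> CARD('n)" using p by (metis nat_0_le nat_le_iff)
    from hierarchy_degree[OF assms ax q(2), of "Y a x" "is"]
    show "nabla M (chi_form M \<epsilon> p) a x (Y a x) is
          + acoef p (p+1) * (cnj k2 - 4 * cnj k1 + (-1) powi p * (k2 - 4 * k1))
              * contract (iprod (Y a x) (F a x)) (chi_form M \<epsilon> (p+1) a x) is
          + acoef p (p-1) * (cnj k2 - 4 * cnj k1 + (-1) powi (p-1) * (k2 - 4 * k1))
              * wedge (iprod (Y a x) (F a x)) (chi_form M \<epsilon> (p-1) a x) is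
          = 1 / of_int (p+1) * iprod (Y a x) (\<lambda>js.
                ext_d M (chi_form M \<epsilon> p) a x js
                - acoef p (p+1) * (cnj k2 - 4 * cnj k1 + (-1) powi p * (k2 - 4 * k1))
                    * contract (F a x) (chi_form M \<epsilon> (p+1) a x) js
                + 2 * acoef p (p-1) * (cnj k2 - 4 * cnj k1 + (-1) powi (p-1) * (k2 - 4 * k1))
                    * wedge (F a x) (chi_form M \<epsilon> (p-1) a x) js) is
            - 1 / of_int (int CARD('n) - p + 1) * wedge (flat (Y a x)) (\<lambda>js.
                codiff M (chi_form M \<epsilon> p) a x js
                + 2 * acoef p (p+1) * (cnj k2 - 4 * cnj k1 + (-1) powi p * (k2 - 4 * k1))
                    * vee (F a x) (chi_form M \<epsilon> (p+1) a x) js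
                + acoef p (p-1) * (cnj k2 - 4 * cnj k1 + (-1) powi (p-1) * (k2 - 4 * k1))
                    * contract (F a x) (chi_form M \<epsilon> (p-1) a x) js) is" unfolding q(1) kcoef_def .
  qed
qed

end
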